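(* Suppose $D(A)\subset W^{1,2}(\mathbb{R}^d)$. Then $C_c^\infty(\mathbb{R}^d)$ is a core for $A$.
   Context: Let $d \in \mathbb{N}$, $\theta \in [0,\frac{\pi}{2})$ and $c_{kl} \in W^{2,\infty}(\mathbb{R}^d,\mathbb{C})$ for all $k,l\in\{1,\dots,d\}$. Set $C=(c_{kl})_{1\le k,l\le d}$ and $\Sigma_\theta=\{re^{i\psi}: r\ge 0,\ |\psi|\le\theta\}$. Assume $(C(x)\xi,\xi)\in\Sigma_\theta$ for all $x\in\mathbb{R}^d$ and $\xi\in\mathbb{C}^d$, where $(\cdot,\cdot)$ is the standard inner product on $\mathbb{C}^d$, linear in the first variable. Function spaces are complex. Define the sesquilinear form $\mathfrak{a}_0(u,v)=\sum_{k,l=1}^d\int_{\mathbb{R}^d}c_{kl}\,(\partial_k u)\,\partial_l\overline{v}$ with domain $C_c^\infty(\mathbb{R}^d)$. It is closable in $L_2(\mathbb{R}^d)$. Let $A$ be the ($m$-sectorial) operator in $L_2(\mathbb{R}^d)$ associated with the closure of $\mathfrak{a}_0$. One has $W^{2,2}(\mathbb{R}^d)\subset D(A)$ and $Au=-\sum_{k,l=1}^d\partial_l(c_{kl}\,\partial_k u)$ for $u\in W^{2,2}(\mathbb{R}^d)$. A core for a closed operator is a subspace of its domain that is dense in the domain for the graph norm. *)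

theory Defs
  imports "HOL-Analysis.Analysis"
begin

text \<open>
  Equivalence classes of functions are represented by arbitrary Borel representatives, and every
  notion for \<open>L\<^sub>2\<close> objects below is invariant under equality almost everywhere. An operator in
  \<open>L\<^sub>2\<close> is given by its graph, a set of pairs of such representatives. Every Lebesgue measurable
  function agrees almost everywhere with a Borel one, so \<open>lborel\<close> yields the usual spaces.
\<close>

primrec C_times :: "nat \<Rightarrow> ('a::euclidean_space \<Rightarrow> complex) \<Rightarrow> bool" where
  "C_times 0 f \<longleftrightarrow> continuous_on UNIV f"
| "C_times (Suc n) f \<longleftrightarrow>
    (\<forall>x. f differentiable at x) \<and> (\<forall>v. C_times n (\<lambda>x. frechet_derivative f (at x) v))"

definition test_functions :: "('a::euclidean_space \<Rightarrow> complex) set" where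
  "test_functions = {f. (\<forall>n. C_times n f) \<and> compact (closure {x. f x \<noteq> 0})}"

definition partial_deriv :: "'n \<Rightarrow> (real^'n \<Rightarrow> complex) \<Rightarrow> real^'n \<Rightarrow> complex" where
  "partial_deriv k f x = frechet_derivative f (at x) (axis k 1)"

definition L2 :: "('a::euclidean_space \<Rightarrow> complex) set" where
  "L2 = {f \<in> borel_measurable lborel. integrable lborel (\<lambda>x. (norm (f x))\<^sup>2)}"

definition L2_inner :: "('a::euclidean_space \<Rightarrow> complex) \<Rightarrow> ('a \<Rightarrow> complex) \<Rightarrow> complex" where
  "L2_inner f g = (\<integral>x. f x * cnj (g x) \<partial>lborel)"

definition L2_norm :: "('a::euclidean_space \<Rightarrow> complex) \<Rightarrow> real" where
  "L2_norm f = sqrt (\<integral>x. (norm (f x))\<^sup>2 \<partial>lborel)"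

definition Linf :: "('a::euclidean_space \<Rightarrow> complex) set" where
  "Linf = {f \<in> borel_measurable lborel. \<exists>M. AE x in lborel. norm (f x) \<le> M}"

definition locally_integrable :: "('a::euclidean_space \<Rightarrow> complex) \<Rightarrow> bool" where
  "locally_integrable f \<longleftrightarrow> (\<forall>K. compact K \<longrightarrow> set_integrable lborel K f)"

definition weak_partial_deriv ::
    "'n \<Rightarrow> (real^'n \<Rightarrow> complex) \<Rightarrow> (real^'n \<Rightarrow> complex) \<Rightarrow> bool" where
  "weak_partial_deriv k f g \<longleftrightarrow> locally_integrable f \<and> locally_integrable g \<and>
    (\<forall>\<phi>\<in>test_functions.
      (\<integral>x. f x * partial_deriv k \<phi> x \<partial>lborel) = - (\<integral>x. g x * \<phi> x \<partial>lborel))"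

text \<open>\<open>sobolev m X\<close> consists of the functions all of whose weak derivatives of order at most
  \<open>m\<close> exist and lie in \<open>X\<close>; thus \<open>W\<^sup>m\<^sup>,\<^sup>2 = sobolev m L2\<close> and \<open>W\<^sup>m\<^sup>,\<^sup>\<infinity> = sobolev m Linf\<close>.\<close>

primrec sobolev :: "nat \<Rightarrow> (real^'n \<Rightarrow> complex) set \<Rightarrow> (real^'n \<Rightarrow> complex) set" where
  "sobolev 0 X = X"
| "sobolev (Suc m) X = {f \<in> X. \<forall>k. \<exists>g \<in> sobolev m X. weak_partial_deriv k f g}"

definition sector :: "real \<Rightarrow> complex set" where
  "sector \<theta> = {rcis r \<psi> | r \<psi>. 0 \<le> r \<and> \<bar>\<psi>\<bar> \<le> \<theta>}"

definition cinner_vec :: "complex^'n \<Rightarrow> complex^'n \<Rightarrow> complex" where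
  "cinner_vec \<xi> \<eta> = (\<Sum>i\<in>UNIV. \<xi> $ i * cnj (\<eta> $ i))"

definition coeff_matrix :: "('n \<Rightarrow> 'n \<Rightarrow> real^'n \<Rightarrow> complex) \<Rightarrow> real^'n \<Rightarrow> complex^'n^'n" where
  "coeff_matrix c x = (\<chi> k l. c k l x)"

type_synonym 'a form = "('a \<Rightarrow> complex) \<Rightarrow> ('a \<Rightarrow> complex) \<Rightarrow> complex"

text \<open>Kato's notion of form convergence: \<open>w n \<rightarrow> u\<close> in \<open>L\<^sub>2\<close> and
  \<open>a (w m - w n) (w m - w n) \<rightarrow> 0\<close>.\<close>

definition form_converges ::
    "('a::euclidean_space \<Rightarrow> complex) set \<Rightarrow> 'a form \<Rightarrow> (nat \<Rightarrow> 'a \<Rightarrow> complex) \<Rightarrow> ('a \<Rightarrow> complex) \<Rightarrow> bool"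
  where
  "form_converges D a w u \<longleftrightarrow> (\<forall>n. w n \<in> D) \<and>
    (\<lambda>n. L2_norm (\<lambda>x. w n x - u x)) \<longlonglongrightarrow> 0 \<and>
    (\<forall>e>0. \<exists>N. \<forall>m\<ge>N. \<forall>n\<ge>N. norm (a (\<lambda>x. w m x - w n x) (\<lambda>x. w m x - w n x)) < e)"

definition closure_domain ::
    "('a::euclidean_space \<Rightarrow> complex) set \<Rightarrow> 'a form \<Rightarrow> ('a \<Rightarrow> complex) set" where
  "closure_domain D a = {u \<in> L2. \<exists>w. form_converges D a w u}"

text \<open>For a closable sectorial form with domain \<open>D\<close> the limit exists for all approximating
  sequences and does not depend on them.\<close>

definition closure_form :: "('a::euclidean_space \<Rightarrow> complex) set \<Rightarrow> 'a form \<Rightarrow> 'a form" where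
  "closure_form D a u v =
    (THE z. \<exists>w w'. form_converges D a w u \<and> form_converges D a w' v \<and>
      (\<lambda>n. a (w n) (w' n)) \<longlonglongrightarrow> z)"

definition associated_operator ::
    "('a::euclidean_space \<Rightarrow> complex) set \<Rightarrow> 'a form \<Rightarrow> (('a \<Rightarrow> complex) \<times> ('a \<Rightarrow> complex)) set" where
  "associated_operator V b = {(u, f). u \<in> V \<and> f \<in> L2 \<and> (\<forall>v\<in>V. b u v = L2_inner f v)}"

definition complex_subspace :: "('a \<Rightarrow> complex) set \<Rightarrow> bool" where
  "complex_subspace S \<longleftrightarrow> (\<lambda>x. 0) \<in> S \<and> (\<forall>u\<in>S. \<forall>v\<in>S. (\<lambda>x. u x + v x) \<in> S) \<and>
    (\<forall>\<alpha>. \<forall>u\<in>S. (\<lambda>x. \<alpha> * u x) \<in> S)"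

definition is_core ::
    "('a::euclidean_space \<Rightarrow> complex) set \<Rightarrow> (('a \<Rightarrow> complex) \<times> ('a \<Rightarrow> complex)) set \<Rightarrow> bool" where
  "is_core S T \<longleftrightarrow> complex_subspace S \<and> S \<subseteq> Domain T \<and>
    (\<forall>(u, f)\<in>T. \<forall>e>0. \<exists>(v, g)\<in>T. v \<in> S \<and>
      L2_norm (\<lambda>x. u x - v x) + L2_norm (\<lambda>x. f x - g x) < e)"

definition elliptic_form :: "('n \<Rightarrow> 'n \<Rightarrow> real^'n \<Rightarrow> complex) \<Rightarrow> (real^'n) form" where
  "elliptic_form c u v =
    (\<Sum>k\<in>UNIV. \<Sum>l\<in>UNIV.
      \<integral>x. c k l x * partial_deriv k u x * partial_deriv l (\<lambda>y. cnj (v y)) x \<partial>lborel)"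

definition elliptic_operator ::
    "('n \<Rightarrow> 'n \<Rightarrow> real^'n \<Rightarrow> complex) \<Rightarrow> ((real^'n \<Rightarrow> complex) \<times> (real^'n \<Rightarrow> complex)) set" where
  "elliptic_operator c =
    associated_operator (closure_domain test_functions (elliptic_form c))
      (closure_form test_functions (elliptic_form c))"

end

theory Submission
  imports Defs
begin

text \<open>
  Let \<open>(u, f)\<close> belong to the graph of the operator \<open>A\<close> and let \<open>J\<^sub>n\<close> denote convolution with
  \<open>dilate (eps n) \<eta>\<close> for a mollifier \<open>\<eta>\<close>. The functions approximating \<open>u\<close> in the graph norm are
  \<open>\<chi>(eps j x) (J\<^sub>n u)(x)\<close>, where \<open>\<chi>\<close> is a test function with \<open>\<chi>(0) = 1\<close>. They are test
  functions, and one lets first \<open>n\<close> and then \<open>j\<close> tend to infinity.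

  The point is the convergence \<open>A J\<^sub>n u \<rightarrow> f\<close>. Integrating by parts against test functions shows that
  \<open>u\<close> solves the equation in the sense of distributions (\<open>operator_weak\<close>). Testing with the translated
  mollifier and using that \<open>u\<close> has weak derivatives \<open>u\<^sub>k\<close> in \<open>L\<^sub>2\<close>, where the hypothesis on the domain enters, gives
  \<open>A J\<^sub>n u - J\<^sub>n f = - (\<Sum>k l. \<partial>\<^sub>l (c\<^sub>k\<^sub>l J\<^sub>n u\<^sub>k - J\<^sub>n (c\<^sub>k\<^sub>l u\<^sub>k)))\<close>.
  The right-hand side is a sum of Friedrichs commutators, differentiated once, applied to functions that
  are merely in \<open>L\<^sub>2\<close>. Each one tends to zero (\<open>commutator_L2_lim\<close>): expanding
  \<open>c\<^sub>k\<^sub>l(x) - c\<^sub>k\<^sub>l(y)\<close> to first order, the linear terms turn into convolutions with the dilated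
  kernels \<open>z\<^sub>m \<partial>\<^sub>l \<eta>(z)\<close>, whose integrals \<open>- \<delta>\<^sub>m\<^sub>l\<close> make the limits cancel the term in which
  the derivative hits the coefficient, while the quadratic remainder gains a factor \<open>eps n\<close>. The expansion holds
  almost everywhere with a uniform remainder because the second weak derivatives of the coefficients are
  bounded (\<open>W2inf_taylor_AE\<close>); it passes to the limit from mollified coefficients.

  Removing the cutoff is harmless (\<open>op_cutoff_L2_lim\<close>), since each derivative that falls on it produces
  a factor \<open>eps j\<close>.

  The remaining part identifies the closed form when one argument is a test function. Sectoriality gives
  a Cauchy-Schwarz type estimate (\<open>form_bound\<close>) and, since the formal operator maps test functions
  into \<open>L\<^sub>2\<close>, closability (\<open>form_closable\<close>). This makes the limits that define
  the closed form independent of the approximating sequences.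
\<close>

section \<open>Smooth functions\<close>

text \<open>
  Differentiation in all directions, rather than along basis vectors only, matches the recursion that
  defines \<open>C_times\<close>.
\<close>

definition dir_deriv :: "'a \<Rightarrow> ('a::euclidean_space \<Rightarrow> complex) \<Rightarrow> 'a \<Rightarrow> complex" where
  "dir_deriv v f x = frechet_derivative f (at x) v"

lemma partial_deriv_eq: "partial_deriv k f = dir_deriv (axis k 1) f"
  by (simp add: fun_eq_iff partial_deriv_def dir_deriv_def)

lemma C_times_Suc_iff:
  "C_times (Suc n) f \<longleftrightarrow> (\<forall>x. f differentiable at x) \<and> (\<forall>v. C_times n (dir_deriv v f))"
  by (simp add: dir_deriv_def[abs_def])

declare C_times.simps(2) [simp del]

lemma dir_deriv_eqI: "(f has_derivative f') (at x) \<Longrightarrow> dir_deriv v f x = f' v"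
  by (metis dir_deriv_def frechet_derivative_at)

lemma has_derivative_dir_deriv:
  "f differentiable at x \<Longrightarrow> (f has_derivative (\<lambda>v. dir_deriv v f x)) (at x)"
  by (simp add: dir_deriv_def frechet_derivative_works)

lemma C_times_imp_continuous: "C_times n f \<Longrightarrow> continuous_on UNIV f"
  by (cases n) (auto simp: C_times_Suc_iff continuous_on_eq_continuous_at differentiable_imp_continuous_within)

lemma C_times_Suc_imp: "C_times (Suc n) f \<Longrightarrow> C_times n f"
proof (induction n arbitrary: f)
  case 0
  then show ?case using C_times_imp_continuous by auto
next
  case (Suc n)
  then show ?case by (metis C_times_Suc_iff)
qed

lemma dir_deriv_const: "dir_deriv v (\<lambda>x. c) = (\<lambda>x. 0)"
  by (auto simp: fun_eq_iff intro!: dir_deriv_eqI)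

lemma C_times_const: "C_times n (\<lambda>x. c)"
proof (induction n arbitrary: c)
  case (Suc n)
  then show ?case by (simp add: C_times_Suc_iff dir_deriv_const)
qed simp

lemma dir_deriv_add:
  assumes "f differentiable at x" "g differentiable at x"
  shows "dir_deriv v (\<lambda>x. f x + g x) x = dir_deriv v f x + dir_deriv v g x"
  using assms by (auto intro!: dir_deriv_eqI derivative_eq_intros has_derivative_dir_deriv)

lemma C_times_add: "C_times n f \<Longrightarrow> C_times n g \<Longrightarrow> C_times n (\<lambda>x. f x + g x)"
proof (induction n arbitrary: f g)
  case 0
  then show ?case by (auto intro: continuous_intros)
next
  case (Suc n)
  have "dir_deriv v (\<lambda>x. f x + g x) = (\<lambda>x. dir_deriv v f x + dir_deriv v g x)" for v
    using Suc.prems by (auto simp: fun_eq_iff C_times_Suc_iff intro!: dir_deriv_add)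
  then show ?case
    using Suc.prems by (auto simp: C_times_Suc_iff intro: Suc.IH differentiable_add)
qed

lemma dir_deriv_mult:
  assumes "f differentiable at x" "g differentiable at x"
  shows "dir_deriv v (\<lambda>x. f x * g x) x = f x * dir_deriv v g x + dir_deriv v f x * g x"
  using assms by (auto intro!: dir_deriv_eqI derivative_eq_intros has_derivative_dir_deriv)

lemma C_times_mult: "C_times n f \<Longrightarrow> C_times n g \<Longrightarrow> C_times n (\<lambda>x. f x * g x)"
proof (induction n arbitrary: f g)
  case 0
  then show ?case by (auto intro: continuous_intros)
next
  case (Suc n)
  have "dir_deriv v (\<lambda>x. f x * g x) = (\<lambda>x. f x * dir_deriv v g x + dir_deriv v f x * g x)" for v
    using Suc.prems by (auto simp: fun_eq_iff C_times_Suc_iff intro!: dir_deriv_mult)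
  moreover have "C_times n (\<lambda>x. f x * dir_deriv v g x + dir_deriv v f x * g x)" for v
    using Suc.prems C_times_Suc_imp[OF Suc.prems(1)] C_times_Suc_imp[OF Suc.prems(2)]
    by (auto simp: C_times_Suc_iff intro!: C_times_add Suc.IH)
  ultimately show ?case using Suc.prems by (auto simp: C_times_Suc_iff intro: differentiable_mult)
qed

lemma dir_deriv_bounded_linear: "bounded_linear h \<Longrightarrow> dir_deriv v h = (\<lambda>x. h v)"
  by (auto simp: fun_eq_iff intro!: dir_deriv_eqI bounded_linear_imp_has_derivative)

lemma C_times_bounded_linear: "bounded_linear h \<Longrightarrow> C_times n h"
proof (cases n)
  case 0
  assume "bounded_linear h"
  with 0 show ?thesis by (simp add: linear_continuous_on)
next
  case (Suc m)
  assume "bounded_linear h"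
  with Suc show ?thesis
    by (auto simp: C_times_Suc_iff dir_deriv_bounded_linear C_times_const
        bounded_linear_imp_differentiable)
qed

lemma dir_deriv_cnj:
  assumes "f differentiable at x"
  shows "dir_deriv v (\<lambda>x. cnj (f x)) x = cnj (dir_deriv v f x)"
  using assms by (auto intro!: dir_deriv_eqI derivative_eq_intros has_derivative_dir_deriv)

lemma differentiable_cnj: "f differentiable at x \<Longrightarrow> (\<lambda>x. cnj (f x)) differentiable at x"
  unfolding differentiable_def by (auto intro: has_derivative_cnj)

lemma C_times_cnj: "C_times n f \<Longrightarrow> C_times n (\<lambda>x. cnj (f x))"
proof (induction n arbitrary: f)
  case 0
  then show ?case by (auto intro: continuous_intros)
next
  case (Suc n)
  have "dir_deriv v (\<lambda>x. cnj (f x)) = (\<lambda>x. cnj (dir_deriv v f x))" for v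
    using Suc.prems by (auto simp: fun_eq_iff C_times_Suc_iff dir_deriv_cnj)
  then show ?case
    using Suc.prems by (auto simp: C_times_Suc_iff intro: Suc.IH differentiable_cnj)
qed

lemma has_derivative_affine_comp:
  fixes f :: "'a::euclidean_space \<Rightarrow> complex"
  assumes "f differentiable at (a + r *\<^sub>R x)"
  shows "((\<lambda>x. f (a + r *\<^sub>R x)) has_derivative (\<lambda>v. r *\<^sub>R dir_deriv v f (a + r *\<^sub>R x))) (at x)"
proof -
  have "((\<lambda>x. a + r *\<^sub>R x) has_derivative (\<lambda>v. r *\<^sub>R v)) (at x)"
    by (auto intro!: derivative_eq_intros)
  from has_derivative_compose[OF this has_derivative_dir_deriv[OF assms]]
  have "((\<lambda>x. f (a + r *\<^sub>R x)) has_derivative (\<lambda>v. dir_deriv (r *\<^sub>R v) f (a + r *\<^sub>R x))) (at x)"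
    by simp
  moreover have "dir_deriv (r *\<^sub>R v) f y = r *\<^sub>R dir_deriv v f y" if "f differentiable at y" for v y
    using linear_frechet_derivative[OF that] by (simp add: dir_deriv_def linear_scale)
  ultimately show ?thesis using assms by simp
qed

lemma dir_deriv_affine:
  fixes f :: "'a::euclidean_space \<Rightarrow> complex"
  assumes "f differentiable at (a + r *\<^sub>R x)"
  shows "dir_deriv v (\<lambda>x. f (a + r *\<^sub>R x)) x = of_real r * dir_deriv v f (a + r *\<^sub>R x)"
  using dir_deriv_eqI[OF has_derivative_affine_comp[OF assms]] by (simp add: scaleR_conv_of_real)

lemma C_times_affine: "C_times n f \<Longrightarrow> C_times n (\<lambda>x. f (a + r *\<^sub>R x))"
proof (induction n arbitrary: f)
  case 0
  then show ?case by (auto intro!: continuous_intros continuous_on_compose2[of UNIV f])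
next
  case (Suc n)
  then have "\<And>x. f differentiable at x" by (simp add: C_times_Suc_iff)
  note d = this
  have "dir_deriv v (\<lambda>x. f (a + r *\<^sub>R x)) = (\<lambda>x. of_real r * dir_deriv v f (a + r *\<^sub>R x))" for v
    by (rule ext, rule dir_deriv_affine, rule d)
  moreover have "(\<lambda>x. f (a + r *\<^sub>R x)) differentiable at x" for x
    by (rule differentiableI) (rule has_derivative_affine_comp[OF d])
  ultimately show ?case
    using Suc.prems by (auto simp: C_times_Suc_iff intro!: C_times_mult C_times_const Suc.IH)
qed

definition smooth :: "('a::euclidean_space \<Rightarrow> complex) \<Rightarrow> bool" where
  "smooth f \<longleftrightarrow> (\<forall>n. C_times n f)"

lemma smooth_differentiable: "smooth f \<Longrightarrow> f differentiable at x"
  by (metis smooth_def C_times_Suc_iff)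

lemma smooth_continuous: "smooth f \<Longrightarrow> continuous_on S f"
  by (metis smooth_def C_times_imp_continuous continuous_on_subset subset_UNIV)

lemma smooth_dir_deriv: "smooth f \<Longrightarrow> smooth (dir_deriv v f)"
  by (metis smooth_def C_times_Suc_iff)

lemma smooth_add: "smooth f \<Longrightarrow> smooth g \<Longrightarrow> smooth (\<lambda>x. f x + g x)"
  by (simp add: smooth_def C_times_add)

lemma smooth_mult: "smooth f \<Longrightarrow> smooth g \<Longrightarrow> smooth (\<lambda>x. f x * g x)"
  by (simp add: smooth_def C_times_mult)

lemma smooth_const: "smooth (\<lambda>x. c)"
  by (simp add: smooth_def C_times_const)

lemma smooth_cnj: "smooth f \<Longrightarrow> smooth (\<lambda>x. cnj (f x))"
  by (simp add: smooth_def C_times_cnj)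

lemma smooth_affine: "smooth f \<Longrightarrow> smooth (\<lambda>x. f (a + r *\<^sub>R x))"
  by (simp add: smooth_def C_times_affine)

lemma smooth_bounded_linear: "bounded_linear f \<Longrightarrow> smooth f"
  by (simp add: smooth_def C_times_bounded_linear)

text \<open>
  Smoothness of functions that come in families closed under differentiation, such as
  the convolutions with test functions, needs no explicit higher derivatives.
\<close>

lemma smooth_coinduct:
  assumes "P f" and step: "\<And>f. P f \<Longrightarrow> (\<forall>x. f differentiable at x) \<and> (\<forall>v. P (dir_deriv v f))"
  shows "smooth f"
proof -
  have "C_times n f" if "P f" for n f using that
  proof (induction n arbitrary: f)
    case 0
    then show ?case using step[of f]
      by (auto simp: continuous_on_eq_continuous_at differentiable_imp_continuous_within)
  next
    case (Suc n)
    then show ?case using step[of f] by (auto simp: C_times_Suc_iff)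
  qed
  with assms show ?thesis by (auto simp: smooth_def)
qed

section \<open>Test functions\<close>

text \<open>
  Compactness of the closed support amounts to boundedness of the support, which is easier to propagate
  through the operations below.
\<close>

lemma test_functions_iff:
  "\<phi> \<in> test_functions \<longleftrightarrow> smooth \<phi> \<and> (\<exists>R. \<forall>x. R < norm x \<longrightarrow> \<phi> x = 0)"
proof -
  have "compact (closure {x. \<phi> x \<noteq> 0}) \<longleftrightarrow> bounded {x. \<phi> x \<noteq> 0}" by simp
  also have "\<dots> \<longleftrightarrow> (\<exists>R. \<forall>x. R < norm x \<longrightarrow> \<phi> x = 0)"
    by (auto simp: bounded_iff not_less) (meson not_less)+
  finally show ?thesis by (simp add: test_functions_def smooth_def)
qed

lemma test_smooth: "\<phi> \<in> test_functions \<Longrightarrow> smooth \<phi>"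
  by (simp add: test_functions_iff)

lemma test_support:
  assumes "\<phi> \<in> test_functions" obtains R where "0 < R" "\<And>x. R < norm x \<Longrightarrow> \<phi> x = 0"
proof -
  obtain R where R: "\<And>x. R < norm x \<Longrightarrow> \<phi> x = 0" using assms by (auto simp: test_functions_iff)
  show ?thesis by (rule that[of "max R 1"]) (auto intro: R)
qed

lemma dir_deriv_zero_outside:
  assumes "\<And>x. R < norm x \<Longrightarrow> \<phi> x = 0" "R < norm x"
  shows "dir_deriv v \<phi> x = 0"
proof -
  have "open {x::'a. R < norm x}" by (intro open_Collect_less continuous_intros)
  then have "(\<phi> has_derivative (\<lambda>v. 0)) (at x)"
    by (rule has_derivative_transform_within_open[OF has_derivative_const[of 0]]) (use assms in auto)
  then show ?thesis by (rule dir_deriv_eqI)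
qed

lemma test_dir_deriv: "\<phi> \<in> test_functions \<Longrightarrow> dir_deriv v \<phi> \<in> test_functions"
  unfolding test_functions_iff using dir_deriv_zero_outside smooth_dir_deriv by metis

lemma test_mult_smooth:
  "\<phi> \<in> test_functions \<Longrightarrow> smooth f \<Longrightarrow> (\<lambda>x. \<phi> x * f x) \<in> test_functions"
  unfolding test_functions_iff by (auto intro: smooth_mult)

lemma smooth_mult_test:
  "smooth f \<Longrightarrow> \<phi> \<in> test_functions \<Longrightarrow> (\<lambda>x. f x * \<phi> x) \<in> test_functions"
  using test_mult_smooth[of \<phi> f] by (simp add: mult.commute)

lemma test_add:
  assumes "\<phi> \<in> test_functions" "\<psi> \<in> test_functions"
  shows "(\<lambda>x. \<phi> x + \<psi> x) \<in> test_functions"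
proof -
  obtain R S where "\<And>x. R < norm x \<Longrightarrow> \<phi> x = 0" "\<And>x. S < norm x \<Longrightarrow> \<psi> x = 0"
    using assms by (auto simp: test_functions_iff)
  then have "\<forall>x. max R S < norm x \<longrightarrow> \<phi> x + \<psi> x = 0" by auto
  then show ?thesis using assms unfolding test_functions_iff by (blast intro: smooth_add)
qed

lemma test_zero: "(\<lambda>x. 0) \<in> test_functions"
  by (auto simp: test_functions_iff smooth_const)

lemma test_cmult: "\<phi> \<in> test_functions \<Longrightarrow> (\<lambda>x. c * \<phi> x) \<in> test_functions"
  using test_mult_smooth[OF _ smooth_const[of c]] by (simp add: mult.commute)

lemma test_diff:
  assumes "\<phi> \<in> test_functions" "\<psi> \<in> test_functions"
  shows "(\<lambda>x. \<phi> x - \<psi> x) \<in> test_functions"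
  using test_add[OF assms(1) test_cmult[OF assms(2), of "-1"]] by simp

lemma test_cnj: "\<phi> \<in> test_functions \<Longrightarrow> (\<lambda>x. cnj (\<phi> x)) \<in> test_functions"
  unfolding test_functions_iff using smooth_cnj by fastforce

lemma test_affine:
  assumes "\<phi> \<in> test_functions" "r \<noteq> 0"
  shows "(\<lambda>x. \<phi> (a + r *\<^sub>R x)) \<in> test_functions"
proof -
  obtain R where R: "\<And>x. R < norm x \<Longrightarrow> \<phi> x = 0" using assms by (auto simp: test_functions_iff)
  have "\<phi> (a + r *\<^sub>R x) = 0" if "(R + norm a) / \<bar>r\<bar> < norm x" for x
  proof -
    have "R + norm a < \<bar>r\<bar> * norm x" using that assms by (simp add: field_simps)
    moreover have "norm (r *\<^sub>R x) \<le> norm (a + r *\<^sub>R x) + norm a"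
      by (metis add.commute norm_triangle_sub add_diff_cancel_left' norm_minus_commute)
    ultimately show ?thesis by (intro R) auto
  qed
  with assms show ?thesis by (auto simp: test_functions_iff intro: smooth_affine)
qed

lemma continuous_bounded_support_bounded:
  fixes f :: "'a::euclidean_space \<Rightarrow> complex"
  assumes "continuous_on UNIV f" "\<And>x. R < norm x \<Longrightarrow> f x = 0"
  obtains M where "0 < M" "\<And>x. norm (f x) \<le> M"
proof -
  have "compact (f ` cball 0 R)"
    using assms(1) by (intro compact_continuous_image) (auto intro: continuous_on_subset)
  then obtain M where M: "\<And>x. x \<in> cball 0 R \<Longrightarrow> norm (f x) \<le> M"
    unfolding bounded_iff[of "f ` cball 0 R"] by (metis compact_imp_bounded bounded_iff imageI)
  have "norm (f x) \<le> max M 1" for x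
  proof (cases "R < norm x")
    case True
    then show ?thesis using assms(2) by simp
  next
    case False
    then show ?thesis using M[of x] by auto
  qed
  then show ?thesis by (intro that[of "max M 1"]) auto
qed

lemma test_bounded:
  assumes "\<phi> \<in> test_functions" obtains M where "0 < M" "\<And>x. norm (\<phi> x) \<le> M"
  using assms continuous_bounded_support_bounded[of \<phi>] unfolding test_functions_iff
  by (metis smooth_continuous)

section \<open>Mean value estimates\<close>

lemma dir_deriv_expand:
  assumes "f differentiable at x"
  shows "dir_deriv v f x = (\<Sum>b\<in>Basis. of_real (v \<bullet> b) * dir_deriv b f x)"
proof -
  have lin: "linear (\<lambda>v. dir_deriv v f x)"
    unfolding dir_deriv_def using assms by (rule linear_frechet_derivative)
  have "dir_deriv v f x = dir_deriv (\<Sum>b\<in>Basis. (v \<bullet> b) *\<^sub>R b) f x"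
    by (simp add: euclidean_representation)
  then show ?thesis
    by (simp add: linear_sum[OF lin] linear_scale[OF lin] scaleR_conv_of_real)
qed

lemma norm_basis_sum_le:
  fixes g :: "'a::euclidean_space \<Rightarrow> complex" and M :: real
  assumes "\<And>b. b \<in> Basis \<Longrightarrow> norm (g b) \<le> M" "0 \<le> M"
  shows "norm (\<Sum>b\<in>Basis. of_real (v \<bullet> b) * g b) \<le> DIM('a) * M * norm v"
proof -
  have "norm (\<Sum>b\<in>Basis. of_real (v \<bullet> b) * g b) \<le> (\<Sum>b\<in>(Basis::'a set). norm v * M)"
  proof (rule order_trans[OF norm_sum sum_mono])
    fix b :: 'a assume b: "b \<in> Basis"
    then show "norm (of_real (v \<bullet> b) * g b) \<le> norm v * M"
      unfolding norm_mult norm_of_real using assms(1)[OF b] assms(2) Basis_le_norm[OF b, of v]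
      by (intro mult_mono) auto
  qed
  then show ?thesis by (simp add: mult_ac)
qed

lemma mean_value_bound:
  fixes f :: "'a::euclidean_space \<Rightarrow> complex" and M :: real
  assumes "\<And>x. f differentiable at x" "\<And>b x. b \<in> Basis \<Longrightarrow> norm (dir_deriv b f x) \<le> M" "0 \<le> M"
  shows "norm (f y - f x) \<le> DIM('a) * M * norm (y - x)"
proof (rule differentiable_bound[of UNIV f "\<lambda>x v. dir_deriv v f x"])
  fix x :: 'a
  show "onorm (\<lambda>v. dir_deriv v f x) \<le> DIM('a) * M"
  proof (rule onorm_le)
    show "norm (dir_deriv v f x) \<le> DIM('a) * M * norm v" for v
      unfolding dir_deriv_expand[OF assms(1), of v] using assms(2,3) by (rule norm_basis_sum_le)
  qed
qed (auto intro!: has_derivative_dir_deriv assms)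

lemma taylor_bound:
  fixes f :: "'a::euclidean_space \<Rightarrow> complex" and L :: real
  assumes d: "\<And>x. f differentiable at x"
    and L: "\<And>b x y. b \<in> Basis \<Longrightarrow> norm (dir_deriv b f y - dir_deriv b f x) \<le> L * norm (y - x)" "0 \<le> L"
  shows "norm (f y - f x - dir_deriv (y - x) f x) \<le> DIM('a) * L * (norm (y - x))\<^sup>2"
proof -
  have "norm (f y - f x - dir_deriv (y - x) f x) \<le> norm (y - x) * (DIM('a) * (L * norm (y - x)))"
  proof (rule differentiable_bound_linearization[where f' = "\<lambda>x v. dir_deriv v f x" and S = "closed_segment x y"])
    show "x \<in> closed_segment x y" by simp
    fix z assume "z \<in> closed_segment x y"
    then have "norm (z - x) \<le> norm (y - x)"
      by (metis dist_norm norm_minus_commute segment_bound(1))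
    then have "L * norm (z - x) \<le> L * norm (y - x)" using L(2) by (rule mult_left_mono)
    then have le: "norm (dir_deriv b f z - dir_deriv b f x) \<le> L * norm (y - x)" if "b \<in> Basis" for b
      using L(1)[OF that, of z x] by linarith
    show "onorm ((\<lambda>v. dir_deriv v f z) - (\<lambda>v. dir_deriv v f x)) \<le> DIM('a) * (L * norm (y - x))"
      unfolding fun_diff_def
    proof (rule onorm_le)
      fix v
      have "dir_deriv v f z - dir_deriv v f x =
          (\<Sum>b\<in>Basis. of_real (v \<bullet> b) * (dir_deriv b f z - dir_deriv b f x))"
        by (simp add: dir_deriv_expand[OF d, of v] sum_subtractf right_diff_distrib)
      then show "norm (dir_deriv v f z - dir_deriv v f x) \<le> DIM('a) * (L * norm (y - x)) * norm v"
        using norm_basis_sum_le[OF le, where v=v] L(2) by simp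
    qed
  next
    show "x + t *\<^sub>R (y - x) \<in> closed_segment x y" if "t \<in> {0..1}" for t
      using that by (auto simp: closed_segment_def algebra_simps intro!: exI[of _ t])
  qed (auto intro!: has_derivative_at_withinI has_derivative_dir_deriv d)
  then show ?thesis by (simp add: power2_eq_square mult_ac)
qed

section \<open>A mollifier\<close>

text \<open>
  The family \<open>t\<^sup>-\<^sup>k exp (- 1 / t)\<close>, extended by zero to \<open>t \<le> 0\<close>, is closed under differentiation up to
  linear combinations. This is what makes the bump function smooth without computing its higher derivatives.
\<close>

definition flat_exp :: "nat \<Rightarrow> real \<Rightarrow> real" where
  "flat_exp k t = (if 0 < t then (1 / t) ^ k * exp (- (1 / t)) else 0)"

lemma flat_exp_tendsto_0: "(flat_exp k \<longlongrightarrow> 0) (at 0)"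
proof -
  have "((\<lambda>t::real. inverse t ^ k / exp (inverse t)) \<longlongrightarrow> 0) (at_right 0)"
    by (rule filterlim_compose[OF tendsto_power_div_exp_0 filterlim_inverse_at_top_right])
  moreover have "\<forall>\<^sub>F t in at_right (0::real). inverse t ^ k / exp (inverse t) = flat_exp k t"
    by (rule eventually_at_right_less[THEN eventually_mono])
       (simp add: flat_exp_def exp_minus divide_simps)
  ultimately have "(flat_exp k \<longlongrightarrow> 0) (at_right 0)"
    by (rule Lim_transform_eventually)
  moreover have "(flat_exp k \<longlongrightarrow> 0) (at_left 0)"
  proof (rule Lim_transform_eventually[OF tendsto_const])
    show "\<forall>\<^sub>F t in at_left (0::real). 0 = flat_exp k t"
      by (auto simp: flat_exp_def eventually_at_filter)
  qed
  ultimately show ?thesis by (simp add: filterlim_at_split)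
qed

lemma flat_exp_has_derivative:
  "(flat_exp k has_real_derivative (- real k * flat_exp (k + 1) t + flat_exp (k + 2) t)) (at t)"
proof (cases t "0::real" rule: linorder_cases)
  case less
  have "(flat_exp k has_real_derivative 0) (at t)"
    by (rule has_field_derivative_transform_within_open[of "\<lambda>t. 0" _ _ "{..<0}"])
       (use less in \<open>auto simp: flat_exp_def\<close>)
  with less show ?thesis by (simp add: flat_exp_def)
next
  case equal
  have "(flat_exp k (0 + h) - flat_exp k 0) / h = flat_exp (Suc k) h" for h
    by (simp add: flat_exp_def)
  then have "(flat_exp k has_real_derivative 0) (at 0)"
    unfolding DERIV_def using flat_exp_tendsto_0[of "Suc k"] by simp
  with equal show ?thesis by (simp add: flat_exp_def)
next
  case greater
  have "((\<lambda>t. (1 / t) ^ k * exp (- (1 / t))) has_real_derivative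
      (- real k * flat_exp (k + 1) t + flat_exp (k + 2) t)) (at t)"
  proof (cases k)
    case 0
    show ?thesis using greater
      by (auto simp: 0 flat_exp_def power2_eq_square intro!: derivative_eq_intros)
  next
    case (Suc j)
    show ?thesis using greater
      by (auto simp: Suc flat_exp_def intro!: derivative_eq_intros)
         (cases j; auto simp: field_simps)
  qed
  then show ?thesis
    by (rule has_field_derivative_transform_within_open[of _ _ _ "{0<..}"])
       (use greater in \<open>auto simp: flat_exp_def\<close>)
qed

text \<open>
  A radial function supported in the closed unit ball; its first derivatives are members
  of this family multiplied by linear functions.
\<close>

definition bump :: "nat \<Rightarrow> 'a::euclidean_space \<Rightarrow> complex" where
  "bump k x = of_real (flat_exp k (1 - x \<bullet> x))"

lemma bump_has_derivative:
  "(bump k has_derivative (\<lambda>v. (of_real (- real k) * bump (k + 1) x + bump (k + 2) x) *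
      (of_real (- 2) * of_real (v \<bullet> x)))) (at x)"
proof -
  have "((\<lambda>x. 1 - x \<bullet> x) has_derivative (\<lambda>v. - 2 * (v \<bullet> x))) (at x)"
    by (auto intro!: derivative_eq_intros simp: inner_commute)
  from has_derivative_compose[OF this has_field_derivative_imp_has_derivative[OF flat_exp_has_derivative]]
  have "((\<lambda>x. flat_exp k (1 - x \<bullet> x)) has_derivative
     (\<lambda>v. (- real k * flat_exp (k + 1) (1 - x \<bullet> x) + flat_exp (k + 2) (1 - x \<bullet> x)) * (- 2 * (v \<bullet> x)))) (at x)" .
  then have "((\<lambda>x. complex_of_real (flat_exp k (1 - x \<bullet> x))) has_derivative (\<lambda>v. of_real
     ((- real k * flat_exp (k + 1) (1 - x \<bullet> x) + flat_exp (k + 2) (1 - x \<bullet> x)) * (- 2 * (v \<bullet> x))))) (at x)"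
    by (rule bounded_linear.has_derivative[OF bounded_linear_of_real])
  then show ?thesis unfolding bump_def[abs_def] by simp
qed

lemma smooth_bump: "smooth (bump k :: 'a::euclidean_space \<Rightarrow> complex)"
proof -
  have "C_times n (bump k :: 'a \<Rightarrow> complex)" for n
  proof (induction n arbitrary: k)
    case 0
    then show ?case
      by (simp add: continuous_on_eq_continuous_at has_derivative_continuous[OF bump_has_derivative])
  next
    case (Suc n)
    have "dir_deriv v (bump k) = (\<lambda>x. (of_real (- real k) * bump (k + 1) x + bump (k + 2) x) *
      (of_real (- 2) * of_real (v \<bullet> x)))" for v :: 'a
      by (rule ext) (rule dir_deriv_eqI[OF bump_has_derivative])
    moreover have lin: "C_times n (\<lambda>x. complex_of_real (v \<bullet> x))" for v :: 'a
      by (intro C_times_bounded_linear bounded_linear_compose[OF bounded_linear_of_real]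
          bounded_linear_inner_right)
    moreover have "C_times n (\<lambda>x. (of_real (- real k) * bump (k + 1) x + bump (k + 2) x) *
      (of_real (- 2) * of_real (v \<bullet> x)))" for v :: 'a
      by (rule C_times_mult[OF C_times_add[OF C_times_mult[OF C_times_const Suc] Suc]
            C_times_mult[OF C_times_const lin]])
    moreover have "bump k differentiable at x" for x :: 'a
      by (rule differentiableI) (rule bump_has_derivative)
    ultimately show ?case unfolding C_times_Suc_iff by simp
  qed
  then show ?thesis by (simp add: smooth_def)
qed

lemma continuous_bounded_support_integrable:
  fixes f :: "'a::euclidean_space \<Rightarrow> 'b::{banach, second_countable_topology}"
  assumes "continuous_on UNIV f" "\<And>x. R < norm x \<Longrightarrow> f x = 0"
  shows "integrable lborel f"
proof -
  have "set_integrable lborel (cball 0 R) f"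
    unfolding set_integrable_def
    by (rule borel_integrable_compact) (auto intro: continuous_on_subset[OF assms(1)])
  then have "integrable lborel (\<lambda>x. indicator (cball 0 R) x *\<^sub>R f x)"
    by (simp add: set_integrable_def)
  moreover have "(\<lambda>x. indicator (cball 0 R) x *\<^sub>R f x) = f"
    using assms(2) by (auto simp: fun_eq_iff indicator_def)
  ultimately show ?thesis by simp
qed

lemma exists_mollifier:
  obtains \<eta> :: "'a::euclidean_space \<Rightarrow> complex" where
    "\<eta> \<in> test_functions" "\<And>x. 1 < norm x \<Longrightarrow> \<eta> x = 0" "\<And>x. \<eta> x = of_real (norm (\<eta> x))"
    "\<eta> 0 \<noteq> 0" "(\<integral>x. \<eta> x \<partial>lborel) = 1"
proof -
  let ?b = "bump 0 :: 'a \<Rightarrow> complex" and ?r = "\<lambda>x::'a. flat_exp 0 (1 - x \<bullet> x)"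
  have supp: "?r x = 0" if "1 < norm x" for x
    using that unfolding flat_exp_def by (simp add: power2_norm_eq_inner[symmetric] one_less_power not_less)
  have cont: "continuous_on UNIV ?r"
    using continuous_on_Re[OF smooth_continuous[OF smooth_bump[of 0]]] by (simp add: bump_def)
  have int: "integrable lborel ?r"
    using cont supp by (rule continuous_bounded_support_integrable)
  have nn: "0 \<le> ?r x" for x by (simp add: flat_exp_def)
  define I where "I = (\<integral>x. ?r x \<partial>lborel)"
  have "I \<noteq> 0"
  proof
    assume "I = 0"
    then have ae: "AE x in lborel. ?r x = 0"
      using integral_nonneg_eq_0_iff_AE[OF int] nn by (auto simp: I_def)
    have "?r x \<noteq> 0" if "x \<in> ball 0 1" for x
      using that by (simp add: flat_exp_def power2_norm_eq_inner[symmetric] power_less_one_iff)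
    then have "AE x in lborel. x \<notin> ball (0::'a) 1"
      using ae by (auto elim!: eventually_mono)
    then have "emeasure lborel (ball (0::'a) 1) = 0"
      by (subst (asm) AE_iff_measurable[where N = "ball 0 1"]) auto
    then have "measure lborel (ball (0::'a) 1) = 0" by (simp add: measure_def)
    then show False using content_ball_pos[of 1 "0::'a"] by simp
  qed
  moreover have "0 \<le> I" unfolding I_def using nn by (intro integral_nonneg_AE) auto
  ultimately have I: "0 < I" by simp
  define \<eta> where "\<eta> x = of_real (1 / I) * ?b x" for x
  have \<eta>: "\<eta> x = of_real (?r x / I)" for x by (simp add: \<eta>_def bump_def)
  show thesis
  proof
    show s: "\<eta> x = 0" if "1 < norm x" for x using supp[OF that] by (simp add: \<eta>)
    show "\<eta> \<in> test_functions"
    proof -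
      have "smooth \<eta>" unfolding \<eta>_def[abs_def] by (intro smooth_mult smooth_const smooth_bump)
      then show ?thesis unfolding test_functions_iff using s by blast
    qed
    show "\<eta> x = of_real (norm (\<eta> x))" for x
      unfolding \<eta> norm_of_real using nn[of x] I by simp
    show "\<eta> 0 \<noteq> 0" using I by (simp add: \<eta> flat_exp_def)
    show "(\<integral>x. \<eta> x \<partial>lborel) = 1"
      unfolding \<eta> integral_of_real using I by (simp add: I_def)
  qed
qed

section \<open>Convolution with test functions\<close>

lemma finite_family_bound:
  assumes "finite I" "\<And>i. i \<in> I \<Longrightarrow> \<exists>M. \<forall>x. norm (g i x) \<le> M"
  obtains M :: real where "0 \<le> M" "\<And>i x. i \<in> I \<Longrightarrow> norm (g i x) \<le> M"
proof -
  obtain M where M: "\<And>i x. i \<in> I \<Longrightarrow> norm (g i x) \<le> M i" using assms(2) by metis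
  show ?thesis
  proof
    show "0 \<le> (\<Sum>i\<in>I. \<bar>M i\<bar>)" by (simp add: sum_nonneg)
    fix i x assume i: "i \<in> I"
    have "norm (g i x) \<le> \<bar>M i\<bar>" using M[OF i, of x] by simp
    also have "\<dots> \<le> (\<Sum>i\<in>I. \<bar>M i\<bar>)"
      using i assms(1) by (intro member_le_sum) auto
    finally show "norm (g i x) \<le> (\<Sum>i\<in>I. \<bar>M i\<bar>)" .
  qed
qed

lemma test_taylor:
  fixes \<phi> :: "'a::euclidean_space \<Rightarrow> complex"
  assumes "\<phi> \<in> test_functions"
  obtains M where "0 \<le> M" "\<And>x h. norm (\<phi> (x + h) - \<phi> x - dir_deriv h \<phi> x) \<le> M * (norm h)\<^sup>2"
proof -
  obtain M where M: "0 \<le> M"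
      "\<And>p x. p \<in> Basis \<times> Basis \<Longrightarrow> norm (dir_deriv (snd p) (dir_deriv (fst p) \<phi>) x) \<le> M"
  proof (rule finite_family_bound[of "Basis \<times> Basis" "\<lambda>p. dir_deriv (snd p) (dir_deriv (fst p) \<phi>)"])
    show "\<exists>M. \<forall>x. norm (dir_deriv (snd p) (dir_deriv (fst p) \<phi>) x) \<le> M" for p :: "'a \<times> 'a"
      using test_bounded[OF test_dir_deriv[OF test_dir_deriv[OF assms]]] by metis
  qed auto
  have d: "dir_deriv b \<phi> differentiable at x" "\<phi> differentiable at x" for b x
    using assms by (auto intro!: smooth_differentiable test_smooth test_dir_deriv)
  have "norm (dir_deriv b \<phi> y - dir_deriv b \<phi> x) \<le> DIM('a) * M * norm (y - x)" if "b \<in> Basis" for b x y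
    using M(2)[of "(b, _)"] that by (intro mean_value_bound d M(1)) auto
  note taylor_bound[OF d(2) this]
  then have "norm (\<phi> y - \<phi> x - dir_deriv (y - x) \<phi> x) \<le> DIM('a) * (DIM('a) * M) * (norm (y - x))\<^sup>2" for x y
    using M(1) by simp
  from this[of "x + h" x for x h] show ?thesis
    using M(1) by (intro that[of "DIM('a) * (DIM('a) * M)"]) auto
qed

lemma locally_integrable_mult:
  fixes f g :: "'a::euclidean_space \<Rightarrow> complex"
  assumes f: "locally_integrable f" and g: "continuous_on UNIV g" "\<And>x. R < norm x \<Longrightarrow> g x = 0"
  shows "integrable lborel (\<lambda>x. f x * g x)"
proof -
  let ?f = "\<lambda>x. indicator (cball 0 R) x *\<^sub>R f x"
  have int: "integrable lborel ?f"
    using f by (simp add: locally_integrable_def set_integrable_def)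
  obtain M where M: "\<And>x. norm (g x) \<le> M" using continuous_bounded_support_bounded[OF g] by metis
  have eq: "(\<lambda>x. f x * g x) = (\<lambda>x. ?f x * g x)"
    using g(2) by (auto simp: fun_eq_iff indicator_def)
  have "integrable lborel (\<lambda>x. ?f x * g x)"
  proof (rule Bochner_Integration.integrable_bound)
    show "integrable lborel (\<lambda>x. M *\<^sub>R ?f x)" using int by (rule integrable_scaleR_right)
    have [measurable]: "g \<in> borel_measurable borel" using g(1) by (rule borel_measurable_continuous_onI)
    have "?f \<in> borel_measurable lborel" using int by auto
    then show "(\<lambda>x. ?f x * g x) \<in> borel_measurable lborel" by measurable
    show "AE x in lborel. norm (?f x * g x) \<le> norm (M *\<^sub>R ?f x)"
    proof (rule AE_I2)
      fix x
      have "norm (?f x) * norm (g x) \<le> norm (?f x) * \<bar>M\<bar>"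
        using M[of x] by (intro mult_left_mono) auto
      then show "norm (?f x * g x) \<le> norm (M *\<^sub>R ?f x)"
        unfolding norm_mult norm_scaleR[of M] by (simp only: mult.commute)
    qed
  qed
  then show ?thesis by (simp add: eq)
qed

lemma locally_integrable_mult_test:
  "locally_integrable f \<Longrightarrow> \<phi> \<in> test_functions \<Longrightarrow> integrable lborel (\<lambda>x. f x * \<phi> x)"
  unfolding test_functions_iff using locally_integrable_mult smooth_continuous by metis

lemma test_reflect: "\<phi> \<in> test_functions \<Longrightarrow> (\<lambda>y. \<phi> (x - y)) \<in> test_functions"
  using test_affine[of \<phi> "-1" x] by simp

definition conv :: "('a::euclidean_space \<Rightarrow> complex) \<Rightarrow> ('a \<Rightarrow> complex) \<Rightarrow> 'a \<Rightarrow> complex" where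
  "conv f \<phi> x = (\<integral>y. f y * \<phi> (x - y) \<partial>lborel)"

lemma conv_integrable:
  "locally_integrable f \<Longrightarrow> \<phi> \<in> test_functions \<Longrightarrow> integrable lborel (\<lambda>y. f y * \<phi> (x - y))"
  by (intro locally_integrable_mult_test test_reflect)

text \<open>
  Only the kernel is differentiated. Its second order Taylor remainder is bounded by a multiple of
  \<open>(norm h)\<^sup>2\<close> and is supported in a fixed ball when \<open>norm h \<le> 1\<close>, where \<open>f\<close> is integrable.
\<close>

lemma conv_has_derivative:
  fixes f :: "'a::euclidean_space \<Rightarrow> complex"
  assumes f: "locally_integrable f" and \<phi>: "\<phi> \<in> test_functions"
  shows "(conv f \<phi> has_derivative (\<lambda>v. conv f (dir_deriv v \<phi>) x)) (at x)"
proof (rule has_derivativeI)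
  have d: "\<phi> differentiable at x" for x using \<phi> by (auto intro!: smooth_differentiable test_smooth)
  note int = conv_integrable[OF f \<phi>] conv_integrable[OF f test_dir_deriv[OF \<phi>]]
  have "conv f (dir_deriv v \<phi>) x = (\<Sum>b\<in>Basis. of_real (v \<bullet> b) * conv f (dir_deriv b \<phi>) x)" for v
    unfolding conv_def dir_deriv_expand[OF d, of v] sum_distrib_left
    by (subst Bochner_Integration.integral_sum)
       (simp_all add: mult.left_commute[of _ "of_real _"] int)
  note eq = this
  show "bounded_linear (\<lambda>v. conv f (dir_deriv v \<phi>) x)"
    by (subst eq) (intro bounded_linear_sum bounded_linear_mult_const
        bounded_linear_compose[OF bounded_linear_of_real] bounded_linear_inner_left)
  obtain M where M: "0 \<le> M" "\<And>x h. norm (\<phi> (x + h) - \<phi> x - dir_deriv h \<phi> x) \<le> M * (norm h)\<^sup>2"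
    using \<phi> by (rule test_taylor) auto
  obtain R where R: "0 < R" "\<And>x. R < norm x \<Longrightarrow> \<phi> x = 0" using \<phi> by (rule test_support) auto
  let ?K = "cball x (R + 1)"
  define C where "C = (\<integral>y. norm (indicator ?K y *\<^sub>R f y) \<partial>lborel)"
  have intK: "integrable lborel (\<lambda>y. indicator ?K y *\<^sub>R f y)"
    using f by (simp add: locally_integrable_def set_integrable_def)
  have bound: "norm (conv f \<phi> y - conv f \<phi> x - conv f (dir_deriv (y - x) \<phi>) x) \<le> M * C * (norm (y - x))\<^sup>2"
    if "norm (y - x) \<le> 1" for y
  proof -
    let ?h = "y - x"
    let ?r = "\<lambda>z. f z * \<phi> (y - z) - f z * \<phi> (x - z) - f z * dir_deriv ?h \<phi> (x - z)"
    have "norm (?r z) \<le> M * (norm ?h)\<^sup>2 * norm (indicator ?K z *\<^sub>R f z)" for z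
    proof (cases "z \<in> ?K")
      case True
      have "norm (f z) * norm (\<phi> ((x - z) + ?h) - \<phi> (x - z) - dir_deriv ?h \<phi> (x - z))
          \<le> norm (f z) * (M * (norm ?h)\<^sup>2)"
        by (intro mult_left_mono M) auto
      with True show ?thesis
        by (simp add: norm_mult[symmetric] right_diff_distrib mult_ac)
    next
      case False
      then have x: "R + 1 < norm (x - z)" by (simp add: dist_norm)
      moreover have "norm (x - z) \<le> norm (y - z) + norm ?h"
        using norm_triangle_ineq4[of "y - z" ?h] by simp
      ultimately have "R < norm (y - z)" using that by linarith
      then show ?thesis using x R M(1) dir_deriv_zero_outside[of R \<phi> "x - z"] by simp
    qed
    then have "norm (\<integral>z. ?r z \<partial>lborel) \<le> (\<integral>z. M * (norm ?h)\<^sup>2 * norm (indicator ?K z *\<^sub>R f z) \<partial>lborel)"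
      using intK
      by (intro order_trans[OF integral_norm_bound integral_mono] integrable_norm
          Bochner_Integration.integrable_diff integrable_mult_right int)
    moreover have "(\<integral>z. ?r z \<partial>lborel) = conv f \<phi> y - conv f \<phi> x - conv f (dir_deriv ?h \<phi>) x"
      unfolding conv_def by (simp add: int)
    ultimately show ?thesis unfolding integral_mult_right_zero C_def[symmetric] by (simp add: mult_ac)
  qed
  show "((\<lambda>y. (conv f \<phi> y - conv f \<phi> x - conv f (dir_deriv (y - x) \<phi>) x) /\<^sub>R norm (y - x)) \<longlongrightarrow> 0) (at x)"
  proof (rule Lim_null_comparison)
    have "eventually (\<lambda>y. y \<in> ball x 1) (at x)" by (intro eventually_at_in_open') auto
    then show "\<forall>\<^sub>F y in at x. norm ((conv f \<phi> y - conv f \<phi> x - conv f (dir_deriv (y - x) \<phi>) x) /\<^sub>R norm (y - x))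
        \<le> M * C * norm (y - x)"
    proof eventually_elim
      case (elim y)
      then have "norm (y - x) \<le> 1" by (simp add: dist_norm norm_minus_commute)
      from bound[OF this] show ?case
        by (cases "y = x") (auto simp: divide_simps power2_eq_square mult_ac)
    qed
    have "((\<lambda>y. M * C * norm (y - x)) \<longlongrightarrow> M * C * norm (x - x)) (at x)"
      by (intro tendsto_intros)
    then show "((\<lambda>y. M * C * norm (y - x)) \<longlongrightarrow> 0) (at x)" by simp
  qed
qed

lemma dir_deriv_conv:
  "locally_integrable f \<Longrightarrow> \<phi> \<in> test_functions \<Longrightarrow> dir_deriv v (conv f \<phi>) = conv f (dir_deriv v \<phi>)"
  by (rule ext) (rule dir_deriv_eqI[OF conv_has_derivative])

lemma smooth_conv:
  assumes "locally_integrable f" "\<phi> \<in> test_functions"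
  shows "smooth (conv f \<phi>)"
proof (rule smooth_coinduct[where P = "\<lambda>g. \<exists>\<phi>\<in>test_functions. g = conv f \<phi>"])
  show "\<exists>\<psi>\<in>test_functions. conv f \<phi> = conv f \<psi>" using assms by blast
  fix g assume "\<exists>\<phi>\<in>test_functions. g = conv f \<phi>"
  then obtain \<psi> where \<psi>: "\<psi> \<in> test_functions" "g = conv f \<psi>" by blast
  have "g differentiable at x" for x
    unfolding \<psi>(2) by (rule differentiableI) (rule conv_has_derivative[OF assms(1) \<psi>(1)])
  then show "(\<forall>x. g differentiable at x) \<and> (\<forall>v. \<exists>\<phi>\<in>test_functions. dir_deriv v g = conv f \<phi>)"
    using dir_deriv_conv[OF assms(1) \<psi>(1)] test_dir_deriv[OF \<psi>(1)] \<psi>(2) by auto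
qed

lemma integral_affine:
  fixes f :: "'a::euclidean_space \<Rightarrow> complex"
  assumes [measurable]: "f \<in> borel_measurable borel" and "r \<noteq> 0"
  shows "(\<integral>y. f y \<partial>lborel) = of_real (\<bar>r\<bar> ^ DIM('a)) * (\<integral>y. f (a + r *\<^sub>R y) \<partial>lborel)"
proof -
  have "(\<integral>y. f y \<partial>lborel) =
      integral\<^sup>L (density (distr lborel borel (\<lambda>x. a + r *\<^sub>R x)) (\<lambda>_. ennreal (\<bar>r\<bar>^DIM('a)))) f"
    using lborel_affine[OF assms(2), of a] by (simp add: ennreal_power)
  also have "\<dots> = integral\<^sup>L (distr lborel borel (\<lambda>x. a + r *\<^sub>R x)) (\<lambda>y. (\<bar>r\<bar>^DIM('a)) *\<^sub>R f y)"
    by (intro integral_density) auto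
  also have "\<dots> = (\<integral>y. (\<bar>r\<bar>^DIM('a)) *\<^sub>R f (a + r *\<^sub>R y) \<partial>lborel)"
    by (intro integral_distr) auto
  finally show ?thesis by (simp add: scaleR_conv_of_real)
qed

lemma locally_integrable_const: "locally_integrable (\<lambda>x. c)"
  unfolding locally_integrable_def set_integrable_def by (auto intro: borel_integrable_compact)

text \<open>
  The convolution of a test function with the constant function \<open>1\<close> is constant, so its derivative, which
  is the integral of the derivative of the test function, vanishes.
\<close>

lemma integral_dir_deriv_test:
  fixes \<phi> :: "'a::euclidean_space \<Rightarrow> complex"
  assumes "\<phi> \<in> test_functions"
  shows "(\<integral>x. dir_deriv v \<phi> x \<partial>lborel) = 0"
proof -
  have meas: "\<psi> \<in> borel_measurable borel" if "\<psi> \<in> test_functions" for \<psi> :: "'a \<Rightarrow> complex"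
    using that by (intro borel_measurable_continuous_onI smooth_continuous test_smooth)
  have c: "conv (\<lambda>y. 1) \<psi> x = (\<integral>y. \<psi> y \<partial>lborel)" if "\<psi> \<in> test_functions" for \<psi> :: "'a \<Rightarrow> complex" and x
    unfolding conv_def using integral_affine[OF meas[OF that], of "-1" x] by simp
  then have "conv (\<lambda>y. 1) \<phi> = (\<lambda>x. \<integral>y. \<phi> y \<partial>lborel)" using assms by (simp add: fun_eq_iff)
  then have "dir_deriv v (conv (\<lambda>y. 1) \<phi>) 0 = 0" by (simp add: dir_deriv_const)
  then show ?thesis
    using assms by (simp add: dir_deriv_conv locally_integrable_const c test_dir_deriv)
qed

section \<open>The space L2\<close>

lemma L2_measurable: "f \<in> L2 \<Longrightarrow> f \<in> borel_measurable borel"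
  by (simp add: L2_def)

lemma L2_integrable: "f \<in> L2 \<Longrightarrow> integrable lborel (\<lambda>x. (norm (f x))\<^sup>2)"
  by (simp add: L2_def)

lemma L2I:
  "f \<in> borel_measurable borel \<Longrightarrow> integrable lborel (\<lambda>x. (norm (f x))\<^sup>2) \<Longrightarrow> f \<in> L2"
  by (simp add: L2_def)

lemma L2_norm_nonneg: "0 \<le> L2_norm f"
  by (simp add: L2_norm_def integral_nonneg_AE)

lemma L2_norm_square: "(L2_norm f)\<^sup>2 = (\<integral>x. (norm (f x))\<^sup>2 \<partial>lborel)"
  by (simp add: L2_norm_def integral_nonneg_AE)

lemma L2_bounded_by:
  assumes "g \<in> L2" and [measurable]: "f \<in> borel_measurable borel"
    and ae: "AE x in lborel. norm (f x) \<le> C * norm (g x)" and C: "0 \<le> C"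
  shows "f \<in> L2" "L2_norm f \<le> C * L2_norm g"
proof -
  have sq: "AE x in lborel. (norm (f x))\<^sup>2 \<le> C\<^sup>2 * (norm (g x))\<^sup>2"
    using ae by eventually_elim (simp add: power_mult_distrib[symmetric] power_mono)
  have int: "integrable lborel (\<lambda>x. C\<^sup>2 * (norm (g x))\<^sup>2)" using L2_integrable[OF assms(1)] by simp
  have intf: "integrable lborel (\<lambda>x. (norm (f x))\<^sup>2)"
    using int by (rule Bochner_Integration.integrable_bound) (use sq in auto)
  then show "f \<in> L2" by (intro L2I) auto
  have "(L2_norm f)\<^sup>2 \<le> (\<integral>x. C\<^sup>2 * (norm (g x))\<^sup>2 \<partial>lborel)"
    unfolding L2_norm_square by (rule integral_mono_AE[OF intf int sq])
  also have "\<dots> = (C * L2_norm g)\<^sup>2" by (simp add: L2_norm_square power_mult_distrib)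
  finally show "L2_norm f \<le> C * L2_norm g"
    by (rule power2_le_imp_le) (simp add: C L2_norm_nonneg)
qed

lemma L2_mult_bounded:
  assumes "g \<in> L2" "b \<in> borel_measurable borel" "AE x in lborel. norm (b x) \<le> C" "0 \<le> C"
  shows "(\<lambda>x. b x * g x) \<in> L2" "L2_norm (\<lambda>x. b x * g x) \<le> C * L2_norm g"
proof -
  have ae: "AE x in lborel. norm (b x * g x) \<le> C * norm (g x)"
    using assms(3) by eventually_elim (simp add: norm_mult mult_right_mono)
  have [measurable]: "g \<in> borel_measurable borel" "b \<in> borel_measurable borel"
    using assms L2_measurable by auto
  have m: "(\<lambda>x. b x * g x) \<in> borel_measurable borel" by measurable
  show "(\<lambda>x. b x * g x) \<in> L2" "L2_norm (\<lambda>x. b x * g x) \<le> C * L2_norm g"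
    using L2_bounded_by[OF assms(1) m ae assms(4)] by auto
qed

lemma L2_cmult: "g \<in> L2 \<Longrightarrow> (\<lambda>x. c * g x) \<in> L2"
  by (rule L2_mult_bounded[where C = "norm c"]) auto

lemma L2_mult_integrable:
  assumes "f \<in> L2" "g \<in> L2"
  shows "integrable lborel (\<lambda>x. f x * g x)"
proof (rule Bochner_Integration.integrable_bound)
  have [measurable]: "g \<in> borel_measurable borel" "f \<in> borel_measurable borel"
    using assms L2_measurable by auto
  show "integrable lborel (\<lambda>x. (norm (f x))\<^sup>2 + (norm (g x))\<^sup>2)"
    using assms by (intro Bochner_Integration.integrable_add L2_integrable)
  show "(\<lambda>x. f x * g x) \<in> borel_measurable lborel" by measurable
  have "a * b \<le> a\<^sup>2 + b\<^sup>2" if "0 \<le> a" "0 \<le> b" for a b :: real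
    using sum_squares_bound[of a b] mult_nonneg_nonneg[OF that] by linarith
  then show "AE x in lborel. norm (f x * g x) \<le> norm ((norm (f x))\<^sup>2 + (norm (g x))\<^sup>2)"
    by (simp add: norm_mult)
qed

lemma L2_add:
  assumes "f \<in> L2" "g \<in> L2"
  shows "(\<lambda>x. f x + g x) \<in> L2"
proof (rule L2I)
  have [measurable]: "g \<in> borel_measurable borel" "f \<in> borel_measurable borel"
    using assms L2_measurable by auto
  show "(\<lambda>x. f x + g x) \<in> borel_measurable borel" by measurable
  show "integrable lborel (\<lambda>x. (norm (f x + g x))\<^sup>2)"
  proof (rule Bochner_Integration.integrable_bound)
    show "integrable lborel (\<lambda>x. 2 * (norm (f x))\<^sup>2 + 2 * (norm (g x))\<^sup>2)"
      using assms by (intro Bochner_Integration.integrable_add integrable_mult_right L2_integrable)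
    have "(norm (a + b))\<^sup>2 \<le> 2 * (norm a)\<^sup>2 + 2 * (norm b)\<^sup>2" for a b :: complex
    proof -
      have "(norm (a + b))\<^sup>2 \<le> (norm a + norm b)\<^sup>2" by (intro power_mono norm_triangle_ineq) auto
      then show ?thesis using sum_squares_bound[of "norm a" "norm b"] by (simp add: power2_sum)
    qed
    then show "AE x in lborel. norm ((norm (f x + g x))\<^sup>2) \<le> norm (2 * (norm (f x))\<^sup>2 + 2 * (norm (g x))\<^sup>2)"
      by simp
  qed measurable
qed

lemma L2_diff: "f \<in> L2 \<Longrightarrow> g \<in> L2 \<Longrightarrow> (\<lambda>x. f x - g x) \<in> L2"
  using L2_add[OF _ L2_cmult[of g "-1"], of f] by simp

lemma L2_uminus: "g \<in> L2 \<Longrightarrow> (\<lambda>x. - g x) \<in> L2"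
  using L2_cmult[of g "-1"] by simp

lemma L2_zero: "(\<lambda>x. 0) \<in> L2"
  by (simp add: L2_def)

lemma L2_sum: "finite I \<Longrightarrow> (\<And>i. i \<in> I \<Longrightarrow> f i \<in> L2) \<Longrightarrow> (\<lambda>x. \<Sum>i\<in>I. f i x) \<in> L2"
  by (induction I rule: finite_induct) (auto intro: L2_add L2_zero)

lemma cnj_measurable [measurable]: "cnj \<in> borel_measurable borel"
  by (intro borel_measurable_continuous_onI continuous_intros)

lemma L2_cnj: "f \<in> L2 \<Longrightarrow> (\<lambda>x. cnj (f x)) \<in> L2"
  by (auto simp: L2_def)

lemma L2_norm_abs: "f \<in> L2 \<Longrightarrow> (\<lambda>x. of_real (norm (f x))) \<in> L2"
  by (auto simp: L2_def)

lemma L2_Cauchy_Schwarz: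
  assumes f: "f \<in> L2" and g: "g \<in> L2"
  shows "(\<integral>x. norm (f x) * norm (g x) \<partial>lborel) \<le> L2_norm f * L2_norm g"
proof (rule power2_le_imp_le)
  have [measurable]: "g \<in> borel_measurable borel" "f \<in> borel_measurable borel"
    using assms L2_measurable by auto
  have int: "integrable lborel (\<lambda>x. norm (f x) * norm (g x))"
    using L2_mult_integrable[OF assms, THEN integrable_norm] by (simp add: norm_mult)
  have sq: "(\<integral>\<^sup>+x. (ennreal (norm (h x)))\<^sup>2 \<partial>lborel) = ennreal ((L2_norm h)\<^sup>2)" if "h \<in> L2"
    for h :: "'a \<Rightarrow> complex"
    unfolding L2_norm_square by (subst nn_integral_eq_integral[symmetric])
      (auto simp: ennreal_power L2_integrable that)
  have "ennreal ((\<integral>x. norm (f x) * norm (g x) \<partial>lborel)\<^sup>2)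
      = (\<integral>\<^sup>+x. ennreal (norm (f x)) * ennreal (norm (g x)) \<partial>lborel)\<^sup>2"
    using nn_integral_eq_integral[OF int]
    by (simp add: ennreal_mult ennreal_power[symmetric] integral_nonneg_AE)
  also have "\<dots> \<le> ennreal ((L2_norm f)\<^sup>2) * ennreal ((L2_norm g)\<^sup>2)"
    using Cauchy_Schwarz_nn_integral[of "\<lambda>x. ennreal (norm (f x))" lborel "\<lambda>x. ennreal (norm (g x))"]
    by (simp add: sq f g)
  also have "\<dots> = ennreal ((L2_norm f * L2_norm g)\<^sup>2)"
    by (simp add: ennreal_mult[symmetric] power_mult_distrib)
  finally show "(\<integral>x. norm (f x) * norm (g x) \<partial>lborel)\<^sup>2 \<le> (L2_norm f * L2_norm g)\<^sup>2"
    by (subst (asm) ennreal_le_iff) auto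
  show "0 \<le> L2_norm f * L2_norm g" by (simp add: L2_norm_nonneg)
qed

lemma L2_integral_bound:
  assumes "f \<in> L2" "g \<in> L2"
  shows "norm (\<integral>x. f x * g x \<partial>lborel) \<le> L2_norm f * L2_norm g"
  using integral_norm_bound[of lborel "\<lambda>x. f x * g x"] L2_Cauchy_Schwarz[OF assms]
  by (simp add: norm_mult)

lemma L2_norm_triangle:
  assumes f: "f \<in> L2" and g: "g \<in> L2"
  shows "L2_norm (\<lambda>x. f x + g x) \<le> L2_norm f + L2_norm g"
proof (rule power2_le_imp_le)
  note ints = L2_integrable[OF f] L2_integrable[OF g] L2_integrable[OF L2_add[OF f g]]
  have int: "integrable lborel (\<lambda>x. norm (f x) * norm (g x))"
    using L2_mult_integrable[OF assms, THEN integrable_norm] by (simp add: norm_mult)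
  have "(L2_norm (\<lambda>x. f x + g x))\<^sup>2
      \<le> (\<integral>x. (norm (f x))\<^sup>2 + 2 * (norm (f x) * norm (g x)) + (norm (g x))\<^sup>2 \<partial>lborel)"
    unfolding L2_norm_square
  proof (rule integral_mono)
    fix x
    have "(norm (f x + g x))\<^sup>2 \<le> (norm (f x) + norm (g x))\<^sup>2" by (intro power_mono norm_triangle_ineq) auto
    then show "(norm (f x + g x))\<^sup>2 \<le> (norm (f x))\<^sup>2 + 2 * (norm (f x) * norm (g x)) + (norm (g x))\<^sup>2"
      by (simp add: power2_sum)
  qed (use ints int in auto)
  also have "\<dots> = (L2_norm f)\<^sup>2 + 2 * (\<integral>x. norm (f x) * norm (g x) \<partial>lborel) + (L2_norm g)\<^sup>2"
    using ints int by (simp add: L2_norm_square)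
  also have "\<dots> \<le> (L2_norm f + L2_norm g)\<^sup>2"
    using L2_Cauchy_Schwarz[OF assms] by (simp add: power2_sum)
  finally show "(L2_norm (\<lambda>x. f x + g x))\<^sup>2 \<le> (L2_norm f + L2_norm g)\<^sup>2" .
qed (simp add: L2_norm_nonneg)

lemma L2_norm_minus_commute: "L2_norm (\<lambda>x. f x - g x) = L2_norm (\<lambda>x. g x - f x)"
  by (simp add: L2_norm_def norm_minus_commute)

lemma L2_norm_triangle_diff:
  assumes f: "f \<in> L2" and g: "g \<in> L2" and h: "h \<in> L2"
  shows "L2_norm (\<lambda>x. f x - h x) \<le> L2_norm (\<lambda>x. f x - g x) + L2_norm (\<lambda>x. g x - h x)"
  using L2_norm_triangle[OF L2_diff[OF f g] L2_diff[OF g h]] by simp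

lemma L2_imp_locally_integrable:
  assumes f: "f \<in> L2" shows "locally_integrable f"
  unfolding locally_integrable_def set_integrable_def
proof (intro allI impI)
  fix K :: "'a set" assume "compact K"
  then have K: "K \<in> sets borel" "emeasure lborel K < \<infinity>"
    using emeasure_bounded_finite[OF compact_imp_bounded] by (auto intro: borel_compact)
  moreover have "(\<lambda>x. (norm (indicator K x :: complex))\<^sup>2) = indicat_real K"
    by (auto simp: fun_eq_iff indicator_def)
  ultimately have "(\<lambda>x. indicator K x :: complex) \<in> L2"
    by (intro L2I) (auto intro: integrable_real_indicator)
  moreover have "(\<lambda>x. indicator K x *\<^sub>R f x) = (\<lambda>x. indicator K x * f x)"
    by (auto simp: fun_eq_iff indicator_def)
  ultimately show "integrable lborel (\<lambda>x. indicator K x *\<^sub>R f x)"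
    using L2_mult_integrable[OF _ f] by simp
qed

text \<open>
  Convergence in \<open>L\<^sub>2\<close> with membership built in, so that limits of composite expressions can be
  assembled by introduction rules.
\<close>

definition L2_lim :: "(nat \<Rightarrow> 'a::euclidean_space \<Rightarrow> complex) \<Rightarrow> ('a \<Rightarrow> complex) \<Rightarrow> bool" where
  "L2_lim F f \<longleftrightarrow> (\<forall>n. F n \<in> L2) \<and> f \<in> L2 \<and> (\<lambda>n. L2_norm (\<lambda>x. F n x - f x)) \<longlonglongrightarrow> 0"

lemma L2_limD: "L2_lim F f \<Longrightarrow> F n \<in> L2" "L2_lim F f \<Longrightarrow> f \<in> L2"
  "L2_lim F f \<Longrightarrow> (\<lambda>n. L2_norm (\<lambda>x. F n x - f x)) \<longlonglongrightarrow> 0"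
  by (auto simp: L2_lim_def)

lemma L2_limI_bound:
  assumes "\<And>n. F n \<in> L2" "f \<in> L2" "e \<longlonglongrightarrow> 0" "\<And>n. L2_norm (\<lambda>x. F n x - f x) \<le> e n"
  shows "L2_lim F f"
  unfolding L2_lim_def
proof (intro conjI allI assms)
  show "(\<lambda>n. L2_norm (\<lambda>x. F n x - f x)) \<longlonglongrightarrow> 0"
    by (rule tendsto_sandwich[OF _ _ tendsto_const assms(3)]) (simp_all add: L2_norm_nonneg assms)
qed

lemma L2_lim_const: "f \<in> L2 \<Longrightarrow> L2_lim (\<lambda>n. f) f"
  by (simp add: L2_lim_def L2_norm_def)

lemma L2_lim_add:
  assumes "L2_lim F f" "L2_lim G g"
  shows "L2_lim (\<lambda>n x. F n x + G n x) (\<lambda>x. f x + g x)"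
proof (rule L2_limI_bound)
  note D = L2_limD[OF assms(1)] L2_limD[OF assms(2)]
  show "(\<lambda>n. L2_norm (\<lambda>x. F n x - f x) + L2_norm (\<lambda>x. G n x - g x)) \<longlonglongrightarrow> 0"
    using tendsto_add[OF D(3) D(6)] by simp
  show "L2_norm (\<lambda>x. F n x + G n x - (f x + g x)) \<le> L2_norm (\<lambda>x. F n x - f x) + L2_norm (\<lambda>x. G n x - g x)" for n
    using L2_norm_triangle[OF L2_diff[OF D(1,2)] L2_diff[OF D(4,5)], of n n] by (simp add: algebra_simps)
qed (use assms in \<open>auto simp: L2_lim_def intro: L2_add\<close>)

lemma L2_lim_mult_bounded:
  assumes F: "L2_lim F f" and b: "b \<in> borel_measurable borel" "AE x in lborel. norm (b x) \<le> C"
  shows "L2_lim (\<lambda>n x. b x * F n x) (\<lambda>x. b x * f x)"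
proof (rule L2_limI_bound)
  note D = L2_limD[OF F]
  have C: "AE x in lborel. norm (b x) \<le> \<bar>C\<bar>" "0 \<le> \<bar>C\<bar>" using b(2) by auto
  note m = L2_mult_bounded[OF _ b(1) C]
  show "(\<lambda>n. \<bar>C\<bar> * L2_norm (\<lambda>x. F n x - f x)) \<longlonglongrightarrow> 0"
    using tendsto_mult[OF tendsto_const D(3)] by simp
  show "L2_norm (\<lambda>x. b x * F n x - b x * f x) \<le> \<bar>C\<bar> * L2_norm (\<lambda>x. F n x - f x)" for n
    using m(2)[OF L2_diff[OF D(1,2)], of n] by (simp add: algebra_simps)
  show "(\<lambda>x. b x * F n x) \<in> L2" "(\<lambda>x. b x * f x) \<in> L2" for n
    using m(1) D by auto
qed

lemma L2_lim_cmult: "L2_lim F f \<Longrightarrow> L2_lim (\<lambda>n x. c * F n x) (\<lambda>x. c * f x)"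
  by (rule L2_lim_mult_bounded[where C = "norm c"]) auto

lemma L2_lim_diff:
  "L2_lim F f \<Longrightarrow> L2_lim G g \<Longrightarrow> L2_lim (\<lambda>n x. F n x - G n x) (\<lambda>x. f x - g x)"
  using L2_lim_add[OF _ L2_lim_cmult[of G g "-1"], of F f] by simp

lemma L2_lim_sum:
  "finite I \<Longrightarrow> (\<And>i. i \<in> I \<Longrightarrow> L2_lim (F i) (f i)) \<Longrightarrow>
    L2_lim (\<lambda>n x. \<Sum>i\<in>I. F i n x) (\<lambda>x. \<Sum>i\<in>I. f i x)"
  by (induction I rule: finite_induct) (auto intro: L2_lim_add L2_lim_const L2_zero)

lemma L2_lim_integral:
  assumes F: "L2_lim F f" and G: "L2_lim G g"
  shows "(\<lambda>n. \<integral>x. F n x * G n x \<partial>lborel) \<longlonglongrightarrow> (\<integral>x. f x * g x \<partial>lborel)"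
proof -
  note D = L2_limD[OF F] L2_limD[OF G]
  define B where "B n = L2_norm (\<lambda>x. F n x - f x) * (L2_norm (\<lambda>x. G n x - g x) + L2_norm g)
      + L2_norm f * L2_norm (\<lambda>x. G n x - g x)" for n
  have "norm ((\<integral>x. F n x * G n x \<partial>lborel) - (\<integral>x. f x * g x \<partial>lborel)) \<le> B n" for n
  proof -
    note i = L2_mult_integrable
    have "(\<integral>x. F n x * G n x \<partial>lborel) - (\<integral>x. f x * g x \<partial>lborel)
       = (\<integral>x. (F n x - f x) * G n x + f x * (G n x - g x) \<partial>lborel)"
      using i[OF D(1) D(4), of n n] i[OF D(2) D(5)]
      by (subst Bochner_Integration.integral_diff[symmetric]) (auto simp: algebra_simps)
    also have "\<dots> = (\<integral>x. (F n x - f x) * G n x \<partial>lborel) + (\<integral>x. f x * (G n x - g x) \<partial>lborel)"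
      by (intro Bochner_Integration.integral_add i L2_diff D)
    finally have eq: "(\<integral>x. F n x * G n x \<partial>lborel) - (\<integral>x. f x * g x \<partial>lborel)
       = (\<integral>x. (F n x - f x) * G n x \<partial>lborel) + (\<integral>x. f x * (G n x - g x) \<partial>lborel)" .
    have "norm ((\<integral>x. F n x * G n x \<partial>lborel) - (\<integral>x. f x * g x \<partial>lborel))
       \<le> L2_norm (\<lambda>x. F n x - f x) * L2_norm (G n) + L2_norm f * L2_norm (\<lambda>x. G n x - g x)"
      unfolding eq
      by (rule order_trans[OF norm_triangle_ineq add_mono[OF L2_integral_bound[OF L2_diff[OF D(1,2)] D(4)]
            L2_integral_bound[OF D(2) L2_diff[OF D(4,5)]]]])
    moreover have "L2_norm (G n) \<le> L2_norm (\<lambda>x. G n x - g x) + L2_norm g"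
      using L2_norm_triangle[OF L2_diff[OF D(4,5)] D(5), of n] by simp
    then have "L2_norm (\<lambda>x. F n x - f x) * L2_norm (G n)
        \<le> L2_norm (\<lambda>x. F n x - f x) * (L2_norm (\<lambda>x. G n x - g x) + L2_norm g)"
      by (rule mult_left_mono) (rule L2_norm_nonneg)
    ultimately show ?thesis unfolding B_def by linarith
  qed
  moreover have "B \<longlonglongrightarrow> 0 * (0 + L2_norm g) + L2_norm f * 0"
    unfolding B_def[abs_def] by (intro tendsto_intros D)
  ultimately show ?thesis
    by (intro LIM_zero_cancel[where l = "\<integral>x. f x * g x \<partial>lborel"])
       (rule Lim_null_comparison[of _ B], auto)
qed

lemma L2_lim_dominated:
  assumes g: "g \<in> L2" and [measurable]: "f \<in> borel_measurable borel" "\<And>n. F n \<in> borel_measurable borel"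
    and lim: "AE x in lborel. (\<lambda>n. F n x) \<longlonglongrightarrow> f x"
    and bound: "\<And>n. AE x in lborel. norm (F n x) \<le> norm (g x)"
  shows "L2_lim F f"
proof -
  have F: "F n \<in> L2" for n using L2_bounded_by(1)[OF g, of "F n" 1] bound by simp
  have "AE x in lborel. \<forall>n. norm (F n x) \<le> norm (g x)" using bound by (simp add: AE_all_countable)
  with lim have fb: "AE x in lborel. norm (f x) \<le> norm (g x)"
  proof eventually_elim
    case (elim x)
    then show ?case by (intro LIMSEQ_le_const2[OF tendsto_norm[OF elim(1)]]) auto
  qed
  then have f: "f \<in> L2" using L2_bounded_by(1)[OF g, of f 1] by simp
  have "(\<lambda>n. \<integral>x. (norm (F n x - f x))\<^sup>2 \<partial>lborel) \<longlonglongrightarrow> (\<integral>x. 0 \<partial>(lborel :: 'a measure))"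
  proof (rule integral_dominated_convergence)
    show "integrable lborel (\<lambda>x. (2 * norm (g x))\<^sup>2)"
      using L2_integrable[OF g] by (simp add: power_mult_distrib)
    show "AE x in lborel. (\<lambda>n. (norm (F n x - f x))\<^sup>2) \<longlonglongrightarrow> 0"
      using lim
    proof eventually_elim
      case (elim x)
      then have "(\<lambda>n. (norm (F n x - f x))\<^sup>2) \<longlonglongrightarrow> (norm (f x - f x))\<^sup>2" by (intro tendsto_intros)
      then show ?case by simp
    qed
    show "AE x in lborel. norm ((norm (F n x - f x))\<^sup>2) \<le> (2 * norm (g x))\<^sup>2" for n
      using bound[of n] fb
    proof eventually_elim
      case (elim x)
      then have "norm (F n x - f x) \<le> 2 * norm (g x)" using norm_triangle_ineq4[of "F n x" "f x"] by linarith
      from power_mono[OF this, of 2] show ?case by simp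
    qed
  qed measurable
  then have "(\<lambda>n. L2_norm (\<lambda>x. F n x - f x)) \<longlonglongrightarrow> sqrt 0"
    unfolding L2_norm_def by (intro tendsto_real_sqrt) simp
  then show ?thesis using F f by (simp add: L2_lim_def)
qed

section \<open>Translations and mollification in L2\<close>

lemma cont_supp_L2:
  fixes g :: "'a::euclidean_space \<Rightarrow> complex"
  assumes "continuous_on UNIV g" "\<And>x. R < norm x \<Longrightarrow> g x = 0"
  shows "g \<in> L2"
proof (rule L2I)
  show "g \<in> borel_measurable borel" using assms(1) by (rule borel_measurable_continuous_onI)
  show "integrable lborel (\<lambda>x. (norm (g x))\<^sup>2)"
    using assms by (intro continuous_bounded_support_integrable[where R=R]) (auto intro!: continuous_intros)
qed

lemma test_L2: "\<phi> \<in> test_functions \<Longrightarrow> \<phi> \<in> L2"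
  unfolding test_functions_iff using cont_supp_L2 smooth_continuous by metis

lemma nn_integral_affine:
  fixes f :: "'a::euclidean_space \<Rightarrow> ennreal"
  assumes [measurable]: "f \<in> borel_measurable borel" and "r \<noteq> 0"
  shows "(\<integral>\<^sup>+y. f y \<partial>lborel) = ennreal (\<bar>r\<bar> ^ DIM('a)) * (\<integral>\<^sup>+y. f (a + r *\<^sub>R y) \<partial>lborel)"
  by (subst lborel_affine[OF assms(2), of a])
     (simp add: nn_integral_density nn_integral_distr nn_integral_cmult ennreal_power)

lemma integrable_affine:
  fixes f :: "'a::euclidean_space \<Rightarrow> 'b::{banach, second_countable_topology}"
  assumes f: "integrable lborel f" and r: "r \<noteq> 0"
  shows "integrable lborel (\<lambda>y. f (a + r *\<^sub>R y))"
proof -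
  have [measurable]: "f \<in> borel_measurable borel" using f by auto
  have "(\<integral>\<^sup>+y. norm (f y) \<partial>lborel) < \<infinity>" using f by (simp add: integrable_iff_bounded)
  then show ?thesis
    using nn_integral_affine[OF _ r, of "\<lambda>y. ennreal (norm (f y))" a] r
    by (auto simp: integrable_iff_bounded ennreal_mult_less_top)
qed

lemma L2_affine:
  assumes h: "h \<in> L2" and r: "r \<noteq> 0"
  shows "(\<lambda>y. h (a + r *\<^sub>R y)) \<in> L2"
proof -
  have [measurable]: "h \<in> borel_measurable borel" using h by (rule L2_measurable)
  show ?thesis using integrable_affine[OF L2_integrable[OF h] r] by (intro L2I) auto
qed

lemma L2_translate: "h \<in> L2 \<Longrightarrow> (\<lambda>y. h (y - t)) \<in> L2"
  using L2_affine[of h 1 "- t"] by simp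

lemma L2_norm_translate:
  assumes h: "h \<in> L2"
  shows "L2_norm (\<lambda>y. h (y - t)) = L2_norm h"
proof -
  have [measurable]: "h \<in> borel_measurable borel" using h by (rule L2_measurable)
  have "(\<integral>y. (norm (h y))\<^sup>2 \<partial>lborel) = (\<integral>y. (norm (h y))\<^sup>2 \<partial>distr lborel borel ((+) (- t)))"
    by (simp add: lborel_distr_plus)
  also have "\<dots> = (\<integral>y. (norm (h (- t + y)))\<^sup>2 \<partial>lborel)" by (intro integral_distr) auto
  finally show ?thesis by (simp add: L2_norm_def)
qed

lemma L2_of_nn_integral:
  assumes [measurable]: "g \<in> borel_measurable borel"
    and le: "(\<integral>\<^sup>+x. ennreal ((norm (g x))\<^sup>2) \<partial>lborel) \<le> ennreal (c\<^sup>2)" and c: "0 \<le> c"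
  shows "g \<in> L2" "L2_norm g \<le> c"
proof -
  have int: "integrable lborel (\<lambda>x. (norm (g x))\<^sup>2)"
    using le by (intro integrableI_nonneg) (auto intro: le_less_trans)
  then show "g \<in> L2" by (intro L2I) auto
  have "ennreal ((L2_norm g)\<^sup>2) \<le> ennreal (c\<^sup>2)"
    using le nn_integral_eq_integral[OF int] by (simp add: L2_norm_square)
  then have "(L2_norm g)\<^sup>2 \<le> c\<^sup>2" by (subst (asm) ennreal_le_iff) auto
  then show "L2_norm g \<le> c" using c by (rule power2_le_imp_le)
qed

lemma nn_integral_L2: "g \<in> L2 \<Longrightarrow> (\<integral>\<^sup>+x. ennreal ((norm (g x))\<^sup>2) \<partial>lborel) = ennreal ((L2_norm g)\<^sup>2)"
  using nn_integral_eq_integral[OF L2_integrable] by (simp add: L2_norm_square)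

lemma indicator_cball_L2: "(\<lambda>x. c * indicator (cball 0 R) x) \<in> L2"
proof (rule L2_cmult, rule L2I)
  have "(\<lambda>x. (norm (indicator (cball (0::'a) R) x :: complex))\<^sup>2) = indicat_real (cball 0 R)"
    by (auto simp: fun_eq_iff indicator_def)
  then show "integrable lborel (\<lambda>x. (norm (indicator (cball (0::'a) R) x :: complex))\<^sup>2)"
    using emeasure_bounded_finite[of "cball (0::'a) R"] by (auto intro: integrable_real_indicator)
qed (intro borel_measurable_indicator, simp)

text \<open>
  A Lebesgue measurable function is almost everywhere a limit of continuous functions; truncating values and
  supports, first of \<open>h\<close> and then of the approximating functions, makes this convergence dominated.
\<close>

lemma L2_dense_continuous:
  fixes h :: "'a::euclidean_space \<Rightarrow> complex"
  assumes h: "h \<in> L2" and e: "0 < e"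
  obtains g R where "continuous_on UNIV g" "\<And>x. R < norm x \<Longrightarrow> g x = 0" "L2_norm (\<lambda>x. h x - g x) < e"
proof -
  have [measurable]: "h \<in> borel_measurable borel" using h by (rule L2_measurable)
  define H where "H m x = (if norm x \<le> real m \<and> norm (h x) \<le> real m then h x else 0)" for m x
  have [measurable]: "H m \<in> borel_measurable borel" for m unfolding H_def by measurable
  have "L2_lim H h"
  proof (rule L2_lim_dominated[OF h])
    show "AE x in lborel. (\<lambda>m. H m x) \<longlonglongrightarrow> h x"
    proof (rule AE_I2)
      fix x
      obtain N where N: "max (norm x) (norm (h x)) \<le> real N" using real_arch_simple by blast
      have "eventually (\<lambda>m. H m x = h x) sequentially"
        using eventually_ge_at_top[of N]
      proof eventually_elim
        case (elim m)
        then have "real N \<le> real m" by simp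
        then show ?case using N by (auto simp: H_def)
      qed
      then show "(\<lambda>m. H m x) \<longlonglongrightarrow> h x" by (rule tendsto_eventually)
    qed
  qed (auto simp: H_def)
  then obtain m where m: "L2_norm (\<lambda>x. H m x - h x) < e / 2"
    using L2_limD(3)[THEN order_tendstoD(2), of H h "e / 2"] e
    by (auto simp: eventually_sequentially)
  have "H m measurable_on UNIV"
    by (intro lebesgue_measurable_imp_measurable_on measurable_completion) auto
  then obtain N G where N: "negligible N" and G: "\<And>n. continuous_on UNIV (G n)"
      "\<And>x. x \<notin> N \<Longrightarrow> (\<lambda>n. G n x) \<longlonglongrightarrow> H m x"
    by (auto simp: measurable_on_def)
  \<comment> \<open>A continuous cutoff that equals \<open>1\<close> on the ball carrying \<open>H m\<close>, and the radial retraction onto a ball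
    that contains all values of \<open>H m\<close>.\<close>
  define ct where "ct x = max 0 (min 1 (real m + 1 - norm x))" for x :: 'a
  define k where "k = real (Suc m)"
  define cl where "cl w = (k / max k (norm w)) *\<^sub>R w" for w :: complex
  have k: "0 < k" by (simp add: k_def)
  have cl: "continuous_on UNIV cl" unfolding cl_def[abs_def] using k by (intro continuous_intros) auto
  have clb: "norm (cl w) \<le> k" for w
  proof -
    have "k * norm w \<le> k * max k (norm w)" using k by (intro mult_left_mono) auto
    then show ?thesis using k by (simp add: cl_def pos_divide_le_eq max_def)
  qed
  have cli: "cl w = w" if "norm w \<le> k" for w using that k by (simp add: cl_def max_def)
  define F where "F n x = of_real (ct x) * cl (G n x)" for n x
  have Fc: "continuous_on UNIV (F n)" for n
    unfolding F_def ct_def by (intro continuous_intros continuous_on_compose2[OF cl G(1)]) auto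
  have Fs: "F n x = 0" if "real m + 1 < norm x" for n x using that by (simp add: F_def ct_def)
  have "AE x in lebesgue. x \<notin> N" using N by (simp add: negligible_iff_null_sets AE_not_in)
  then have aeN: "AE x in lborel. x \<notin> N" by (simp add: AE_completion_iff)
  have "L2_lim F (H m)"
  proof (rule L2_lim_dominated[OF indicator_cball_L2[of "of_real k" "real m + 1"]])
    show "F n \<in> borel_measurable borel" for n using Fc by (rule borel_measurable_continuous_onI)
    show "AE x in lborel. (\<lambda>n. F n x) \<longlonglongrightarrow> H m x" using aeN
    proof eventually_elim
      case (elim x)
      have "norm (H m x) \<le> k" by (simp add: H_def k_def)
      moreover have "(\<lambda>n. cl (G n x)) \<longlonglongrightarrow> cl (H m x)"
        using continuous_on_tendsto_compose[OF cl G(2)[OF elim]] by simp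
      ultimately have "(\<lambda>n. F n x) \<longlonglongrightarrow> of_real (ct x) * H m x"
        unfolding F_def by (intro tendsto_intros) (simp add: cli)
      moreover have "of_real (ct x) * H m x = H m x" by (simp add: ct_def H_def)
      ultimately show ?case by simp
    qed
    show "AE x in lborel. norm (F n x) \<le> norm (of_real k * indicator (cball 0 (real m + 1)) x :: complex)" for n
    proof (rule AE_I2)
      fix x :: 'a
      have "\<bar>ct x\<bar> * norm (cl (G n x)) \<le> 1 * k" by (intro mult_mono clb) (auto simp: ct_def)
      then show "norm (F n x) \<le> norm (of_real k * indicator (cball 0 (real m + 1)) x :: complex)"
        using Fs[of x n] k by (cases "norm x \<le> real m + 1") (auto simp: F_def norm_mult)
    qed
  qed auto
  then obtain n where n: "L2_norm (\<lambda>x. F n x - H m x) < e / 2"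
    using L2_limD(3)[THEN order_tendstoD(2), of F "H m" "e / 2"] e
    by (auto simp: eventually_sequentially)
  have "L2_norm (\<lambda>x. h x - F n x) \<le> L2_norm (\<lambda>x. h x - H m x) + L2_norm (\<lambda>x. H m x - F n x)"
    using \<open>L2_lim H h\<close> \<open>L2_lim F (H m)\<close> by (intro L2_norm_triangle_diff) (auto simp: L2_lim_def)
  also have "\<dots> < e" using m n L2_norm_minus_commute[of h "H m"] L2_norm_minus_commute[of "H m" "F n"] by linarith
  finally show ?thesis by (intro that[OF Fc Fs])
qed

text \<open>
  For a continuous function with bounded support this is uniform continuity; translations are isometries, so
  the general case follows by density.
\<close>

lemma L2_translation_continuous:
  fixes h :: "'a::euclidean_space \<Rightarrow> complex"
  assumes h: "h \<in> L2" and e: "0 < e"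
  obtains d where "0 < d" "\<And>t. norm t < d \<Longrightarrow> L2_norm (\<lambda>x. h (x - t) - h x) < e"
proof -
  obtain g R where g: "continuous_on UNIV g" "\<And>x. R < norm x \<Longrightarrow> g x = 0"
      and hg: "L2_norm (\<lambda>x. h x - g x) < e / 3"
    using L2_dense_continuous[OF h, of "e / 3"] e by auto
  have gL: "g \<in> L2" by (rule cont_supp_L2[OF g])
  let ?I = "\<lambda>x::'a. 1 * indicator (cball 0 (R + 1)) x :: complex"
  define V where "V = L2_norm ?I"
  define c where "c = e / 3 / (V + 1)"
  have pos: "0 < V + 1" unfolding V_def using L2_norm_nonneg[of ?I] by linarith
  then have c: "0 < c" using e by (simp add: c_def)
  have "uniformly_continuous_on UNIV g"
  proof -
    have "uniformly_continuous_on (cball 0 (R + 2)) g"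
      using g(1) by (intro compact_uniformly_continuous) (auto intro: continuous_on_subset)
    then show ?thesis
      unfolding uniformly_continuous_on_def
    proof (intro allI impI)
      fix \<epsilon> :: real assume "0 < \<epsilon>"
      assume "\<forall>e>0. \<exists>d>0. \<forall>x\<in>cball 0 (R + 2). \<forall>x'\<in>cball 0 (R + 2). dist x' x < d \<longrightarrow> dist (g x') (g x) < e"
      then obtain d where d: "0 < d" "\<And>x x'. x \<in> cball 0 (R + 2) \<Longrightarrow> x' \<in> cball 0 (R + 2) \<Longrightarrow>
          dist x' x < d \<Longrightarrow> dist (g x') (g x) < \<epsilon>" using \<open>0 < \<epsilon>\<close> by metis
      have "dist (g x') (g x) < \<epsilon>" if "dist x' x < min d 1" for x x'
      proof (cases "x \<in> cball 0 (R + 2) \<and> x' \<in> cball 0 (R + 2)")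
        case True
        then show ?thesis using d(2)[of x x'] that by simp
      next
        case False
        then have "R + 2 < norm x \<or> R + 2 < norm x'" by auto
        moreover have "norm x \<le> norm x' + dist x' x" "norm x' \<le> norm x + dist x' x"
          by (metis dist_norm norm_minus_commute norm_triangle_sub)+
        ultimately have "R < norm x" "R < norm x'" using that by linarith+
        then show ?thesis using g(2) \<open>0 < \<epsilon>\<close> by simp
      qed
      then show "\<exists>d>0. \<forall>x\<in>UNIV. \<forall>x'\<in>UNIV. dist x' x < d \<longrightarrow> dist (g x') (g x) < \<epsilon>"
        using d(1) by (intro exI[of _ "min d 1"]) auto
    qed
  qed
  from this[unfolded uniformly_continuous_on_def, rule_format, OF c]
  obtain d where d: "0 < d" "\<And>x x'. dist x' x < d \<Longrightarrow> dist (g x') (g x) < c" by auto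
  show thesis
  proof
    show "0 < min d 1" using d by simp
    fix t :: 'a assume t: "norm t < min d 1"
    note tL = L2_translate[OF h, of t] L2_translate[OF gL, of t]
    have "L2_norm (\<lambda>x. g (x - t) - g x) \<le> c * V"
      unfolding V_def
    proof (rule L2_bounded_by(2)[OF indicator_cball_L2])
      show "(\<lambda>x. g (x - t) - g x) \<in> borel_measurable borel"
        by (rule L2_measurable[OF L2_diff[OF tL(2) gL]])
      show "AE x in lborel. norm (g (x - t) - g x) \<le> c * norm (?I x)"
      proof (rule AE_I2)
        fix x :: 'a
        show "norm (g (x - t) - g x) \<le> c * norm (?I x)"
        proof (cases "norm x \<le> R + 1")
          case True
          have "dist (x - t) x < d" using t by (simp add: dist_norm)
          from d(2)[OF this] True show ?thesis by (simp add: dist_norm)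
        next
          case False
          moreover have "norm x \<le> norm (x - t) + norm t" using norm_triangle_ineq[of "x - t" t] by simp
          ultimately have "R < norm x" "R < norm (x - t)" using t by linarith+
          then show ?thesis using g(2) c by simp
        qed
      qed
    qed (use c in simp)
    also have "\<dots> < c * (V + 1)" using c by simp
    also have "\<dots> = e / 3" by (metis c_def eq_divide_eq order_less_irrefl pos)
    finally have 1: "L2_norm (\<lambda>x. g (x - t) - g x) < e / 3" .
    have 2: "L2_norm (\<lambda>x. h (x - t) - g (x - t)) = L2_norm (\<lambda>x. h x - g x)"
      by (rule L2_norm_translate[OF L2_diff[OF h gL]])
    have "L2_norm (\<lambda>x. h (x - t) - h x) \<le> L2_norm (\<lambda>x. h (x - t) - g (x - t)) + L2_norm (\<lambda>x. g (x - t) - h x)"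
      by (rule L2_norm_triangle_diff[OF tL h])
    also have "L2_norm (\<lambda>x. g (x - t) - h x) \<le> L2_norm (\<lambda>x. g (x - t) - g x) + L2_norm (\<lambda>x. g x - h x)"
      by (rule L2_norm_triangle_diff[OF tL(2) gL h])
    finally show "L2_norm (\<lambda>x. h (x - t) - h x) < e"
      using 1 2 hg L2_norm_minus_commute[of g h] by linarith
  qed
qed

text \<open>
  The normalisation preserves the integral, so the dilated kernels concentrate at the origin as \<open>e\<close> tends to
  zero.
\<close>

definition dilate :: "real \<Rightarrow> ('a::euclidean_space \<Rightarrow> complex) \<Rightarrow> 'a \<Rightarrow> complex" where
  "dilate e \<kappa> z = of_real ((1 / e) ^ DIM('a)) * \<kappa> ((1 / e) *\<^sub>R z)"

lemma conv_dilate: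
  fixes h \<kappa> :: "'a::euclidean_space \<Rightarrow> complex"
  assumes [measurable]: "h \<in> borel_measurable borel" "\<kappa> \<in> borel_measurable borel" and e: "0 < e"
  shows "conv h (dilate e \<kappa>) x = (\<integral>z. \<kappa> z * h (x - e *\<^sub>R z) \<partial>lborel)"
proof -
  have "conv h (dilate e \<kappa>) x = of_real (\<bar>- e\<bar> ^ DIM('a)) *
      (\<integral>z. h (x + (- e) *\<^sub>R z) * dilate e \<kappa> (x - (x + (- e) *\<^sub>R z)) \<partial>lborel)"
    unfolding conv_def dilate_def using e by (intro integral_affine) auto
  also have "\<dots> = (\<integral>z. \<kappa> z * h (x - e *\<^sub>R z) \<partial>lborel)"
    unfolding integral_mult_right_zero[symmetric] dilate_def
    using e by (intro Bochner_Integration.integral_cong) (auto simp: power_one_over field_simps)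
  finally show ?thesis .
qed

text \<open>
  After substitution the difference is \<open>\<integral> \<kappa>(z) (h(x - e z) - h(x)) dz\<close>. The Cauchy-Schwarz inequality with
  respect to the weight \<open>norm (\<kappa> z)\<close>, followed by an exchange of the order of integration, bounds its norm by
  the modulus of continuity of translations.
\<close>

lemma mollify_bound:
  fixes h \<kappa> :: "'a::euclidean_space \<Rightarrow> complex"
  assumes h: "h \<in> L2" and \<kappa>: "continuous_on UNIV \<kappa>" "\<And>x. R < norm x \<Longrightarrow> \<kappa> x = 0" and e: "0 < e"
    and \<omega>: "\<And>z. norm z \<le> R \<Longrightarrow> L2_norm (\<lambda>x. h (x - e *\<^sub>R z) - h x) \<le> c" "0 \<le> c"
  defines "D \<equiv> (\<lambda>x. conv h (dilate e \<kappa>) x - (\<integral>z. \<kappa> z \<partial>lborel) * h x)"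
  shows "D \<in> L2" "L2_norm D \<le> (\<integral>z. norm (\<kappa> z) \<partial>lborel) * c"
proof -
  have hm [measurable]: "h \<in> borel_measurable borel" and \<kappa>m [measurable]: "\<kappa> \<in> borel_measurable borel"
    using h \<kappa>(1) by (auto intro: L2_measurable borel_measurable_continuous_onI)
  have \<kappa>i: "integrable lborel \<kappa>" using \<kappa> by (rule continuous_bounded_support_integrable)
  define A where "A = (\<integral>z. norm (\<kappa> z) \<partial>lborel)"
  have A: "(\<integral>\<^sup>+z. ennreal (norm (\<kappa> z)) \<partial>lborel) = ennreal A" "0 \<le> A"
    using nn_integral_eq_integral[OF integrable_norm[OF \<kappa>i]] by (auto simp: A_def)
  let ?\<Delta> = "\<lambda>x z. h (x - e *\<^sub>R z) - h x"
  have \<Delta>m [measurable]: "(\<lambda>p. ?\<Delta> (fst p) (snd p)) \<in> borel_measurable (lborel \<Otimes>\<^sub>M lborel)" by measurable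
  have hL: "(\<lambda>z. h (x - e *\<^sub>R z)) \<in> L2" for x using L2_affine[OF h, of "- e" x] e by simp
  have int: "integrable lborel (\<lambda>z. \<kappa> z * h (x - e *\<^sub>R z))" for x
    by (rule L2_mult_integrable[OF cont_supp_L2[OF \<kappa>] hL])
  have D: "D x = (\<integral>z. \<kappa> z * ?\<Delta> x z \<partial>lborel)" for x
    unfolding D_def conv_dilate[OF hm \<kappa>m e]
    using int[of x] \<kappa>i by (simp add: right_diff_distrib)
  have [measurable]: "D \<in> borel_measurable borel"
    unfolding D by (rule lborel.borel_measurable_lebesgue_integral) measurable
  have pt: "ennreal ((norm (D x))\<^sup>2) \<le> ennreal A * (\<integral>\<^sup>+z. ennreal (norm (\<kappa> z)) * ennreal ((norm (?\<Delta> x z))\<^sup>2) \<partial>lborel)" for x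
  proof -
    have "integrable lborel (\<lambda>z. \<kappa> z * ?\<Delta> x z)" using int[of x] \<kappa>i by (simp add: right_diff_distrib)
    then have "ennreal (norm (D x)) \<le> (\<integral>\<^sup>+z. norm (\<kappa> z * ?\<Delta> x z) \<partial>lborel)"
      unfolding D by (rule integral_norm_bound_ennreal)
    also have "\<dots> = (\<integral>\<^sup>+z. ennreal (sqrt (norm (\<kappa> z))) * ennreal (sqrt (norm (\<kappa> z)) * norm (?\<Delta> x z)) \<partial>lborel)"
      by (simp add: ennreal_mult[symmetric] norm_mult mult.assoc[symmetric])
    finally have "(ennreal (norm (D x)))\<^sup>2
        \<le> (\<integral>\<^sup>+z. ennreal (sqrt (norm (\<kappa> z))) * ennreal (sqrt (norm (\<kappa> z)) * norm (?\<Delta> x z)) \<partial>lborel)\<^sup>2"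
      by (rule power_mono) simp
    also have "\<dots> \<le> (\<integral>\<^sup>+z. (ennreal (sqrt (norm (\<kappa> z))))\<^sup>2 \<partial>lborel)
        * (\<integral>\<^sup>+z. (ennreal (sqrt (norm (\<kappa> z)) * norm (?\<Delta> x z)))\<^sup>2 \<partial>lborel)"
      by (rule Cauchy_Schwarz_nn_integral) measurable
    finally show ?thesis
      by (simp add: ennreal_power power_mult_distrib A ennreal_mult)
  qed
  have "(\<integral>\<^sup>+x. (\<integral>\<^sup>+z. ennreal (norm (\<kappa> z)) * ennreal ((norm (?\<Delta> x z))\<^sup>2) \<partial>lborel) \<partial>lborel)
      = (\<integral>\<^sup>+z. (\<integral>\<^sup>+x. ennreal (norm (\<kappa> z)) * ennreal ((norm (?\<Delta> x z))\<^sup>2) \<partial>lborel) \<partial>lborel)"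
    by (rule lborel_pair.Fubini') measurable
  also have "\<dots> = (\<integral>\<^sup>+z. ennreal (norm (\<kappa> z)) * (\<integral>\<^sup>+x. ennreal ((norm (?\<Delta> x z))\<^sup>2) \<partial>lborel) \<partial>lborel)"
    by (intro nn_integral_cong nn_integral_cmult) measurable
  also have "\<dots> \<le> (\<integral>\<^sup>+z. ennreal (norm (\<kappa> z)) * ennreal (c\<^sup>2) \<partial>lborel)"
  proof (rule nn_integral_mono)
    fix z
    show "ennreal (norm (\<kappa> z)) * (\<integral>\<^sup>+x. ennreal ((norm (?\<Delta> x z))\<^sup>2) \<partial>lborel) \<le> ennreal (norm (\<kappa> z)) * ennreal (c\<^sup>2)"
    proof (cases "norm z \<le> R")
      case True
      have "(L2_norm (\<lambda>x. ?\<Delta> x z))\<^sup>2 \<le> c\<^sup>2" by (intro power_mono \<omega>(1) True L2_norm_nonneg)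
      then show ?thesis
        by (intro mult_left_mono) (simp_all add: nn_integral_L2[OF L2_diff[OF L2_translate[OF h] h]])
    next
      case False
      then show ?thesis using \<kappa>(2)[of z] by simp
    qed
  qed
  also have "\<dots> = ennreal A * ennreal (c\<^sup>2)" by (simp add: nn_integral_multc A)
  finally have le: "(\<integral>\<^sup>+x. (\<integral>\<^sup>+z. ennreal (norm (\<kappa> z)) * ennreal ((norm (?\<Delta> x z))\<^sup>2) \<partial>lborel) \<partial>lborel)
      \<le> ennreal A * ennreal (c\<^sup>2)" .
  have "(\<integral>\<^sup>+x. ennreal ((norm (D x))\<^sup>2) \<partial>lborel)
      \<le> (\<integral>\<^sup>+x. ennreal A * (\<integral>\<^sup>+z. ennreal (norm (\<kappa> z)) * ennreal ((norm (?\<Delta> x z))\<^sup>2) \<partial>lborel) \<partial>lborel)"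
    by (rule nn_integral_mono) (rule pt)
  also have "\<dots> = ennreal A * (\<integral>\<^sup>+x. (\<integral>\<^sup>+z. ennreal (norm (\<kappa> z)) * ennreal ((norm (?\<Delta> x z))\<^sup>2) \<partial>lborel) \<partial>lborel)"
    by (rule nn_integral_cmult) measurable
  also have "\<dots> \<le> ennreal A * (ennreal A * ennreal (c\<^sup>2))" using le by (rule mult_left_mono) simp
  also have "\<dots> = ennreal ((A * c)\<^sup>2)"
    using A(2) by (simp add: ennreal_mult[symmetric] power2_eq_square mult_ac)
  finally have "(\<integral>\<^sup>+x. ennreal ((norm (D x))\<^sup>2) \<partial>lborel) \<le> ennreal ((A * c)\<^sup>2)" .
  then show "D \<in> L2" "L2_norm D \<le> (\<integral>z. norm (\<kappa> z) \<partial>lborel) * c"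
    using L2_of_nn_integral[of D "A * c"] A(2) \<omega>(2) by (auto simp: A_def)
qed

definition eps :: "nat \<Rightarrow> real" where "eps n = inverse (real (Suc n))"

lemma eps_pos: "0 < eps n" and eps_le_1: "eps n \<le> 1"
  by (auto simp: eps_def inverse_le_1_iff)

lemma eps_tendsto: "eps \<longlonglongrightarrow> 0"
  unfolding eps_def[abs_def] by (rule LIMSEQ_inverse_real_of_nat)

text \<open>
  The commutator estimate applies this to the moment kernels \<open>z\<^sub>m \<partial>\<^sub>l \<eta>(z)\<close>, whose integral is \<open>0\<close> or
  \<open>- 1\<close>, and to a nonnegative kernel that is continuous but not smooth.
\<close>

theorem mollify_L2:
  fixes h \<kappa> :: "'a::euclidean_space \<Rightarrow> complex"
  assumes h: "h \<in> L2" and \<kappa>: "continuous_on UNIV \<kappa>" "\<And>x. R < norm x \<Longrightarrow> \<kappa> x = 0"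
  shows "L2_lim (\<lambda>n. conv h (dilate (eps n) \<kappa>)) (\<lambda>x. (\<integral>z. \<kappa> z \<partial>lborel) * h x)"
  unfolding L2_lim_def
proof (intro conjI allI)
  define A where "A = (\<integral>z. norm (\<kappa> z) \<partial>lborel)"
  have A: "0 \<le> A" by (simp add: A_def)
  have hc: "(\<lambda>x. (\<integral>z. \<kappa> z \<partial>lborel) * h x) \<in> L2" using h by (rule L2_cmult)
  then show "(\<lambda>x. (\<integral>z. \<kappa> z \<partial>lborel) * h x) \<in> L2" .
  show "conv h (dilate (eps n) \<kappa>) \<in> L2" for n
  proof -
    have "L2_norm (\<lambda>x. h (x - eps n *\<^sub>R z) - h x) \<le> 2 * L2_norm h" for z
      using L2_norm_triangle_diff[OF L2_translate[OF h] L2_zero h, of "eps n *\<^sub>R z"]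
        L2_norm_translate[OF h, of "eps n *\<^sub>R z"] L2_norm_minus_commute[of "\<lambda>x. 0" h] by simp
    from mollify_bound(1)[where R=R, OF h \<kappa> eps_pos this] L2_norm_nonneg[of h]
    have "(\<lambda>x. conv h (dilate (eps n) \<kappa>) x - (\<integral>z. \<kappa> z \<partial>lborel) * h x) \<in> L2" by simp
    from L2_add[OF this hc] show ?thesis by simp
  qed
  show "(\<lambda>n. L2_norm (\<lambda>x. conv h (dilate (eps n) \<kappa>) x - (\<integral>z. \<kappa> z \<partial>lborel) * h x)) \<longlonglongrightarrow> 0"
  proof (rule LIMSEQ_I)
    fix r :: real assume r: "0 < r"
    define c where "c = r / (A + 1)"
    have c: "0 < c" "A * c < r" using r A by (auto simp: c_def divide_simps)
    obtain d where d: "0 < d" "\<And>t. norm t < d \<Longrightarrow> L2_norm (\<lambda>x. h (x - t) - h x) < c"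
      using L2_translation_continuous[OF h c(1)] by metis
    have "0 < d / (\<bar>R\<bar> + 1)" using d by simp
    then obtain N where N: "\<And>n. n \<ge> N \<Longrightarrow> norm (eps n - 0) < d / (\<bar>R\<bar> + 1)"
      using LIMSEQ_D[OF eps_tendsto] by metis
    show "\<exists>no. \<forall>n\<ge>no. norm (L2_norm (\<lambda>x. conv h (dilate (eps n) \<kappa>) x - (\<integral>z. \<kappa> z \<partial>lborel) * h x) - 0) < r"
    proof (intro exI allI impI)
      fix n assume "n \<ge> N"
      from N[OF this] have n: "eps n * (\<bar>R\<bar> + 1) < d"
        using eps_pos[of n] by (simp add: pos_less_divide_eq)
      have "L2_norm (\<lambda>x. h (x - eps n *\<^sub>R z) - h x) \<le> c" if "norm z \<le> R" for z
      proof -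
        have "eps n * norm z \<le> eps n * (\<bar>R\<bar> + 1)" using that eps_pos[of n] by (intro mult_left_mono) auto
        then have "norm (eps n *\<^sub>R z) < d" using n eps_pos[of n] unfolding norm_scaleR by linarith
        from d(2)[OF this] show ?thesis by simp
      qed
      from mollify_bound(2)[where R=R, OF h \<kappa> eps_pos this] c
      show "norm (L2_norm (\<lambda>x. conv h (dilate (eps n) \<kappa>) x - (\<integral>z. \<kappa> z \<partial>lborel) * h x) - 0) < r"
        by (simp add: A_def abs_of_nonneg[OF L2_norm_nonneg])
    qed
  qed
qed

section \<open>Dilated kernels and weak derivatives\<close>

lemma test_dilate:
  assumes "\<kappa> \<in> test_functions" "0 < e"
  shows "dilate e \<kappa> \<in> test_functions"
  unfolding dilate_def[abs_def] using test_cmult[OF test_affine[OF assms(1), of "1 / e" 0]] assms(2) by simp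

lemma dilate_support:
  assumes "\<And>x. R < norm x \<Longrightarrow> \<kappa> x = 0" "0 < e" "e * R < norm z"
  shows "dilate e \<kappa> z = 0"
  using assms by (simp add: dilate_def field_simps)

lemma dir_deriv_dilate:
  assumes "smooth \<kappa>"
  shows "dir_deriv v (dilate e \<kappa>) z = of_real (1 / e) * dilate e (dir_deriv v \<kappa>) z"
proof -
  have d: "(\<lambda>z. \<kappa> (0 + (1 / e) *\<^sub>R z)) differentiable at z"
    by (intro smooth_differentiable smooth_affine assms)
  show ?thesis
    unfolding dilate_def[abs_def]
    using dir_deriv_mult[OF differentiable_const d, of v "of_real ((1 / e) ^ DIM('a))"]
      dir_deriv_affine[of \<kappa> 0 "1 / e" z v, OF smooth_differentiable[OF assms]]
    by (simp add: dir_deriv_const)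
qed

lemma dir_deriv_reflect:
  assumes "smooth \<phi>"
  shows "dir_deriv v (\<lambda>y. \<phi> (x - y)) y = - dir_deriv v \<phi> (x - y)"
  using dir_deriv_affine[of \<phi> x "-1" y v, OF smooth_differentiable[OF assms]] by simp

lemma Linf_measurable: "g \<in> Linf \<Longrightarrow> g \<in> borel_measurable borel"
  by (simp add: Linf_def)

lemma Linf_bound:
  assumes "g \<in> Linf" obtains M where "0 \<le> M" "AE x in lborel. norm (g x) \<le> M"
proof -
  obtain M where "AE x in lborel. norm (g x) \<le> M" using assms by (auto simp: Linf_def)
  then have "AE x in lborel. norm (g x) \<le> \<bar>M\<bar>" by eventually_elim simp
  then show ?thesis by (intro that[of "\<bar>M\<bar>"]) auto
qed

lemma Linf_mult_L2:
  assumes "b \<in> Linf" "g \<in> L2" shows "(\<lambda>x. b x * g x) \<in> L2"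
proof -
  obtain M where "0 \<le> M" "AE x in lborel. norm (b x) \<le> M" using assms(1) by (rule Linf_bound)
  then show ?thesis using L2_mult_bounded(1)[OF assms(2) Linf_measurable[OF assms(1)]] by blast
qed

lemma Linf_cball_L2:
  assumes "g \<in> Linf" shows "(\<lambda>x. indicator (cball 0 R) x * g x) \<in> L2"
proof -
  obtain M where "0 \<le> M" "AE x in lborel. norm (g x) \<le> M" using assms by (rule Linf_bound)
  then show ?thesis
    using L2_mult_bounded(1)[OF indicator_cball_L2[of 1 R] Linf_measurable[OF assms]]
    by (simp add: mult.commute)
qed

lemma Linf_locally_integrable:
  assumes "g \<in> Linf" shows "locally_integrable g"
  unfolding locally_integrable_def set_integrable_def
proof (intro allI impI)
  fix K :: "'a set" assume K: "compact K"
  obtain M where M: "0 \<le> M" "AE x in lborel. norm (g x) \<le> M" using assms by (rule Linf_bound)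
  have Kb: "K \<in> sets borel" "emeasure lborel K < \<infinity>"
    using emeasure_bounded_finite[OF compact_imp_bounded] K by (auto intro: borel_compact)
  have [measurable]: "g \<in> borel_measurable borel" using assms by (rule Linf_measurable)
  show "integrable lborel (\<lambda>x. indicator K x *\<^sub>R g x)"
  proof (rule Bochner_Integration.integrable_bound)
    show "integrable lborel (\<lambda>x. M * indicator K x)"
      using Kb by (intro integrable_mult_right integrable_real_indicator) auto
    show "AE x in lborel. norm (indicator K x *\<^sub>R g x) \<le> norm (M * indicator K x)"
      using M(2) by eventually_elim (use M(1) in \<open>auto simp: indicator_def\<close>)
    show "(\<lambda>x. indicator K x *\<^sub>R g x) \<in> borel_measurable lborel"
      using Kb by (intro borel_measurable_scaleR borel_measurable_indicator) auto
  qed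
qed

text \<open>
  The definition of a weak derivative, tested with the reflected and translated kernel.
\<close>

lemma dir_deriv_conv_weak:
  assumes w: "weak_partial_deriv k f g" and \<phi>: "\<phi> \<in> test_functions"
  shows "dir_deriv (axis k 1) (conv f \<phi>) = conv g \<phi>"
proof -
  have "conv f (dir_deriv (axis k 1) \<phi>) x = conv g \<phi> x" for x
  proof -
    have "(\<integral>y. f y * partial_deriv k (\<lambda>y. \<phi> (x - y)) y \<partial>lborel) = - (\<integral>y. g y * \<phi> (x - y) \<partial>lborel)"
      using w test_reflect[OF \<phi>] by (simp add: weak_partial_deriv_def)
    then show ?thesis
      by (simp add: partial_deriv_eq dir_deriv_reflect[OF test_smooth[OF \<phi>]] conv_def)
  qed
  then show ?thesis
    using dir_deriv_conv[of f \<phi>] w \<phi> by (auto simp: weak_partial_deriv_def)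
qed

definition mollifier :: "('a::euclidean_space \<Rightarrow> complex) \<Rightarrow> bool" where
  "mollifier \<eta> \<longleftrightarrow> \<eta> \<in> test_functions \<and> (\<forall>x. 1 < norm x \<longrightarrow> \<eta> x = 0) \<and>
    (\<forall>x. \<eta> x = of_real (norm (\<eta> x))) \<and> (\<integral>x. \<eta> x \<partial>lborel) = 1"

lemma mollifierD:
  assumes "mollifier \<eta>"
  shows "\<eta> \<in> test_functions" "1 < norm x \<Longrightarrow> \<eta> x = 0" "\<eta> x = of_real (norm (\<eta> x))"
    "(\<integral>x. \<eta> x \<partial>lborel) = 1"
  using assms by (auto simp: mollifier_def)

lemma test_measurable: "\<psi> \<in> test_functions \<Longrightarrow> \<psi> \<in> borel_measurable borel"
  by (intro borel_measurable_continuous_onI smooth_continuous test_smooth)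

lemma mollify_Linf_bound:
  fixes g :: "'a::euclidean_space \<Rightarrow> complex"
  assumes g: "g \<in> Linf" "AE x in lborel. norm (g x) \<le> M" and \<eta>: "mollifier \<eta>" and e: "0 < e"
  shows "norm (conv g (dilate e \<eta>) x) \<le> M"
proof -
  note \<eta>t = mollifierD(1)[OF \<eta>]
  have nn: "norm (dilate e \<eta> z) = Re (dilate e \<eta> z)" for z
  proof -
    have "dilate e \<eta> z = of_real ((1 / e) ^ DIM('a) * norm (\<eta> ((1 / e) *\<^sub>R z)))"
      unfolding dilate_def by (subst mollifierD(3)[OF \<eta>]) simp
    moreover have "0 \<le> (1 / e) ^ DIM('a) * norm (\<eta> ((1 / e) *\<^sub>R z))" using e by simp
    ultimately show ?thesis by (simp only: norm_of_real Re_complex_of_real abs_of_nonneg)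
  qed
  have i1: "integrable lborel (\<lambda>y. 1 * dilate e \<eta> (x - y))"
    by (rule conv_integrable[OF locally_integrable_const test_dilate[OF \<eta>t e]])
  have "norm (conv g (dilate e \<eta>) x) \<le> (\<integral>y. M * norm (dilate e \<eta> (x - y)) \<partial>lborel)"
    unfolding conv_def
  proof (rule order_trans[OF integral_norm_bound integral_mono_AE])
    show "integrable lborel (\<lambda>y. norm (g y * dilate e \<eta> (x - y)))"
      by (intro integrable_norm conv_integrable Linf_locally_integrable g test_dilate \<eta>t e)
    show "integrable lborel (\<lambda>y. M * norm (dilate e \<eta> (x - y)))"
      using integrable_norm[OF i1] by simp
    show "AE y in lborel. norm (g y * dilate e \<eta> (x - y)) \<le> M * norm (dilate e \<eta> (x - y))"
      using g(2) by eventually_elim (simp add: norm_mult mult_right_mono)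
  qed
  also have "\<dots> = M * Re (conv (\<lambda>y. 1) (dilate e \<eta>) x)"
    using i1 unfolding conv_def nn by (simp add: integral_Re)
  also have "\<dots> = M"
    using conv_dilate[of "\<lambda>y. 1" \<eta> e x] test_measurable[OF \<eta>t] e mollifierD(4)[OF \<eta>] by simp
  finally show ?thesis .
qed

section \<open>Coefficients with bounded weak derivatives\<close>

text \<open>
  Convergence in \<open>L\<^sub>2\<close> on a ball yields almost everywhere convergence along a subsequence. The sum of the
  squared errors is used so that a single subsequence serves the whole family. Near a point of the ball the
  convolution sees only values in a ball whose radius is larger by one.
\<close>

lemma mollify_Linf_AE:
  fixes g :: "'i \<Rightarrow> 'a::euclidean_space \<Rightarrow> complex"
  assumes I: "finite I" and g: "\<And>i. i \<in> I \<Longrightarrow> g i \<in> Linf" and \<eta>: "mollifier \<eta>"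
  obtains r :: "nat \<Rightarrow> nat" where
    "AE x in lborel. norm x \<le> R \<longrightarrow>
      (\<forall>i\<in>I. (\<lambda>n. conv (g i) (dilate (eps (r n)) \<eta>) x) \<longlonglongrightarrow> g i x)"
proof -
  define G where "G i x = indicator (cball 0 (R + 1)) x * g i x" for i x
  have \<eta>c: "continuous_on UNIV \<eta>" "\<And>x. 1 < norm x \<Longrightarrow> \<eta> x = 0"
    using mollifierD[OF \<eta>] by (auto intro: smooth_continuous test_smooth)
  have lim: "L2_lim (\<lambda>n. conv (G i) (dilate (eps n) \<eta>)) (G i)" if "i \<in> I" for i
    using mollify_L2[OF _ \<eta>c, of "G i"] Linf_cball_L2[OF g[OF that]] mollifierD(4)[OF \<eta>]
    by (simp add: G_def[abs_def])
  define u where "u n x = (\<Sum>i\<in>I. (norm (conv (G i) (dilate (eps n) \<eta>) x - G i x))\<^sup>2)" for n x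
  have ui: "integrable lborel (\<lambda>x. (norm (conv (G i) (dilate (eps n) \<eta>) x - G i x))\<^sup>2)" if "i \<in> I" for i n
    by (intro L2_integrable L2_diff L2_limD(1,2)[OF lim[OF that]])
  have "(\<integral>x. norm (u n x) \<partial>lborel) = (\<Sum>i\<in>I. (L2_norm (\<lambda>x. conv (G i) (dilate (eps n) \<eta>) x - G i x))\<^sup>2)" for n
  proof -
    have "norm (u n x) = u n x" for x by (simp add: u_def sum_nonneg)
    then show ?thesis using ui by (simp add: u_def L2_norm_square)
  qed
  moreover have "(\<lambda>n. \<Sum>i\<in>I. (L2_norm (\<lambda>x. conv (G i) (dilate (eps n) \<eta>) x - G i x))\<^sup>2) \<longlonglongrightarrow> (\<Sum>i\<in>I. 0\<^sup>2)"
    by (intro tendsto_intros L2_limD(3) lim)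
  ultimately have "(\<lambda>n. \<integral>x. norm (u n x) \<partial>lborel) \<longlonglongrightarrow> 0" by simp
  moreover have "integrable lborel (u n)" for n
    unfolding u_def[abs_def] using ui by (intro Bochner_Integration.integrable_sum) auto
  ultimately obtain r :: "nat \<Rightarrow> nat" where r: "AE x in lborel. (\<lambda>n. u (r n) x) \<longlonglongrightarrow> 0"
    using tendsto_L1_AE_subseq[of lborel u] by blast
  have same: "conv (g i) (dilate (eps n) \<eta>) x = conv (G i) (dilate (eps n) \<eta>) x" if x: "norm x \<le> R" for i n x
    unfolding conv_def
  proof (intro Bochner_Integration.integral_cong refl)
    fix y
    show "g i y * dilate (eps n) \<eta> (x - y) = G i y * dilate (eps n) \<eta> (x - y)"
    proof (cases "norm y \<le> R + 1")
      case False
      have "norm y \<le> norm (x - y) + norm x" using norm_triangle_ineq4[of x "x - y"] by simp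
      then have "1 < norm (x - y)" using False x by linarith
      then have "eps n * 1 < norm (x - y)" using eps_le_1[of n] by linarith
      from dilate_support[OF mollifierD(2)[OF \<eta>] eps_pos this] show ?thesis by simp
    qed (simp add: G_def)
  qed
  have "AE x in lborel. norm x \<le> R \<longrightarrow> (\<forall>i\<in>I. (\<lambda>n. conv (g i) (dilate (eps (r n)) \<eta>) x) \<longlonglongrightarrow> g i x)"
    using r
  proof (eventually_elim, intro impI ballI)
    fix x i assume ux: "(\<lambda>n. u (r n) x) \<longlonglongrightarrow> 0" and x: "norm x \<le> R" and i: "i \<in> I"
    have "(norm (conv (G i) (dilate (eps (r n)) \<eta>) x - G i x))\<^sup>2 \<le> u (r n) x" for n
      unfolding u_def using i I by (intro member_le_sum) auto
    then have "(\<lambda>n. (norm (conv (G i) (dilate (eps (r n)) \<eta>) x - G i x))\<^sup>2) \<longlonglongrightarrow> 0"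
      by (intro tendsto_sandwich[OF _ _ tendsto_const ux]) auto
    from tendsto_real_sqrt[OF this]
    have "(\<lambda>n. conv (G i) (dilate (eps (r n)) \<eta>) x) \<longlonglongrightarrow> G i x"
      by (simp add: LIM_zero_iff tendsto_norm_zero_iff)
    moreover have "G i x = g i x" using x by (simp add: G_def)
    ultimately show "(\<lambda>n. conv (g i) (dilate (eps (r n)) \<eta>) x) \<longlonglongrightarrow> g i x"
      using same[OF x] by simp
  qed
  then show ?thesis by (rule that)
qed

text \<open>
  If \<open>c\<close> were smooth, \<open>c \<psi>\<close> would itself be a test function and the identity would be the definition of
  the weak derivative of \<open>u\<close>. Mollifying \<open>c\<close> reduces to that case, and dominated convergence along a
  subsequence returns to \<open>c\<close>.
\<close>

lemma weak_product_rule: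
  fixes c :: "real^'n::finite \<Rightarrow> complex"
  assumes c: "c \<in> Linf" "D \<in> Linf" "weak_partial_deriv k c D"
    and u: "weak_partial_deriv k u u'" and \<psi>: "\<psi> \<in> test_functions" and \<eta>: "mollifier (\<eta> :: real^'n \<Rightarrow> complex)"
  shows "(\<integral>x. u x * (D x * \<psi> x + c x * partial_deriv k \<psi> x) \<partial>lborel) = - (\<integral>x. u' x * (c x * \<psi> x) \<partial>lborel)"
proof -
  let ?d = "dir_deriv (axis k 1)"
  obtain R where R: "\<And>x. R < norm x \<Longrightarrow> \<psi> x = 0" using \<psi> by (rule test_support) blast
  have dR: "?d \<psi> x = 0" if "R < norm x" for x using R that by (rule dir_deriv_zero_outside)
  obtain r where r: "AE x in lborel. norm x \<le> R \<longrightarrow> (\<forall>i\<in>UNIV.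
      (\<lambda>n. conv (if i then c else D) (dilate (eps (r n)) \<eta>) x) \<longlonglongrightarrow> (if i then c else D) x)"
  proof (rule mollify_Linf_AE[of "UNIV :: bool set" "\<lambda>i. if i then c else D", OF finite _ \<eta>])
    show "(if i then c else D) \<in> Linf" for i using c by simp
  qed
  define cn where "cn n = conv c (dilate (eps (r n)) \<eta>)" for n
  define Dn where "Dn n = conv D (dilate (eps (r n)) \<eta>)" for n
  have lim: "AE x in lborel. norm x \<le> R \<longrightarrow> (\<lambda>n. cn n x) \<longlonglongrightarrow> c x \<and> (\<lambda>n. Dn n x) \<longlonglongrightarrow> D x"
    using r
  proof eventually_elim
    case (elim x)
    show ?case
    proof (intro impI conjI)
      assume "norm x \<le> R"
      note * = elim[rule_format, OF this UNIV_I]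
      show "(\<lambda>n. cn n x) \<longlonglongrightarrow> c x" using *[of True] by (simp add: cn_def)
      show "(\<lambda>n. Dn n x) \<longlonglongrightarrow> D x" using *[of False] by (simp add: Dn_def)
    qed
  qed
  have t: "dilate (eps m) \<eta> \<in> test_functions" for m
    by (intro test_dilate mollifierD[OF \<eta>] eps_pos)
  have sm: "smooth (cn n)" "smooth (Dn n)" for n
    unfolding cn_def Dn_def by (intro smooth_conv Linf_locally_integrable c t)+
  have d: "?d (cn n) = Dn n" for n
    unfolding cn_def Dn_def by (rule dir_deriv_conv_weak[OF c(3) t])
  obtain M1 where M1: "0 \<le> M1" "AE x in lborel. norm (c x) \<le> M1" using c(1) by (rule Linf_bound)
  obtain M2 where M2: "0 \<le> M2" "AE x in lborel. norm (D x) \<le> M2" using c(2) by (rule Linf_bound)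
  have bn: "norm (cn n x) \<le> M1" "norm (Dn n x) \<le> M2" for n x
    unfolding cn_def Dn_def by (rule mollify_Linf_bound[OF c(1) M1(2) \<eta> eps_pos])
      (rule mollify_Linf_bound[OF c(2) M2(2) \<eta> eps_pos])
  have lu: "locally_integrable u" "locally_integrable u'" using u by (auto simp: weak_partial_deriv_def)
  have [measurable]: "c \<in> borel_measurable borel" "D \<in> borel_measurable borel"
    "cn n \<in> borel_measurable borel" "Dn n \<in> borel_measurable borel" for n
    using c sm by (auto intro: Linf_measurable borel_measurable_continuous_onI smooth_continuous)
  have i1: "integrable lborel (\<lambda>x. u x * \<psi> x)" "integrable lborel (\<lambda>x. u' x * \<psi> x)"
      "integrable lborel (\<lambda>x. u x * ?d \<psi> x)"
    by (intro locally_integrable_mult_test lu \<psi> test_dir_deriv)+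
  have [measurable]: "(\<lambda>x. u x * \<psi> x) \<in> borel_measurable lborel" "(\<lambda>x. u' x * \<psi> x) \<in> borel_measurable lborel"
      "(\<lambda>x. u x * ?d \<psi> x) \<in> borel_measurable lborel"
    using i1 by auto
  have dom: "(\<lambda>n. \<integral>x. f x * bn n x \<partial>lborel) \<longlonglongrightarrow> (\<integral>x. f x * b x \<partial>lborel)"
    if f: "integrable lborel f" and fz: "\<And>x. R < norm x \<Longrightarrow> f x = 0"
      and bm: "\<And>n. bn n \<in> borel_measurable lborel" "b \<in> borel_measurable lborel"
      and bl: "AE x in lborel. norm x \<le> R \<longrightarrow> (\<lambda>n. bn n x) \<longlonglongrightarrow> b x"
      and bb: "\<And>n x. norm (bn n x) \<le> M"
    for f b :: "real^'n \<Rightarrow> complex" and bn :: "nat \<Rightarrow> real^'n \<Rightarrow> complex" and M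
  proof (rule integral_dominated_convergence)
    show "integrable lborel (\<lambda>x. norm (f x) * M)" using f by auto
    show "AE x in lborel. (\<lambda>n. f x * bn n x) \<longlonglongrightarrow> f x * b x"
      using bl
    proof eventually_elim
      case (elim x)
      then show ?case using fz[of x] by (cases "norm x \<le> R") (auto intro: tendsto_intros)
    qed
    show "AE x in lborel. norm (f x * bn n x) \<le> norm (f x) * M" for n
      using bb by (intro AE_I2) (simp add: norm_mult mult_left_mono)
    show "(\<lambda>x. f x * bn n x) \<in> borel_measurable lborel" "(\<lambda>x. f x * b x) \<in> borel_measurable lborel" for n
      using f bm by auto
  qed
  have "(\<integral>x. u x * \<psi> x * Dn n x \<partial>lborel) + (\<integral>x. u x * ?d \<psi> x * cn n x \<partial>lborel)
      = - (\<integral>x. u' x * \<psi> x * cn n x \<partial>lborel)" for n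
  proof -
    have tt: "(\<lambda>x. \<psi> x * cn n x) \<in> test_functions" by (rule test_mult_smooth[OF \<psi> sm(1)])
    have "?d (\<lambda>x. \<psi> x * cn n x) x = \<psi> x * Dn n x + ?d \<psi> x * cn n x" for x
      using dir_deriv_mult[OF smooth_differentiable[OF test_smooth[OF \<psi>]] smooth_differentiable[OF sm(1)], of "axis k 1" n x]
      by (simp add: d)
    then have "(\<integral>x. u x * (\<psi> x * Dn n x + ?d \<psi> x * cn n x) \<partial>lborel) = - (\<integral>x. u' x * (\<psi> x * cn n x) \<partial>lborel)"
      using conjunct2[OF conjunct2[OF u[unfolded weak_partial_deriv_def partial_deriv_eq]], rule_format, OF tt]
      by simp
    moreover have "integrable lborel (\<lambda>x. u x * \<psi> x * Dn n x)" "integrable lborel (\<lambda>x. u x * ?d \<psi> x * cn n x)"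
      using locally_integrable_mult_test[OF lu(1) test_mult_smooth[OF \<psi> sm(2)]]
        locally_integrable_mult_test[OF lu(1) test_mult_smooth[OF test_dir_deriv[OF \<psi>] sm(1)]]
      by (simp_all add: mult.assoc)
    ultimately show ?thesis by (simp add: distrib_left mult.assoc)
  qed
  moreover have "(\<lambda>n. (\<integral>x. u x * \<psi> x * Dn n x \<partial>lborel) + (\<integral>x. u x * ?d \<psi> x * cn n x \<partial>lborel))
      \<longlonglongrightarrow> (\<integral>x. u x * \<psi> x * D x \<partial>lborel) + (\<integral>x. u x * ?d \<psi> x * c x \<partial>lborel)"
    by (intro tendsto_add dom[OF i1(1) _ _ _ _ bn(2)] dom[OF i1(3) _ _ _ _ bn(1)])
       (use R dR lim in \<open>auto elim: eventually_mono\<close>)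
  moreover have "(\<lambda>n. - (\<integral>x. u' x * \<psi> x * cn n x \<partial>lborel)) \<longlonglongrightarrow> - (\<integral>x. u' x * \<psi> x * c x \<partial>lborel)"
    by (intro tendsto_minus dom[OF i1(2) _ _ _ _ bn(1)]) (use R lim in \<open>auto elim: eventually_mono\<close>)
  ultimately have eq: "(\<integral>x. u x * \<psi> x * D x \<partial>lborel) + (\<integral>x. u x * ?d \<psi> x * c x \<partial>lborel)
      = - (\<integral>x. u' x * \<psi> x * c x \<partial>lborel)"
    by (simp add: LIMSEQ_unique)
  have ib: "integrable lborel (\<lambda>x. f x * b x)"
    if "integrable lborel f" "AE x in lborel. norm (b x) \<le> M" "b \<in> borel_measurable lborel"
    for f b :: "real^'n \<Rightarrow> complex" and M
  proof (rule Bochner_Integration.integrable_bound)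
    show "integrable lborel (\<lambda>x. norm (f x) * M)" using that by auto
    show "AE x in lborel. norm (f x * b x) \<le> norm (norm (f x) * M)"
      using that(2)
    proof eventually_elim
      case (elim x)
      then show ?case by (simp add: norm_mult abs_mult mult_left_mono)
    qed
    show "(\<lambda>x. f x * b x) \<in> borel_measurable lborel" using that by auto
  qed
  have "(\<integral>x. u x * (D x * \<psi> x + c x * partial_deriv k \<psi> x) \<partial>lborel)
      = (\<integral>x. u x * \<psi> x * D x + u x * ?d \<psi> x * c x \<partial>lborel)"
    by (simp add: partial_deriv_eq algebra_simps)
  also have "\<dots> = (\<integral>x. u x * \<psi> x * D x \<partial>lborel) + (\<integral>x. u x * ?d \<psi> x * c x \<partial>lborel)"
    by (intro Bochner_Integration.integral_add ib[OF i1(1) M2(2)] ib[OF i1(3) M1(2)]) auto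
  finally show ?thesis using eq by (simp add: algebra_simps)
qed

section \<open>The commutator with a mollifier\<close>

lemma sum_Basis_vec:
  fixes f :: "real^'n::finite \<Rightarrow> complex"
  shows "(\<Sum>b\<in>Basis. f b) = (\<Sum>k\<in>UNIV. f (axis k 1))"
proof -
  have B: "(Basis :: (real^'n) set) = range (\<lambda>k. axis k 1)" by (auto simp: Basis_vec_def)
  have "inj (\<lambda>k::'n. axis k (1::real))" by (auto simp: inj_def axis_eq_axis)
  then show ?thesis unfolding B by (subst sum.reindex) (simp_all add: o_def)
qed

lemma Basis_vecE:
  assumes "b \<in> (Basis :: (real^'n::finite) set)" obtains k where "b = axis k 1"
  using assms by (auto simp: Basis_vec_def)

lemma dir_deriv_expand_vec:
  fixes f :: "real^'n::finite \<Rightarrow> complex"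
  assumes "f differentiable at x"
  shows "dir_deriv v f x = (\<Sum>k\<in>UNIV. of_real (v $ k) * dir_deriv (axis k 1) f x)"
  using dir_deriv_expand[OF assms, of v] by (simp add: sum_Basis_vec inner_axis)

text \<open>
  The mollified coefficients satisfy Taylor's formula with a constant determined by the
  essential bounds of the second weak derivatives. It survives in the limit at all points where \<open>c\<close> and its first
  derivatives are limits of their mollifications; for two such points the subsequence is
  the one attached to a ball containing both.
\<close>

lemma W2inf_taylor_AE:
  fixes c :: "real^'n::finite \<Rightarrow> complex"
  assumes c: "c \<in> Linf" "\<And>m. D m \<in> Linf" "\<And>m. weak_partial_deriv m c (D m)"
    and E: "\<And>m p. E m p \<in> Linf" "\<And>m p. weak_partial_deriv p (D m) (E m p)"
    and \<eta>: "mollifier (\<eta> :: real^'n \<Rightarrow> complex)"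
  obtains L Q where "0 \<le> L" "AE x in lborel. Q x"
    "\<And>x y. Q x \<Longrightarrow> Q y \<Longrightarrow>
      norm (c y - c x - (\<Sum>m\<in>UNIV. of_real ((y - x) $ m) * D m x)) \<le> L * (norm (y - x))\<^sup>2"
proof -
  have "\<exists>M. 0 \<le> M \<and> (AE x in lborel. norm (E m p x) \<le> M)" for m p
    using Linf_bound[OF E(1)] by metis
  then obtain M where M: "\<And>m p. 0 \<le> M m p" "\<And>m p. AE x in lborel. norm (E m p x) \<le> M m p" by metis
  define B where "B = (\<Sum>m\<in>UNIV. \<Sum>p\<in>UNIV. M m p)"
  have B0: "0 \<le> B" unfolding B_def by (intro sum_nonneg M(1))
  have MB: "M m p \<le> B" for m p
  proof -
    have "M m p \<le> (\<Sum>p\<in>UNIV. M m p)" by (rule member_le_sum) (auto intro: M(1))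
    also have "\<dots> \<le> B" unfolding B_def by (rule member_le_sum) (auto intro!: sum_nonneg M(1))
    finally show ?thesis .
  qed
  let ?g = "\<lambda>i. case i of None \<Rightarrow> c | Some m \<Rightarrow> D m"
  let ?d = "DIM(real^'n)"
  have gL: "?g i \<in> Linf" for i using c by (cases i) auto
  have "\<exists>r::nat \<Rightarrow> nat. AE x in lborel. norm x \<le> real R \<longrightarrow>
      (\<forall>i\<in>UNIV. (\<lambda>n. conv (?g i) (dilate (eps (r n)) \<eta>) x) \<longlonglongrightarrow> ?g i x)" for R :: nat
  proof (rule mollify_Linf_AE[where I = UNIV and g = ?g and R = "real R", OF finite gL \<eta>])
    fix r :: "nat \<Rightarrow> nat"
    assume "AE x in lborel. norm x \<le> real R \<longrightarrow>
      (\<forall>i\<in>UNIV. (\<lambda>n. conv (?g i) (dilate (eps (r n)) \<eta>) x) \<longlonglongrightarrow> ?g i x)"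
    then show ?thesis by (rule exI[of _ r])
  qed
  from choice[OF allI[OF this]] obtain r :: "nat \<Rightarrow> nat \<Rightarrow> nat"
    where "\<forall>R. AE x in lborel. norm x \<le> real R \<longrightarrow>
      (\<forall>i\<in>UNIV. (\<lambda>n. conv (?g i) (dilate (eps (r R n)) \<eta>) x) \<longlonglongrightarrow> ?g i x)" ..
  note r = this[rule_format]
  define Q where "Q x \<longleftrightarrow> (\<forall>R. norm x \<le> real R \<longrightarrow>
      (\<forall>i\<in>UNIV. (\<lambda>n. conv (?g i) (dilate (eps (r R n)) \<eta>) x) \<longlonglongrightarrow> ?g i x))" for x
  define L where "L = ?d * (?d * B)"
  show thesis
  proof
    show "0 \<le> L" unfolding L_def using B0 by simp
    show "AE x in lborel. Q x" unfolding Q_def AE_all_countable using r by blast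
    fix x y assume Q: "Q x" "Q y"
    obtain R :: nat where R: "max (norm x) (norm y) \<le> real R" using real_arch_simple by blast
    let ?\<eta> = "\<lambda>n. dilate (eps (r R n)) \<eta>"
    have t: "?\<eta> n \<in> test_functions" for n by (intro test_dilate mollifierD[OF \<eta>] eps_pos)
    have cl: "(\<lambda>n. conv c (?\<eta> n) z) \<longlonglongrightarrow> c z" if "Q z" "norm z \<le> real R" for z
      using that(1)[unfolded Q_def, rule_format, OF that(2) UNIV_I, of None] by simp
    have Dl: "(\<lambda>n. conv (D m) (?\<eta> n) z) \<longlonglongrightarrow> D m z" if "Q z" "norm z \<le> real R" for z m
      using that(1)[unfolded Q_def, rule_format, OF that(2) UNIV_I, of "Some m"] by simp
    have sm: "smooth (conv c (?\<eta> n))" "smooth (conv (D m) (?\<eta> n))" for n m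
      by (intro smooth_conv Linf_locally_integrable c t)+
    have d: "dir_deriv (axis m 1) (conv c (?\<eta> n)) = conv (D m) (?\<eta> n)" for m n
      by (rule dir_deriv_conv_weak[OF c(3) t])
    have d2: "norm (dir_deriv b (conv (D m) (?\<eta> n)) z) \<le> B" if "b \<in> Basis" for b m n z
    proof -
      obtain p where b: "b = axis p 1" using \<open>b \<in> Basis\<close> by (rule Basis_vecE)
      have "norm (conv (E m p) (?\<eta> n) z) \<le> M m p"
        by (rule mollify_Linf_bound[OF E(1) M(2) \<eta> eps_pos])
      then show ?thesis unfolding b dir_deriv_conv_weak[OF E(2) t] using MB[of m p] by simp
    qed
    have "norm (dir_deriv b (conv c (?\<eta> n)) w - dir_deriv b (conv c (?\<eta> n)) z) \<le> ?d * B * norm (w - z)"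
      if "b \<in> Basis" for b w z n
    proof -
      obtain m where b: "b = axis m 1" using \<open>b \<in> Basis\<close> by (rule Basis_vecE)
      show ?thesis unfolding b d by (intro mean_value_bound smooth_differentiable sm d2 B0)
    qed
    from taylor_bound[OF smooth_differentiable[OF sm(1)] this]
    have "norm (conv c (?\<eta> n) y - conv c (?\<eta> n) x - dir_deriv (y - x) (conv c (?\<eta> n)) x) \<le> L * (norm (y - x))\<^sup>2" for n
      using B0 by (simp add: L_def)
    then have le: "norm (conv c (?\<eta> n) y - conv c (?\<eta> n) x - (\<Sum>m\<in>UNIV. of_real ((y - x) $ m) * conv (D m) (?\<eta> n) x))
        \<le> L * (norm (y - x))\<^sup>2" for n
      unfolding dir_deriv_expand_vec[OF smooth_differentiable[OF sm(1)], of "y - x"] d .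
    have "(\<lambda>n. norm (conv c (?\<eta> n) y - conv c (?\<eta> n) x - (\<Sum>m\<in>UNIV. of_real ((y - x) $ m) * conv (D m) (?\<eta> n) x)))
        \<longlonglongrightarrow> norm (c y - c x - (\<Sum>m\<in>UNIV. of_real ((y - x) $ m) * D m x))"
      using Q R by (intro tendsto_intros cl Dl) auto
    then show "norm (c y - c x - (\<Sum>m\<in>UNIV. of_real ((y - x) $ m) * D m x)) \<le> L * (norm (y - x))\<^sup>2"
      by (rule LIMSEQ_le_const2) (use le in auto)
  qed
qed

text \<open>
  The derivative of the test function \<open>\<eta>(z) z\<^sub>m\<close> in direction \<open>l\<close> has integral zero.
\<close>

lemma integral_moment_kernel:
  fixes \<eta> :: "real^'n::finite \<Rightarrow> complex"
  assumes "mollifier \<eta>"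
  defines "\<rho> m l \<equiv> (\<lambda>z. of_real (z $ m) * dir_deriv (axis l 1) \<eta> z)"
  shows "\<rho> m l \<in> test_functions" "(\<integral>z. \<rho> m l z \<partial>lborel) = (if m = l then - 1 else 0)"
proof -
  note \<eta> = mollifierD[OF assms(1)]
  have bl: "bounded_linear (\<lambda>z::real^'n. complex_of_real (z $ m))"
    by (intro bounded_linear_compose[OF bounded_linear_of_real] bounded_linear_vec_nth)
  note sm = smooth_bounded_linear[OF bl]
  show \<rho>: "\<rho> m l \<in> test_functions"
    unfolding \<rho>_def by (rule smooth_mult_test[OF sm test_dir_deriv[OF \<eta>(1)]])
  have t: "(\<lambda>z. \<eta> z * of_real (z $ m)) \<in> test_functions" by (rule test_mult_smooth[OF \<eta>(1) sm])
  have "dir_deriv (axis l 1) (\<lambda>z. \<eta> z * of_real (z $ m)) = (\<lambda>z. (if m = l then \<eta> z else 0) + \<rho> m l z)"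
    using dir_deriv_mult[OF smooth_differentiable[OF test_smooth[OF \<eta>(1)]] smooth_differentiable[OF sm], of "axis l 1"]
    by (auto simp: dir_deriv_bounded_linear[OF bl] \<rho>_def axis_def fun_eq_iff)
  with integral_dir_deriv_test[OF t, of "axis l 1"]
  have "(\<integral>z. (if m = l then \<eta> z else 0) + \<rho> m l z \<partial>lborel) = 0" by simp
  moreover have "integrable lborel \<psi>" if "\<psi> \<in> test_functions" for \<psi> :: "real^'n \<Rightarrow> complex"
    using locally_integrable_mult_test[OF locally_integrable_const that, of 1] by simp
  ultimately show "(\<integral>z. \<rho> m l z \<partial>lborel) = (if m = l then - 1 else 0)"
    using \<eta>(1,4) \<rho> by (auto simp: add_eq_0_iff split: if_splits)
qed

text \<open>
  This is \<open>\<partial>\<^sub>l\<close> of the commutator of multiplication by \<open>c\<close> with mollification, applied to \<open>h\<close>. No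
  derivative of \<open>h\<close> is available to absorb \<open>\<partial>\<^sub>l\<close>, which costs a factor \<open>1 / eps n\<close> on the kernel. This is
  balanced by the factor \<open>c(x) - c(y)\<close>, of order \<open>eps n\<close> on the support of the kernel, and the resulting terms
  of order one cancel in the limit.
\<close>

lemma commutator_L2_lim:
  fixes c :: "real^'n::finite \<Rightarrow> complex" and l :: 'n
  assumes c: "c \<in> Linf" "\<And>m. D m \<in> Linf" "\<And>m. weak_partial_deriv m c (D m)"
    and E: "\<And>m p. E m p \<in> Linf" "\<And>m p. weak_partial_deriv p (D m) (E m p)"
    and \<eta>: "mollifier (\<eta> :: real^'n \<Rightarrow> complex)" and h: "h \<in> L2"
  defines "\<eta>n \<equiv> \<lambda>n. dilate (eps n) \<eta>"
  defines "d\<eta> \<equiv> \<lambda>n. dir_deriv (axis l 1) (\<eta>n n)"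
  shows "L2_lim (\<lambda>n x. D l x * conv h (\<eta>n n) x + c x * conv h (d\<eta> n) x - conv (\<lambda>y. c y * h y) (d\<eta> n) x) (\<lambda>x. 0)"
    (is "L2_lim ?S _")
proof -
  note \<eta>D = mollifierD[OF \<eta>]
  let ?d1 = "dir_deriv (axis l 1) \<eta>"
  have ht: "locally_integrable h" by (rule L2_imp_locally_integrable[OF h])
  have [measurable]: "h \<in> borel_measurable borel" "c \<in> borel_measurable borel" "D m \<in> borel_measurable borel" for m
    using h c by (auto intro: L2_measurable Linf_measurable)
  obtain M where M: "0 \<le> M" "AE x in lborel. norm (c x) \<le> M" using c(1) by (rule Linf_bound)
  have ch: "(\<lambda>y. c y * h y) \<in> L2" by (rule L2_mult_bounded(1)[OF h _ M(2,1)]) measurable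
  note cht = L2_imp_locally_integrable[OF ch]
  have \<eta>t: "\<eta>n n \<in> test_functions" for n unfolding \<eta>n_def by (intro test_dilate \<eta>D eps_pos)
  have d\<eta>t: "d\<eta> n \<in> test_functions" for n unfolding d\<eta>_def by (intro test_dir_deriv \<eta>t)
  have d\<eta>: "d\<eta> n z = of_real (1 / eps n) * dilate (eps n) ?d1 z" for n z
    unfolding d\<eta>_def \<eta>n_def by (rule dir_deriv_dilate[OF test_smooth[OF \<eta>D(1)]])
  define \<rho> where "\<rho> m z = of_real (z $ m) * ?d1 z" for m and z :: "real^'n"
  have \<rho>: "\<rho> m \<in> test_functions" "(\<integral>z. \<rho> m z \<partial>lborel) = (if m = l then - 1 else 0)" for m
    using integral_moment_kernel[OF \<eta>, of m l] unfolding \<rho>_def[abs_def] by auto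
  have moll: "L2_lim (\<lambda>n. conv h (dilate (eps n) \<kappa>)) (\<lambda>x. (\<integral>z. \<kappa> z \<partial>lborel) * h x)" if "\<kappa> \<in> test_functions" for \<kappa>
    using mollify_L2[OF h smooth_continuous] that unfolding test_functions_iff by metis
  \<comment> \<open>The terms of order one; everything else is the contribution \<open>T\<close> of the quadratic remainder.\<close>
  define P where "P n x = D l x * conv h (\<eta>n n) x + (\<Sum>m\<in>UNIV. D m x * conv h (dilate (eps n) (\<rho> m)) x)" for n x
  have bD: "\<exists>M. AE x in lborel. norm (D m x) \<le> M" for m using c(2)[of m] by (auto simp: Linf_def)
  have mD: "L2_lim (\<lambda>n x. D m x * F n x) (\<lambda>x. D m x * f x)" if "L2_lim F f" for m F f
    using bD[of m] L2_lim_mult_bounded[OF that] by auto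
  have "L2_lim P (\<lambda>x. D l x * ((\<integral>z. \<eta> z \<partial>lborel) * h x) + (\<Sum>m\<in>UNIV. D m x * ((\<integral>z. \<rho> m z \<partial>lborel) * h x)))"
    unfolding P_def[abs_def] \<eta>n_def by (intro L2_lim_add L2_lim_sum mD moll \<eta>D \<rho>) auto
  moreover have "(\<lambda>x. D l x * ((\<integral>z. \<eta> z \<partial>lborel) * h x) + (\<Sum>m\<in>UNIV. D m x * ((\<integral>z. \<rho> m z \<partial>lborel) * h x))) = (\<lambda>x. 0)"
    unfolding \<rho> \<eta>D(4) by (simp add: if_distrib[of "\<lambda>a. _ * (a * _)"] sum.delta' cong: if_cong)
  ultimately have Plim: "L2_lim P (\<lambda>x. 0)" by simp
  \<comment> \<open>Two powers of \<open>norm z\<close> from the remainder against one factor \<open>1 / eps n\<close> from the differentiated kernel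
    leave \<open>eps n\<close> times the dilation of this kernel.\<close>
  define \<sigma> :: "real^'n \<Rightarrow> complex" where "\<sigma> z = of_real ((norm z)\<^sup>2 * norm (?d1 z))" for z
  define ah where "ah x = complex_of_real (norm (h x))" for x
  have ah: "ah \<in> L2" unfolding ah_def[abs_def] using h by (rule L2_norm_abs)
  obtain R where R: "\<And>z. R < norm z \<Longrightarrow> ?d1 z = 0" using test_support[OF test_dir_deriv[OF \<eta>D(1)]] by metis
  have dc: "continuous_on UNIV ?d1" by (intro smooth_continuous test_smooth test_dir_deriv \<eta>D)
  have \<sigma>c: "continuous_on UNIV \<sigma>" "\<And>z. R < norm z \<Longrightarrow> \<sigma> z = 0"
    unfolding \<sigma>_def[abs_def] using R
    by (auto intro!: continuous_intros dc)
  have \<sigma>lim: "L2_lim (\<lambda>n. conv ah (dilate (eps n) \<sigma>)) (\<lambda>x. (\<integral>z. \<sigma> z \<partial>lborel) * ah x)"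
    by (rule mollify_L2[OF ah \<sigma>c])
  obtain L Q where L: "0 \<le> L" "AE x in lborel. Q x"
    "\<And>x y. Q x \<Longrightarrow> Q y \<Longrightarrow>
      norm (c y - c x - (\<Sum>m\<in>UNIV. of_real ((y - x) $ m) * D m x)) \<le> L * (norm (y - x))\<^sup>2"
    by (rule W2inf_taylor_AE[OF c E \<eta>]) blast
  define T where "T n x = ?S n x - P n x" for n x
  have Tb: "norm (T n x) \<le> L * eps n * norm (conv ah (dilate (eps n) \<sigma>) x)" if Q: "Q x" for n x
  proof -
    note e = eps_pos[of n]
    define rem where "rem y = c y - c x - (\<Sum>m\<in>UNIV. of_real ((y - x) $ m) * D m x)" for y
    have k\<rho>: "of_real ((x - y) $ m) * d\<eta> n (x - y) = dilate (eps n) (\<rho> m) (x - y)" for y m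
      using e by (simp add: d\<eta> dilate_def \<rho>_def)
    have ci: "integrable lborel (\<lambda>y. h y * d\<eta> n (x - y))" "integrable lborel (\<lambda>y. c y * h y * d\<eta> n (x - y))"
        "integrable lborel (\<lambda>y. h y * dilate (eps n) (\<rho> m) (x - y))" for m
      by (intro conv_integrable ht cht d\<eta>t test_dilate \<rho> e)+
    have eq: "(\<lambda>y. c x * (h y * d\<eta> n (x - y)) - c y * h y * d\<eta> n (x - y)
        - (\<Sum>m\<in>UNIV. D m x * (h y * dilate (eps n) (\<rho> m) (x - y)))) = (\<lambda>y. - (rem y * (h y * d\<eta> n (x - y))))"
    proof
      fix y
      have "(\<Sum>m\<in>UNIV. D m x * (h y * dilate (eps n) (\<rho> m) (x - y)))
          = (\<Sum>m\<in>UNIV. of_real ((x - y) $ m) * D m x) * (h y * d\<eta> n (x - y))"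
        unfolding k\<rho>[symmetric] sum_distrib_right by (intro sum.cong) (auto simp: mult_ac)
      moreover have "(\<Sum>m\<in>UNIV. of_real ((x - y) $ m) * D m x) = - (\<Sum>m\<in>UNIV. of_real ((y - x) $ m) * D m x)"
        unfolding sum_negf[symmetric] by (intro sum.cong) (auto simp: algebra_simps)
      ultimately show "c x * (h y * d\<eta> n (x - y)) - c y * h y * d\<eta> n (x - y)
        - (\<Sum>m\<in>UNIV. D m x * (h y * dilate (eps n) (\<rho> m) (x - y))) = - (rem y * (h y * d\<eta> n (x - y)))"
        by (simp add: rem_def algebra_simps)
    qed
    have irem: "integrable lborel (\<lambda>y. - (rem y * (h y * d\<eta> n (x - y))))"
      unfolding eq[symmetric]
      by (intro Bochner_Integration.integrable_diff Bochner_Integration.integrable_sum integrable_mult_right ci)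
    have "T n x = c x * conv h (d\<eta> n) x - conv (\<lambda>y. c y * h y) (d\<eta> n) x
        - (\<Sum>m\<in>UNIV. D m x * conv h (dilate (eps n) (\<rho> m)) x)" by (simp add: T_def P_def)
    also have "\<dots> = (\<integral>y. c x * (h y * d\<eta> n (x - y)) - c y * h y * d\<eta> n (x - y)
        - (\<Sum>m\<in>UNIV. D m x * (h y * dilate (eps n) (\<rho> m) (x - y))) \<partial>lborel)"
      unfolding conv_def using ci by simp
    finally have T: "T n x = (\<integral>y. - (rem y * (h y * d\<eta> n (x - y))) \<partial>lborel)"
      by (simp only: eq)
    have k\<sigma>: "(norm (y - x))\<^sup>2 * (norm (h y) * norm (d\<eta> n (x - y))) = eps n * Re (ah y * dilate (eps n) \<sigma> (x - y))" for y
    proof -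
      define w where "w = (1 / eps n) *\<^sub>R (x - y)"
      define q where "q = (1 / eps n) ^ DIM(real^'n)"
      have q: "0 \<le> q" unfolding q_def using e by simp
      have w: "norm w = norm (y - x) / eps n" unfolding w_def norm_scaleR using e by (simp add: norm_minus_commute)
      have "norm (d\<eta> n (x - y)) = 1 / eps n * (q * norm (?d1 w))"
        unfolding d\<eta> dilate_def w_def[symmetric] q_def[symmetric] norm_mult norm_of_real using q e by simp
      moreover have "Re (ah y * dilate (eps n) \<sigma> (x - y)) = norm (h y) * (q * ((norm w)\<^sup>2 * norm (?d1 w)))"
        unfolding ah_def dilate_def w_def[symmetric] q_def[symmetric] \<sigma>_def of_real_mult[symmetric] Re_complex_of_real ..
      ultimately show ?thesis unfolding w using e by (simp add: power_divide power2_eq_square)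
    qed
    have "integrable lborel (\<lambda>y. ah y * dilate (eps n) \<sigma> (x - y))"
    proof (rule locally_integrable_mult[OF L2_imp_locally_integrable[OF ah]])
      show "continuous_on UNIV (\<lambda>y. dilate (eps n) \<sigma> (x - y))"
        unfolding dilate_def by (intro continuous_intros continuous_on_compose2[OF \<sigma>c(1)]) auto
      show "dilate (eps n) \<sigma> (x - y) = 0" if "eps n * R + norm x < norm y" for y
      proof (rule dilate_support[OF \<sigma>c(2) e])
        show "eps n * R < norm (x - y)" using that norm_triangle_ineq2[of y x] by (simp add: norm_minus_commute)
      qed
    qed
    note i\<sigma> = this
    have "norm (T n x) \<le> (\<integral>y. L * (eps n * Re (ah y * dilate (eps n) \<sigma> (x - y))) \<partial>lborel)"
      unfolding T
    proof (rule order_trans[OF integral_norm_bound integral_mono_AE])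
      show "integrable lborel (\<lambda>y. norm (- (rem y * (h y * d\<eta> n (x - y)))))" using irem by (rule integrable_norm)
      show "integrable lborel (\<lambda>y. L * (eps n * Re (ah y * dilate (eps n) \<sigma> (x - y))))"
        using i\<sigma> by (intro integrable_mult_right integrable_Re)
      show "AE y in lborel. norm (- (rem y * (h y * d\<eta> n (x - y)))) \<le> L * (eps n * Re (ah y * dilate (eps n) \<sigma> (x - y)))"
        using L(2)
      proof eventually_elim
        case (elim y)
        have "norm (rem y) * (norm (h y) * norm (d\<eta> n (x - y)))
            \<le> L * (norm (y - x))\<^sup>2 * (norm (h y) * norm (d\<eta> n (x - y)))"
          unfolding rem_def by (intro mult_right_mono L(3) Q elim) auto
        also have "\<dots> = L * (eps n * Re (ah y * dilate (eps n) \<sigma> (x - y)))"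
          unfolding mult.assoc k\<sigma> ..
        finally show ?case by (simp only: norm_minus_cancel norm_mult)
      qed
    qed
    also have "\<dots> = L * eps n * Re (conv ah (dilate (eps n) \<sigma>) x)"
      unfolding integral_mult_right_zero conv_def integral_Re[OF i\<sigma>] by (rule mult.assoc[symmetric])
    also have "\<dots> \<le> L * eps n * norm (conv ah (dilate (eps n) \<sigma>) x)"
      using L(1) e by (intro mult_left_mono complex_Re_le_cmod) auto
    finally show ?thesis .
  qed
  have cm: "conv f \<kappa> \<in> borel_measurable borel" if "locally_integrable f" "\<kappa> \<in> test_functions" for f \<kappa> :: "real^'n \<Rightarrow> complex"
    by (rule borel_measurable_continuous_onI[OF smooth_continuous[OF smooth_conv[OF that]]])
  have [measurable]: "conv h (\<eta>n n) \<in> borel_measurable borel" "conv h (d\<eta> n) \<in> borel_measurable borel"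
      "conv (\<lambda>y. c y * h y) (d\<eta> n) \<in> borel_measurable borel" "P n \<in> borel_measurable borel" for n
    by (rule cm[OF ht \<eta>t] cm[OF ht d\<eta>t] cm[OF cht d\<eta>t] L2_measurable[OF L2_limD(1)[OF Plim]])+
  have Tm: "T n \<in> borel_measurable borel" for n unfolding T_def by measurable
  define W where "W n = L2_norm (conv ah (dilate (eps n) \<sigma>))" for n
  have Tn: "T n \<in> L2" "L2_norm (T n) \<le> L * eps n * W n" for n
  proof -
    have ae: "AE x in lborel. norm (T n x) \<le> L * eps n * norm (conv ah (dilate (eps n) \<sigma>) x)"
      using L(2) by eventually_elim (rule Tb)
    have "0 \<le> L * eps n" using L(1) eps_pos[of n] by simp
    from L2_bounded_by[OF L2_limD(1)[OF \<sigma>lim] Tm ae this]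
    show "T n \<in> L2" "L2_norm (T n) \<le> L * eps n * W n" by (auto simp: W_def)
  qed
  have Tlim: "L2_lim T (\<lambda>x. 0)"
  proof (rule L2_limI_bound)
    let ?s = "\<lambda>x. (\<integral>z. \<sigma> z \<partial>lborel) * ah x"
    let ?B = "\<lambda>n. L2_norm (\<lambda>x. conv ah (dilate (eps n) \<sigma>) x - ?s x) + L2_norm ?s"
    have "W n \<le> ?B n" for n
      unfolding W_def using L2_norm_triangle[OF L2_diff[OF L2_limD(1,2)[OF \<sigma>lim]] L2_limD(2)[OF \<sigma>lim], of n] by simp
    moreover have "0 \<le> L * eps n" for n using L(1) eps_pos[of n] by simp
    ultimately have "L * eps n * W n \<le> L * eps n * ?B n" for n by (rule mult_left_mono)
    then show "L2_norm (\<lambda>x. T n x - 0) \<le> L * eps n * ?B n" for n using Tn(2)[of n] by (auto intro: order_trans)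
    have "(\<lambda>n. L * eps n * ?B n) \<longlonglongrightarrow> L * 0 * (0 + L2_norm ?s)"
      by (intro tendsto_intros eps_tendsto L2_limD(3)[OF \<sigma>lim])
    then show "(\<lambda>n. L * eps n * ?B n) \<longlonglongrightarrow> 0" by simp
  qed (auto intro: Tn L2_zero)
  have "(\<lambda>n x. P n x + T n x) = ?S" by (simp add: fun_eq_iff T_def)
  then show ?thesis using L2_lim_add[OF Plim Tlim] by simp
qed

section \<open>The form on test functions\<close>

abbreviation dd :: "'n::finite \<Rightarrow> (real^'n \<Rightarrow> complex) \<Rightarrow> real^'n \<Rightarrow> complex" where
  "dd k \<equiv> dir_deriv (axis k 1)"

lemma weak_partial_derivD:
  assumes "weak_partial_deriv k f g"
  shows "locally_integrable f" "locally_integrable g"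
    "\<phi> \<in> test_functions \<Longrightarrow> (\<integral>x. f x * dd k \<phi> x \<partial>lborel) = - (\<integral>x. g x * \<phi> x \<partial>lborel)"
  using assms by (auto simp: weak_partial_deriv_def partial_deriv_eq)

lemma dd_cnj: "v \<in> test_functions \<Longrightarrow> dd l (\<lambda>x. cnj (v x)) = (\<lambda>x. cnj (dd l v x))"
  by (auto simp: fun_eq_iff intro!: dir_deriv_cnj smooth_differentiable test_smooth)

lemma dd_add:
  assumes "u \<in> test_functions" "v \<in> test_functions"
  shows "dd l (\<lambda>x. u x + v x) = (\<lambda>x. dd l u x + dd l v x)"
  by (auto simp: fun_eq_iff intro!: dir_deriv_add smooth_differentiable test_smooth assms)

lemma dd_cmult:
  assumes "u \<in> test_functions"
  shows "dd l (\<lambda>x. \<alpha> * u x) = (\<lambda>x. \<alpha> * dd l u x)"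
  using dir_deriv_mult[OF differentiable_const smooth_differentiable[OF test_smooth[OF assms]]]
  by (simp add: fun_eq_iff dir_deriv_const)

text \<open>
  \<open>D m k l\<close> and \<open>E m p k l\<close> stand for \<open>\<partial>\<^sub>m c\<^sub>k\<^sub>l\<close> and \<open>\<partial>\<^sub>p \<partial>\<^sub>m c\<^sub>k\<^sub>l\<close>.
\<close>

locale elliptic_coefficients =
  fixes c :: "'n::finite \<Rightarrow> 'n \<Rightarrow> real^'n \<Rightarrow> complex"
    and D :: "'n \<Rightarrow> 'n \<Rightarrow> 'n \<Rightarrow> real^'n \<Rightarrow> complex"
    and E :: "'n \<Rightarrow> 'n \<Rightarrow> 'n \<Rightarrow> 'n \<Rightarrow> real^'n \<Rightarrow> complex"
    and \<theta> :: real
  assumes \<theta>: "0 \<le> \<theta>" "\<theta> < pi / 2"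
    and c_Linf: "\<And>k l. c k l \<in> Linf"
    and D_Linf: "\<And>m k l. D m k l \<in> Linf"
    and D_weak: "\<And>m k l. weak_partial_deriv m (c k l) (D m k l)"
    and E_Linf: "\<And>m p k l. E m p k l \<in> Linf"
    and E_weak: "\<And>m p k l. weak_partial_deriv p (D m k l) (E m p k l)"
    and in_sector: "\<And>x \<xi>. cinner_vec (coeff_matrix c x *v \<xi>) \<xi> \<in> sector \<theta>"
begin

lemma measurable_coeffs [measurable]:
  "c k l \<in> borel_measurable borel" "D m k l \<in> borel_measurable borel"
  using c_Linf D_Linf by (auto intro: Linf_measurable)

lemma sector_bound:
  assumes "z \<in> sector \<theta>" shows "norm z \<le> Re z / cos \<theta>" "0 \<le> Re z"
proof -
  obtain r \<psi> where z: "z = rcis r \<psi>" "0 \<le> r" "\<bar>\<psi>\<bar> \<le> \<theta>" using assms by (auto simp: sector_def)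
  have c: "0 < cos \<theta>" using \<theta> by (intro cos_gt_zero_pi) auto
  have "cos \<theta> \<le> cos \<bar>\<psi>\<bar>" using z \<theta> by (intro cos_monotone_0_pi_le) auto
  then have "cos \<theta> \<le> cos \<psi>" by simp
  then have "r * cos \<theta> \<le> r * cos \<psi>" using z(2) by (rule mult_left_mono)
  then show "norm z \<le> Re z / cos \<theta>" using c z by (simp add: pos_le_divide_eq)
  then show "0 \<le> Re z" using c by (metis norm_ge_zero order_trans zero_le_divide_iff not_less)
qed

text \<open>
  In the form the derivatives of \<open>u\<close> carry the row index of the coefficients, in the matrix-vector product
  the column index. Conjugating the vector compensates for the transposition.
\<close>

lemma quadratic_form_in_sector:
  "(\<Sum>k\<in>UNIV. \<Sum>l\<in>UNIV. c k l x * \<xi> k * cnj (\<xi> l)) \<in> sector \<theta>"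
proof -
  have "cinner_vec (coeff_matrix c x *v (\<chi> i. cnj (\<xi> i))) (\<chi> i. cnj (\<xi> i))
      = (\<Sum>k\<in>UNIV. \<Sum>l\<in>UNIV. c k l x * \<xi> k * cnj (\<xi> l))"
    by (simp add: cinner_vec_def coeff_matrix_def matrix_vector_mult_def sum_distrib_right sum_distrib_left mult_ac)
  then show ?thesis using in_sector by metis
qed

abbreviation form :: "(real^'n \<Rightarrow> complex) \<Rightarrow> (real^'n \<Rightarrow> complex) \<Rightarrow> complex" where
  "form \<equiv> elliptic_form c"

lemma form_integrable:
  assumes "u \<in> test_functions" "v \<in> test_functions"
  shows "integrable lborel (\<lambda>x. c k l x * dd k u x * cnj (dd l v x))"
  by (intro L2_mult_integrable Linf_mult_L2 c_Linf test_L2 test_dir_deriv test_cnj assms)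

lemma form_eq:
  assumes "u \<in> test_functions" "v \<in> test_functions"
  shows "form u v = (\<Sum>k\<in>UNIV. \<Sum>l\<in>UNIV. \<integral>x. c k l x * dd k u x * cnj (dd l v x) \<partial>lborel)"
  by (simp add: elliptic_form_def partial_deriv_eq dd_cnj[OF assms(2)])

lemma form_add_left:
  assumes "u \<in> test_functions" "v \<in> test_functions" "w \<in> test_functions"
  shows "form (\<lambda>x. u x + v x) w = form u w + form v w"
proof -
  have "(\<integral>x. c k l x * (dd k u x + dd k v x) * cnj (dd l w x) \<partial>lborel)
      = (\<integral>x. c k l x * dd k u x * cnj (dd l w x) \<partial>lborel) + (\<integral>x. c k l x * dd k v x * cnj (dd l w x) \<partial>lborel)" for k l
    using form_integrable assms by (subst Bochner_Integration.integral_add[symmetric]) (auto simp: algebra_simps)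
  then show ?thesis by (simp add: form_eq test_add assms dd_add sum.distrib)
qed

lemma form_cmult_left:
  assumes "u \<in> test_functions" "w \<in> test_functions"
  shows "form (\<lambda>x. \<alpha> * u x) w = \<alpha> * form u w"
  using assms by (simp add: form_eq test_cmult dd_cmult sum_distrib_left mult.left_commute[of _ \<alpha>] mult.assoc)

lemma form_add_right:
  assumes "u \<in> test_functions" "v \<in> test_functions" "w \<in> test_functions"
  shows "form w (\<lambda>x. u x + v x) = form w u + form w v"
proof -
  have "(\<integral>x. c k l x * dd k w x * cnj (dd l u x + dd l v x) \<partial>lborel)
      = (\<integral>x. c k l x * dd k w x * cnj (dd l u x) \<partial>lborel) + (\<integral>x. c k l x * dd k w x * cnj (dd l v x) \<partial>lborel)" for k l
    using form_integrable assms by (subst Bochner_Integration.integral_add[symmetric]) (auto simp: algebra_simps)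
  then show ?thesis by (simp add: form_eq test_add assms dd_add sum.distrib del: complex_cnj_add)
qed

lemma form_cmult_right:
  assumes "u \<in> test_functions" "w \<in> test_functions"
  shows "form w (\<lambda>x. \<alpha> * u x) = cnj \<alpha> * form w u"
  using assms by (simp add: form_eq test_cmult dd_cmult sum_distrib_left mult.left_commute[of _ "cnj \<alpha>"] mult.assoc)

lemma form_diff_left:
  assumes "u \<in> test_functions" "v \<in> test_functions" "w \<in> test_functions"
  shows "form (\<lambda>x. u x - v x) w = form u w - form v w"
  using form_add_left[OF assms(1) test_cmult[OF assms(2)] assms(3), of "-1"] form_cmult_left[OF assms(2,3), of "-1"]
  by simp

lemma form_diff_right:
  assumes "u \<in> test_functions" "v \<in> test_functions" "w \<in> test_functions"
  shows "form w (\<lambda>x. u x - v x) = form w u - form w v"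
  using form_add_right[OF assms(1) test_cmult[OF assms(2)] assms(3), of "-1"] form_cmult_right[OF assms(2,3), of "-1"]
  by simp

lemma form_sectorial:
  assumes u: "u \<in> test_functions"
  shows "norm (form u u) \<le> Re (form u u) / cos \<theta>" "0 \<le> Re (form u u)"
proof -
  let ?q = "\<lambda>x. \<Sum>k\<in>UNIV. \<Sum>l\<in>UNIV. c k l x * dd k u x * cnj (dd l u x)"
  have int: "integrable lborel ?q"
    by (intro Bochner_Integration.integrable_sum form_integrable u)
  have eq: "form u u = (\<integral>x. ?q x \<partial>lborel)"
    by (simp add: form_eq[OF u u] form_integrable[OF u u])
  note q = sector_bound[OF quadratic_form_in_sector[of _ "\<lambda>k. dd k u _"]]
  have "norm (\<integral>x. ?q x \<partial>lborel) \<le> (\<integral>x. Re (?q x) / cos \<theta> \<partial>lborel)"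
    using int q(1) by (intro order_trans[OF integral_norm_bound integral_mono] integrable_norm
        integrable_divide integrable_Re)
  then show "norm (form u u) \<le> Re (form u u) / cos \<theta>"
    unfolding eq using int by (simp add: integral_Re del: Re_sum)
  have "0 \<le> (\<integral>x. Re (?q x) \<partial>lborel)" using q(2) by (intro integral_nonneg_AE AE_I2)
  then show "0 \<le> Re (form u u)" unfolding eq integral_Re[OF int] .
qed

lemma form_parallelogram:
  assumes "u \<in> test_functions" "v \<in> test_functions"
  shows "form (\<lambda>x. u x + v x) (\<lambda>x. u x + v x) + form (\<lambda>x. u x - v x) (\<lambda>x. u x - v x)
    = 2 * form u u + 2 * form v v"
  using assms
  by (simp add: form_add_left form_add_right form_diff_left form_diff_right test_add test_diff algebra_simps)

text \<open>
  Polarisation bounds the form by its values on the diagonal, where the modulus is controlled by the real part;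
  the four real parts add up without the mixed terms.
\<close>

lemma form_bound_sum:
  assumes u: "u \<in> test_functions" and v: "v \<in> test_functions"
  shows "norm (form u v) \<le> (Re (form u u) + Re (form v v)) / cos \<theta>"
proof -
  define w where "w \<alpha> = (\<lambda>x. u x + \<alpha> * v x)" for \<alpha> :: complex
  have wt: "w \<alpha> \<in> test_functions" for \<alpha> unfolding w_def by (intro test_add test_cmult u v)
  have ww: "form (w \<alpha>) (w \<alpha>) = form u u + cnj \<alpha> * form u v + \<alpha> * form v u + \<alpha> * cnj \<alpha> * form v v" for \<alpha>
    unfolding w_def using u v
    by (simp add: form_add_left form_add_right form_cmult_left form_cmult_right test_add test_cmult algebra_simps)
  let ?S = "form (w 1) (w 1) - form (w (-1)) (w (-1)) + \<i> * form (w \<i>) (w \<i>) - \<i> * form (w (-\<i>)) (w (-\<i>))"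
  have "4 * form u v = ?S" unfolding ww by (simp add: algebra_simps)
  then have "norm (4 * form u v) = norm ?S" by simp
  also have "\<dots> \<le> norm (form (w 1) (w 1)) + norm (form (w (-1)) (w (-1)))
      + norm (\<i> * form (w \<i>) (w \<i>)) + norm (\<i> * form (w (-\<i>)) (w (-\<i>)))"
    by (intro order_trans[OF norm_triangle_ineq4 add_right_mono] order_trans[OF norm_triangle_ineq add_right_mono]
        norm_triangle_ineq4)
  also have "\<dots> = norm (form (w 1) (w 1)) + norm (form (w (-1)) (w (-1)))
      + norm (form (w \<i>) (w \<i>)) + norm (form (w (-\<i>)) (w (-\<i>)))" by (simp add: norm_mult)
  also have "\<dots> \<le> Re (form (w 1) (w 1)) / cos \<theta> + Re (form (w (-1)) (w (-1))) / cos \<theta>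
      + Re (form (w \<i>) (w \<i>)) / cos \<theta> + Re (form (w (-\<i>)) (w (-\<i>))) / cos \<theta>"
    by (intro add_mono form_sectorial wt)
  also have "\<dots> = 4 * ((Re (form u u) + Re (form v v)) / cos \<theta>)"
    unfolding ww by (simp add: add_divide_distrib[symmetric] diff_divide_distrib[symmetric])
  finally show ?thesis by (simp only: norm_mult norm_numeral mult_le_cancel_left_pos zero_less_numeral)
qed

text \<open>
  Scaling one argument gives a free parameter, in place of the product of square roots in the generalised
  Cauchy-Schwarz inequality.
\<close>

lemma form_bound:
  assumes u: "u \<in> test_functions" and v: "v \<in> test_functions" and s: "0 < s"
  shows "norm (form u v) \<le> (s * Re (form u u) + Re (form v v) / s) / cos \<theta>"
proof -
  have su: "(\<lambda>x. of_real s * u x) \<in> test_functions" using u by (rule test_cmult)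
  have "s * norm (form u v) = norm (form (\<lambda>x. of_real s * u x) v)"
    using s by (simp add: form_cmult_left u v norm_mult)
  also have "\<dots> \<le> (Re (form (\<lambda>x. of_real s * u x) (\<lambda>x. of_real s * u x)) + Re (form v v)) / cos \<theta>"
    by (rule form_bound_sum[OF su v])
  also have "\<dots> = (s * (s * Re (form u u)) + Re (form v v)) / cos \<theta>"
    by (simp add: form_cmult_left[OF u su] form_cmult_right[OF u u])
  also have "\<dots> = s * ((s * Re (form u u) + Re (form v v) / s) / cos \<theta>)"
    unfolding times_divide_eq_right distrib_left using s by simp
  finally show ?thesis using s by (simp only: mult_le_cancel_left_pos)
qed

text \<open>
  The formal operator \<open>- (\<Sum>k l. \<partial>\<^sub>l (c\<^sub>k\<^sub>l \<partial>\<^sub>k g))\<close>, expanded so that it makes sense pointwise for every smooth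
  \<open>g\<close> once the weak derivatives of the coefficients are chosen.
\<close>

definition op :: "(real^'n \<Rightarrow> complex) \<Rightarrow> real^'n \<Rightarrow> complex" where
  "op g x = - (\<Sum>k\<in>UNIV. \<Sum>l\<in>UNIV. D l k l x * dd k g x + c k l x * dd l (dd k g) x)"

text \<open>
  The transpose \<open>- (\<Sum>k l. \<partial>\<^sub>k (c\<^sub>k\<^sub>l \<partial>\<^sub>l g))\<close> with respect to the bilinear pairing, without
  complex conjugation.
\<close>

definition transposed_op :: "(real^'n \<Rightarrow> complex) \<Rightarrow> real^'n \<Rightarrow> complex" where
  "transposed_op g x = - (\<Sum>k\<in>UNIV. \<Sum>l\<in>UNIV. D k k l x * dd l g x + c k l x * dd k (dd l g) x)"

lemma op_L2: "\<phi> \<in> test_functions \<Longrightarrow> op \<phi> \<in> L2"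
  unfolding op_def[abs_def]
  by (intro L2_uminus L2_sum L2_add Linf_mult_L2 c_Linf D_Linf test_L2 test_dir_deriv finite)

lemma transposed_op_L2: "\<phi> \<in> test_functions \<Longrightarrow> transposed_op \<phi> \<in> L2"
  unfolding transposed_op_def[abs_def]
  by (intro L2_uminus L2_sum L2_add Linf_mult_L2 c_Linf D_Linf test_L2 test_dir_deriv finite)

lemma integral_by_parts:
  assumes \<phi>: "\<phi> \<in> test_functions" and \<psi>: "\<psi> \<in> test_functions"
  shows "(\<integral>x. c k l x * \<phi> x * dd m \<psi> x \<partial>lborel) = - (\<integral>x. (D m k l x * \<phi> x + c k l x * dd m \<phi> x) * \<psi> x \<partial>lborel)"
proof -
  have t: "(\<lambda>x. \<phi> x * \<psi> x) \<in> test_functions" by (rule test_mult_smooth[OF \<phi> test_smooth[OF \<psi>]])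
  have d: "dd m (\<lambda>x. \<phi> x * \<psi> x) = (\<lambda>x. \<phi> x * dd m \<psi> x + dd m \<phi> x * \<psi> x)"
    by (auto simp: fun_eq_iff intro!: dir_deriv_mult smooth_differentiable test_smooth \<phi> \<psi>)
  have eq: "(\<integral>x. c k l x * (\<phi> x * dd m \<psi> x + dd m \<phi> x * \<psi> x) \<partial>lborel) = - (\<integral>x. D m k l x * (\<phi> x * \<psi> x) \<partial>lborel)"
    using weak_partial_derivD(3)[OF D_weak[of m k l] t] by (simp add: d)
  have i: "integrable lborel (\<lambda>x. c k l x * \<phi> x * dd m \<psi> x)" "integrable lborel (\<lambda>x. c k l x * dd m \<phi> x * \<psi> x)"
      "integrable lborel (\<lambda>x. D m k l x * \<phi> x * \<psi> x)"
    by (intro L2_mult_integrable Linf_mult_L2 c_Linf D_Linf test_L2 test_dir_deriv \<phi> \<psi>)+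
  have "(\<integral>x. c k l x * (\<phi> x * dd m \<psi> x + dd m \<phi> x * \<psi> x) \<partial>lborel)
      = (\<integral>x. c k l x * \<phi> x * dd m \<psi> x \<partial>lborel) + (\<integral>x. c k l x * dd m \<phi> x * \<psi> x \<partial>lborel)"
    by (subst Bochner_Integration.integral_add[OF i(1,2), symmetric]) (simp add: algebra_simps)
  moreover have "(\<integral>x. (D m k l x * \<phi> x + c k l x * dd m \<phi> x) * \<psi> x \<partial>lborel)
      = (\<integral>x. D m k l x * (\<phi> x * \<psi> x) \<partial>lborel) + (\<integral>x. c k l x * dd m \<phi> x * \<psi> x \<partial>lborel)"
    using Bochner_Integration.integral_add[OF i(3,2)] by (simp add: distrib_right mult.assoc)
  ultimately show ?thesis using eq by algebra
qed

lemma form_eq_op: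
  assumes \<phi>: "\<phi> \<in> test_functions" and \<psi>: "\<psi> \<in> test_functions"
  shows "form \<phi> \<psi> = (\<integral>x. op \<phi> x * cnj (\<psi> x) \<partial>lborel)"
proof -
  have i: "integrable lborel (\<lambda>x. (D l k l x * dd k \<phi> x + c k l x * dd l (dd k \<phi>) x) * cnj (\<psi> x))" for k l
    by (intro L2_mult_integrable L2_add Linf_mult_L2 c_Linf D_Linf test_L2 test_dir_deriv test_cnj \<phi> \<psi>)
  have "form \<phi> \<psi> = (\<Sum>k\<in>UNIV. \<Sum>l\<in>UNIV. \<integral>x. c k l x * dd k \<phi> x * dd l (\<lambda>x. cnj (\<psi> x)) x \<partial>lborel)"
    by (simp add: form_eq \<phi> \<psi> dd_cnj)
  also have "\<dots> = (\<Sum>k\<in>UNIV. \<Sum>l\<in>UNIV. - (\<integral>x. (D l k l x * dd k \<phi> x + c k l x * dd l (dd k \<phi>) x) * cnj (\<psi> x) \<partial>lborel))"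
    by (intro sum.cong refl integral_by_parts test_dir_deriv test_cnj \<phi> \<psi>)
  also have "\<dots> = (\<integral>x. - (\<Sum>k\<in>UNIV. \<Sum>l\<in>UNIV. (D l k l x * dd k \<phi> x + c k l x * dd l (dd k \<phi>) x) * cnj (\<psi> x)) \<partial>lborel)"
    using i by (simp add: sum_negf)
  also have "\<dots> = (\<integral>x. op \<phi> x * cnj (\<psi> x) \<partial>lborel)"
    unfolding op_def by (simp add: sum_distrib_right)
  finally show ?thesis .
qed

lemma form_eq_transposed_op:
  assumes \<phi>: "\<phi> \<in> test_functions" and \<psi>: "\<psi> \<in> test_functions"
  shows "form \<phi> \<psi> = (\<integral>x. \<phi> x * transposed_op (\<lambda>x. cnj (\<psi> x)) x \<partial>lborel)"
proof -
  let ?\<psi> = "\<lambda>x. cnj (\<psi> x)"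
  have t: "?\<psi> \<in> test_functions" by (rule test_cnj[OF \<psi>])
  have i: "integrable lborel (\<lambda>x. \<phi> x * (D k k l x * dd l ?\<psi> x + c k l x * dd k (dd l ?\<psi>) x))" for k l
    by (intro L2_mult_integrable L2_add Linf_mult_L2 c_Linf D_Linf test_L2 test_dir_deriv t \<phi>)
  have "form \<phi> \<psi> = (\<Sum>k\<in>UNIV. \<Sum>l\<in>UNIV. \<integral>x. c k l x * dd l ?\<psi> x * dd k \<phi> x \<partial>lborel)"
    by (simp add: form_eq \<phi> \<psi> dd_cnj mult_ac)
  also have "\<dots> = (\<Sum>k\<in>UNIV. \<Sum>l\<in>UNIV. - (\<integral>x. (D k k l x * dd l ?\<psi> x + c k l x * dd k (dd l ?\<psi>) x) * \<phi> x \<partial>lborel))"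
    by (intro sum.cong refl integral_by_parts test_dir_deriv t \<phi>)
  also have "\<dots> = (\<Sum>k\<in>UNIV. \<Sum>l\<in>UNIV. - (\<integral>x. \<phi> x * (D k k l x * dd l ?\<psi> x + c k l x * dd k (dd l ?\<psi>) x) \<partial>lborel))"
    by (simp only: mult.commute)
  also have "\<dots> = (\<integral>x. - (\<Sum>k\<in>UNIV. \<Sum>l\<in>UNIV. \<phi> x * (D k k l x * dd l ?\<psi> x + c k l x * dd k (dd l ?\<psi>) x)) \<partial>lborel)"
    using i by (simp add: sum_negf)
  also have "\<dots> = (\<integral>x. \<phi> x * transposed_op ?\<psi> x \<partial>lborel)"
    unfolding transposed_op_def by (simp add: sum_distrib_left)
  finally show ?thesis .
qed

section \<open>The closure of the form\<close>

abbreviation "fconv \<equiv> form_converges test_functions form"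

lemma fconv_test: "fconv w u \<Longrightarrow> w n \<in> test_functions"
  by (simp add: form_converges_def)

lemma fconv_L2_lim: "fconv w u \<Longrightarrow> u \<in> L2 \<Longrightarrow> L2_lim w u"
  by (simp add: form_converges_def L2_lim_def test_L2)

lemma fconv_Cauchy:
  "fconv w u \<Longrightarrow> 0 < e \<Longrightarrow>
    \<exists>N. \<forall>m\<ge>N. \<forall>n\<ge>N. norm (form (\<lambda>x. w m x - w n x) (\<lambda>x. w m x - w n x)) < e"
  by (simp add: form_converges_def)

lemma fconv_const: "\<phi> \<in> test_functions \<Longrightarrow> fconv (\<lambda>n. \<phi>) \<phi>"
  using form_cmult_left[OF test_zero test_zero, of 0]
  by (simp add: form_converges_def L2_norm_def)

lemma cos_pos: "0 < cos \<theta>"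
  using \<theta> by (intro cos_gt_zero_pi) auto

lemma fconv_bounded:
  assumes "fconv w u"
  obtains B N where "0 \<le> B" "\<And>n. n \<ge> N \<Longrightarrow> Re (form (w n) (w n)) \<le> B"
proof -
  note t = fconv_test[OF assms]
  obtain N where N: "\<And>m n. m \<ge> N \<Longrightarrow> n \<ge> N \<Longrightarrow> norm (form (\<lambda>x. w m x - w n x) (\<lambda>x. w m x - w n x)) < 1"
    using fconv_Cauchy[OF assms, of 1] by auto
  \<comment> \<open>By the parallelogram identity for \<open>w n = (w n - w N) + w N\<close>.\<close>
  define B where "B = 2 + 2 * Re (form (w N) (w N))"
  have "Re (form (w n) (w n)) \<le> B" if n: "n \<ge> N" for n
  proof -
    let ?d = "\<lambda>x. w n x - w N x"
    have dt: "?d \<in> test_functions" by (rule test_diff[OF t t])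
    have "Re (form (w n) (w n)) + Re (form (\<lambda>x. ?d x - w N x) (\<lambda>x. ?d x - w N x))
        = 2 * Re (form ?d ?d) + 2 * Re (form (w N) (w N))"
      using arg_cong[OF form_parallelogram[OF dt t[of N]], of Re] by simp
    moreover have "0 \<le> Re (form (\<lambda>x. ?d x - w N x) (\<lambda>x. ?d x - w N x))"
      by (intro form_sectorial test_diff dt t)
    moreover have "Re (form ?d ?d) \<le> 1" using N[OF n order_refl] complex_Re_le_cmod[of "form ?d ?d"] by linarith
    ultimately show ?thesis unfolding B_def by linarith
  qed
  moreover have "0 \<le> B" unfolding B_def using form_sectorial(2)[OF t[of N]] by simp
  ultimately show ?thesis using that by blast
qed

text \<open>
  With \<open>z\<^sub>n = w\<^sub>n - \<psi>\<close>, split \<open>form z\<^sub>n z\<^sub>n\<close> into \<open>form z\<^sub>n z\<^sub>m\<close> and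
  \<open>form z\<^sub>n (z\<^sub>n - z\<^sub>m)\<close>. For fixed \<open>n\<close> the first part tends to zero as \<open>m\<close> grows, because it is the
  inner product of the fixed \<open>L\<^sub>2\<close> function \<open>op z\<^sub>n\<close> with \<open>z\<^sub>m\<close>; the second part is small by the
  Cauchy property.
\<close>

lemma form_closable:
  assumes w: "fconv w \<psi>" and \<psi>: "\<psi> \<in> test_functions"
  shows "(\<lambda>n. Re (form (\<lambda>x. w n x - \<psi> x) (\<lambda>x. w n x - \<psi> x))) \<longlonglongrightarrow> 0"
proof (rule LIMSEQ_I)
  fix r :: real assume r: "0 < r"
  define z where "z n = (\<lambda>x. w n x - \<psi> x)" for n
  have zt: "z n \<in> test_functions" for n unfolding z_def by (intro test_diff fconv_test[OF w] \<psi>)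
  have zd: "(\<lambda>x. z m x - z n x) = (\<lambda>x. w m x - w n x)" for m n by (simp add: z_def fun_eq_iff)
  have z0: "L2_lim z (\<lambda>x. 0)"
    using L2_lim_diff[OF fconv_L2_lim[OF w test_L2[OF \<psi>]] L2_lim_const[OF test_L2[OF \<psi>]]] by (simp add: z_def[abs_def])
  define C where "C = cos \<theta>"
  have C: "0 < C" unfolding C_def by (rule cos_pos)
  \<comment> \<open>Chosen so that the contribution \<open>2 * \<delta> / C\<^sup>2\<close> of the second part below is \<open>r / 4\<close>.\<close>
  define \<delta> where "\<delta> = r * C\<^sup>2 / 8"
  have "0 < \<delta>" unfolding \<delta>_def using r C by simp
  then obtain N where N: "\<And>m n. m \<ge> N \<Longrightarrow> n \<ge> N \<Longrightarrow> norm (form (\<lambda>x. w m x - w n x) (\<lambda>x. w m x - w n x)) < \<delta>"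
    using fconv_Cauchy[OF w, of \<delta>] by auto
  have "Re (form (z n) (z n)) < r" if n: "n \<ge> N" for n
  proof -
    define a where "a = Re (form (z n) (z n))"
    have "norm (form (z n) (z n)) \<le> norm (form (z n) (z m)) + (a / 2 + 2 * \<delta> / C\<^sup>2)" if m: "m \<ge> N" for m
    proof -
      let ?d = "\<lambda>x. z n x - z m x"
      have dt: "?d \<in> test_functions" by (intro test_diff zt)
      have "form (z n) (z n) = form (z n) (z m) + form (z n) ?d"
        by (simp add: form_diff_right zt)
      then have "norm (form (z n) (z n)) \<le> norm (form (z n) (z m)) + norm (form (z n) ?d)"
        using norm_triangle_ineq by metis
      \<comment> \<open>The parameter \<open>C / 2\<close> leaves half of \<open>a\<close> on the right, where it can be absorbed.\<close>
      moreover have "norm (form (z n) ?d) \<le> ((C / 2) * a + Re (form ?d ?d) / (C / 2)) / C"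
        unfolding a_def C_def using C by (intro form_bound zt dt) (simp add: C_def)
      moreover have "((C / 2) * a + Re (form ?d ?d) / (C / 2)) / C = a / 2 + 2 * Re (form ?d ?d) / C\<^sup>2"
        using C by (simp add: field_simps power2_eq_square)
      moreover have "Re (form ?d ?d) \<le> \<delta>"
        using N[OF n m] complex_Re_le_cmod[of "form ?d ?d"] unfolding zd by linarith
      then have "2 * Re (form ?d ?d) / C\<^sup>2 \<le> 2 * \<delta> / C\<^sup>2" by (intro divide_right_mono) auto
      ultimately show ?thesis by linarith
    qed
    moreover have "(\<lambda>m. norm (form (z n) (z m)) + (a / 2 + 2 * \<delta> / C\<^sup>2)) \<longlonglongrightarrow> 0 + (a / 2 + 2 * \<delta> / C\<^sup>2)"
    proof (intro tendsto_add tendsto_const)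
      have lim: "(\<lambda>m. L2_norm (op (z n)) * L2_norm (z m)) \<longlonglongrightarrow> 0"
        using tendsto_mult[OF tendsto_const L2_limD(3)[OF z0], of "L2_norm (op (z n))"] by simp
      have "norm (form (z n) (z m)) \<le> L2_norm (op (z n)) * L2_norm (z m)" for m
        unfolding form_eq_op[OF zt zt] using L2_integral_bound[OF op_L2[OF zt] L2_cnj[OF test_L2[OF zt]]]
        by (simp add: L2_norm_def)
      then have "(\<lambda>m. form (z n) (z m)) \<longlonglongrightarrow> 0"
        by (intro Lim_null_comparison[OF _ lim] always_eventually allI)
      then show "(\<lambda>m. norm (form (z n) (z m))) \<longlonglongrightarrow> 0" by (rule tendsto_norm_zero)
    qed
    ultimately have "norm (form (z n) (z n)) \<le> 0 + (a / 2 + 2 * \<delta> / C\<^sup>2)"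
      by (intro LIMSEQ_le_const) auto
    moreover have "a \<le> norm (form (z n) (z n))" unfolding a_def by (rule complex_Re_le_cmod)
    moreover have "2 * \<delta> / C\<^sup>2 = r / 4" unfolding \<delta>_def using C by simp
    ultimately show ?thesis using r unfolding a_def by linarith
  qed
  moreover have "0 \<le> Re (form (z n) (z n))" for n by (rule form_sectorial(2)[OF zt])
  ultimately show "\<exists>no. \<forall>n\<ge>no. norm (Re (form (\<lambda>x. w n x - \<psi> x) (\<lambda>x. w n x - \<psi> x)) - 0) < r"
    unfolding z_def by (intro exI[of _ N]) auto
qed

lemma form_vanishes:
  assumes u: "\<And>n. u n \<in> test_functions" and v: "\<And>n. v n \<in> test_functions"
    and B: "\<And>n. n \<ge> N \<Longrightarrow> Re (form (u n) (u n)) \<le> B" "0 \<le> B"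
    and lim: "(\<lambda>n. Re (form (v n) (v n))) \<longlonglongrightarrow> 0"
  shows "(\<lambda>n. form (u n) (v n)) \<longlonglongrightarrow> 0" "(\<lambda>n. form (v n) (u n)) \<longlonglongrightarrow> 0"
proof -
  define C where "C = cos \<theta>"
  have C: "0 < C" unfolding C_def by (rule cos_pos)
  have *: "\<exists>no. \<forall>n\<ge>no. norm (form (u n) (v n) - 0) < r \<and> norm (form (v n) (u n) - 0) < r" if r: "0 < r" for r
  proof -
    \<comment> \<open>With this parameter each of the two terms of the form bound contributes less than \<open>r / 2\<close>.\<close>
    define s where "s = r * C / 2 / (B + 1)"
    have s: "0 < s" unfolding s_def using r C B by simp
    have "0 < s * r * C / 2" using s r C by simp
    then obtain M where M: "\<And>n. n \<ge> M \<Longrightarrow> norm (Re (form (v n) (v n)) - 0) < s * r * C / 2"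
      using LIMSEQ_D[OF lim] by metis
    show ?thesis
    proof (intro exI allI impI)
      fix n assume n: "n \<ge> max M N"
      have "s * Re (form (u n) (u n)) \<le> s * B" using n B(1)[of n] s by (intro mult_left_mono) auto
      also have "\<dots> < s * (B + 1)" using s by simp
      also have "\<dots> = r * C / 2" using B(2) by (metis eq_divide_eq s_def add_nonneg_pos less_irrefl zero_less_one)
      finally have 1: "s * Re (form (u n) (u n)) < r * C / 2" .
      have "Re (form (v n) (v n)) < s * r * C / 2" using M[of n] n by simp
      then have 2: "Re (form (v n) (v n)) / s < r * C / 2" using s by (simp add: pos_divide_less_eq mult_ac)
      have 3: "(s * Re (form (u n) (u n)) + Re (form (v n) (v n)) / s) / C < r"
      proof -
        have "s * Re (form (u n) (u n)) + Re (form (v n) (v n)) / s < r * C" using 1 2 by linarith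
        then show ?thesis by (simp only: pos_divide_less_eq[OF C])
      qed
      have "0 < 1 / s" using s by simp
      from form_bound[OF u v s, of n n] form_bound[OF v u this, of n n] 3
      show "norm (form (u n) (v n) - 0) < r \<and> norm (form (v n) (u n) - 0) < r"
        unfolding C_def by (simp add: mult.commute add.commute)
    qed
  qed
  show "(\<lambda>n. form (u n) (v n)) \<longlonglongrightarrow> 0" "(\<lambda>n. form (v n) (u n)) \<longlonglongrightarrow> 0"
    by (rule LIMSEQ_I, drule *, blast)+
qed

abbreviation "V \<equiv> closure_domain test_functions form"

text \<open>
  Every pair of approximating sequences gives the same limit: replacing the sequence for \<open>\<psi>\<close> by \<open>\<psi>\<close> itself changes
  the values by a null sequence, and then all derivatives can be moved onto \<open>\<psi>\<close>, so that convergence in \<open>L\<^sub>2\<close>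
  suffices.
\<close>

lemma closure_form_test_right:
  assumes u: "u \<in> V" and \<psi>: "\<psi> \<in> test_functions"
  shows "closure_form test_functions form u \<psi> = (\<integral>x. u x * transposed_op (\<lambda>x. cnj (\<psi> x)) x \<partial>lborel)"
    (is "_ = ?z")
proof -
  have uL: "u \<in> L2" using u by (simp add: closure_domain_def)
  have lim: "(\<lambda>n. form (w n) (w' n)) \<longlonglongrightarrow> ?z" if w: "fconv w u" and w': "fconv w' \<psi>" for w w'
  proof -
    note t = fconv_test[OF w] fconv_test[OF w']
    obtain B N where B: "0 \<le> B" "\<And>n. n \<ge> N \<Longrightarrow> Re (form (w n) (w n)) \<le> B" using fconv_bounded[OF w] by blast
    have "(\<lambda>n. form (w n) \<psi>) \<longlonglongrightarrow> ?z"
      unfolding form_eq_transposed_op[OF t(1) \<psi>]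
      by (intro L2_lim_integral fconv_L2_lim[OF w uL] L2_lim_const transposed_op_L2 test_cnj \<psi>)
    moreover have "(\<lambda>n. form (w n) (\<lambda>x. w' n x - \<psi> x)) \<longlonglongrightarrow> 0"
      by (rule form_vanishes(1)[OF t(1) test_diff[OF t(2) \<psi>] B(2,1) form_closable[OF w' \<psi>]])
    ultimately have "(\<lambda>n. form (w n) \<psi> + form (w n) (\<lambda>x. w' n x - \<psi> x)) \<longlonglongrightarrow> ?z + 0" by (rule tendsto_add)
    then show ?thesis by (simp add: form_diff_right t \<psi>)
  qed
  obtain w where w: "fconv w u" using u by (auto simp: closure_domain_def)
  show ?thesis unfolding closure_form_def
  proof (rule the_equality)
    show "\<exists>w w'. fconv w u \<and> fconv w' \<psi> \<and> (\<lambda>n. form (w n) (w' n)) \<longlonglongrightarrow> ?z"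
      using w fconv_const[OF \<psi>] lim by blast
    show "z = ?z" if "\<exists>w w'. fconv w u \<and> fconv w' \<psi> \<and> (\<lambda>n. form (w n) (w' n)) \<longlonglongrightarrow> z" for z
      using that lim LIMSEQ_unique by blast
  qed
qed

lemma closure_form_test_left:
  assumes v: "v \<in> V" and \<phi>: "\<phi> \<in> test_functions"
  shows "closure_form test_functions form \<phi> v = L2_inner (op \<phi>) v"
proof -
  have vL: "v \<in> L2" using v by (simp add: closure_domain_def)
  have lim: "(\<lambda>n. form (w n) (w' n)) \<longlonglongrightarrow> L2_inner (op \<phi>) v" if w: "fconv w \<phi>" and w': "fconv w' v" for w w'
  proof -
    note t = fconv_test[OF w] fconv_test[OF w']
    obtain B N where B: "0 \<le> B" "\<And>n. n \<ge> N \<Longrightarrow> Re (form (w' n) (w' n)) \<le> B" using fconv_bounded[OF w'] by blast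
    have "L2_lim (\<lambda>n x. cnj (w' n x)) (\<lambda>x. cnj (v x))"
    proof -
      have "L2_norm (\<lambda>x. cnj (w' n x) - cnj (v x)) = L2_norm (\<lambda>x. w' n x - v x)" for n
        by (simp add: L2_norm_def flip: complex_cnj_diff)
      then show ?thesis using fconv_L2_lim[OF w' vL] by (simp add: L2_lim_def L2_cnj)
    qed
    then have "(\<lambda>n. form \<phi> (w' n)) \<longlonglongrightarrow> L2_inner (op \<phi>) v"
      unfolding form_eq_op[OF \<phi> t(2)] L2_inner_def
      by (intro L2_lim_integral L2_lim_const op_L2 \<phi>)
    moreover have "(\<lambda>n. form (\<lambda>x. w n x - \<phi> x) (w' n)) \<longlonglongrightarrow> 0"
      by (rule form_vanishes(2)[OF t(2) test_diff[OF t(1) \<phi>] B(2,1) form_closable[OF w \<phi>]])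
    ultimately have "(\<lambda>n. form \<phi> (w' n) + form (\<lambda>x. w n x - \<phi> x) (w' n)) \<longlonglongrightarrow> L2_inner (op \<phi>) v + 0"
      by (rule tendsto_add)
    then show ?thesis by (simp add: form_diff_left t \<phi>)
  qed
  obtain w where w: "fconv w v" using v by (auto simp: closure_domain_def)
  show ?thesis unfolding closure_form_def
  proof (rule the_equality)
    show "\<exists>w w'. fconv w \<phi> \<and> fconv w' v \<and> (\<lambda>n. form (w n) (w' n)) \<longlonglongrightarrow> L2_inner (op \<phi>) v"
      using w fconv_const[OF \<phi>] lim by blast
    show "z = L2_inner (op \<phi>) v" if "\<exists>w w'. fconv w \<phi> \<and> fconv w' v \<and> (\<lambda>n. form (w n) (w' n)) \<longlonglongrightarrow> z" for z
      using that lim LIMSEQ_unique by blast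
  qed
qed

lemma test_in_V: "\<phi> \<in> test_functions \<Longrightarrow> \<phi> \<in> V"
  unfolding closure_domain_def using test_L2 fconv_const by blast

lemma test_in_operator: "\<phi> \<in> test_functions \<Longrightarrow> (\<phi>, op \<phi>) \<in> elliptic_operator c"
  unfolding elliptic_operator_def associated_operator_def
  by (simp add: test_in_V op_L2 closure_form_test_left)

text \<open>
  Elements of the graph solve the equation in the sense of distributions. The closed form has no integral
  representation for general \<open>u\<close>, so both derivatives have to sit on the test function.
\<close>

lemma operator_weak:
  assumes uf: "(u, f) \<in> elliptic_operator c" and \<psi>: "\<psi> \<in> test_functions"
  shows "(\<integral>x. f x * \<psi> x \<partial>lborel) = (\<integral>x. u x * transposed_op \<psi> x \<partial>lborel)"
proof -
  let ?\<psi> = "\<lambda>x. cnj (\<psi> x)"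
  have t: "?\<psi> \<in> test_functions" by (rule test_cnj[OF \<psi>])
  have u: "u \<in> V" and eq: "\<And>v. v \<in> V \<Longrightarrow> closure_form test_functions form u v = L2_inner f v"
    using uf by (auto simp: elliptic_operator_def associated_operator_def)
  from eq[OF test_in_V[OF t]] closure_form_test_right[OF u t] show ?thesis by (simp add: L2_inner_def)
qed

end

section \<open>Approximation in the graph norm\<close>

text \<open>
  The scalar \<open>s j\<close> is \<open>1\<close> for a first derivative of the cutoff and \<open>eps j\<close> for a second one.
\<close>

lemma scaled_test_vanishes:
  fixes q :: "'a::euclidean_space \<Rightarrow> complex"
  assumes q: "q \<in> Linf" and p: "p \<in> test_functions" and s: "\<And>j. norm (s j) \<le> 1" and g: "g \<in> L2"
  shows "L2_lim (\<lambda>j x. q x * (of_real (eps j) * (s j * p (eps j *\<^sub>R x))) * g x) (\<lambda>x. 0)"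
proof -
  obtain M where M: "0 \<le> M" "AE x in lborel. norm (q x) \<le> M" using q by (rule Linf_bound)
  obtain P where P: "0 < P" "\<And>x. norm (p x) \<le> P" using p by (rule test_bounded) blast
  have [measurable]: "q \<in> borel_measurable borel" "p \<in> borel_measurable borel"
    using q p by (auto intro: Linf_measurable test_measurable)
  have m: "(\<lambda>x. q x * (of_real (eps j) * (s j * p (eps j *\<^sub>R x)))) \<in> borel_measurable borel" for j by measurable
  have b: "AE x in lborel. norm (q x * (of_real (eps j) * (s j * p (eps j *\<^sub>R x)))) \<le> M * P * eps j" for j
    using M(2)
  proof eventually_elim
    case (elim x)
    have "norm (q x) * (eps j * (norm (s j) * norm (p (eps j *\<^sub>R x)))) \<le> M * (eps j * (1 * P))"
      by (intro mult_mono elim s P order_refl) (use M P eps_pos[of j] in auto)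
    then show ?case using eps_pos[of j] by (simp add: norm_mult mult_ac)
  qed
  have c0: "0 \<le> M * P * eps j" for j using M P eps_pos[of j] by simp
  note mb = L2_mult_bounded[OF g m b c0]
  show ?thesis
  proof (rule L2_limI_bound)
    show "(\<lambda>j. M * P * eps j * L2_norm g) \<longlonglongrightarrow> 0"
      using tendsto_mult[OF tendsto_mult[OF tendsto_const eps_tendsto] tendsto_const] by simp
    show "L2_norm (\<lambda>x. q x * (of_real (eps j) * (s j * p (eps j *\<^sub>R x))) * g x - 0) \<le> M * P * eps j * L2_norm g" for j
      using mb(2)[of j] by simp
  qed (use mb(1) in \<open>auto simp: L2_zero\<close>)
qed

lemma L2_lim_cutoff:
  fixes g :: "'a::euclidean_space \<Rightarrow> complex"
  assumes g: "g \<in> L2" and \<chi>: "ch \<in> test_functions" "ch 0 = 1"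
  shows "L2_lim (\<lambda>j x. ch (eps j *\<^sub>R x) * g x) g"
proof -
  obtain P where P: "0 < P" "\<And>x. norm (ch x) \<le> P" using \<chi>(1) by (rule test_bounded) blast
  have [measurable]: "ch \<in> borel_measurable borel" "g \<in> borel_measurable borel"
    using test_measurable[OF \<chi>(1)] L2_measurable[OF g] by auto
  show ?thesis
  proof (rule L2_lim_dominated[OF L2_cmult[OF g, of "of_real P"]])
    show "AE x in lborel. (\<lambda>j. ch (eps j *\<^sub>R x) * g x) \<longlonglongrightarrow> g x"
    proof (rule AE_I2)
      fix x :: 'a
      have "isCont ch 0" using smooth_continuous[OF test_smooth[OF \<chi>(1)], of UNIV]
        by (simp add: continuous_on_eq_continuous_at)
      moreover have "(\<lambda>j. eps j *\<^sub>R x) \<longlonglongrightarrow> 0 *\<^sub>R x" by (rule tendsto_scaleR[OF eps_tendsto tendsto_const])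
      ultimately have "(\<lambda>j. ch (eps j *\<^sub>R x)) \<longlonglongrightarrow> ch 0"
        using isCont_tendsto_compose[of 0 ch "\<lambda>j. eps j *\<^sub>R x"] by simp
      from tendsto_mult[OF this tendsto_const, of "g x"] show "(\<lambda>j. ch (eps j *\<^sub>R x) * g x) \<longlonglongrightarrow> g x"
        by (simp add: \<chi>(2))
    qed
    show "AE x in lborel. norm (ch (eps j *\<^sub>R x) * g x) \<le> norm (of_real P * g x)" for j
      using P by (intro AE_I2) (auto simp: norm_mult intro!: mult_right_mono)
  qed measurable
qed

context elliptic_coefficients
begin

text \<open>
  In \<open>J\<^sub>n f\<close> the weak formulation leaves two derivatives on the mollifier. The weak product rule moves the
  outer one onto \<open>u\<close>, after which the difference from \<open>op (J\<^sub>n u)\<close> is a sum of commutators applied to the weak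
  derivatives of \<open>u\<close>.
\<close>

lemma op_mollification_L2_lim:
  assumes uf: "(u, f) \<in> elliptic_operator c"
    and u': "\<And>k. u' k \<in> L2" "\<And>k. weak_partial_deriv k u (u' k)"
    and \<eta>: "mollifier (\<eta> :: real^'n \<Rightarrow> complex)"
  shows "L2_lim (\<lambda>n. op (conv u (dilate (eps n) \<eta>))) f"
proof -
  define \<eta>n where "\<eta>n n = dilate (eps n) \<eta>" for n
  note \<eta>D = mollifierD[OF \<eta>]
  have uL: "u \<in> L2" and fL: "f \<in> L2"
    using uf by (auto simp: elliptic_operator_def associated_operator_def closure_domain_def)
  have t: "\<eta>n n \<in> test_functions" for n unfolding \<eta>n_def by (intro test_dilate \<eta>D eps_pos)
  define X where "X n x = (\<Sum>k\<in>UNIV. \<Sum>l\<in>UNIV. D l k l x * conv (u' k) (\<eta>n n) x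
      + c k l x * conv (u' k) (dd l (\<eta>n n)) x - conv (\<lambda>y. c k l y * u' k y) (dd l (\<eta>n n)) x)" for n x
  have "L2_lim X (\<lambda>x. \<Sum>k\<in>(UNIV :: 'n set). \<Sum>l\<in>(UNIV :: 'n set). 0)"
    unfolding X_def[abs_def] \<eta>n_def
    by (intro L2_lim_sum finite)
       (rule commutator_L2_lim[OF c_Linf D_Linf D_weak E_Linf E_weak \<eta> u'(1)])
  then have X: "L2_lim X (\<lambda>x. 0)" by simp
  have F: "L2_lim (\<lambda>n. conv f (\<eta>n n)) f"
    using mollify_L2[OF fL smooth_continuous[OF test_smooth[OF \<eta>D(1)]] \<eta>D(2)]
    by (simp add: \<eta>D(4) \<eta>n_def)
  have "op (conv u (\<eta>n n)) x = conv f (\<eta>n n) x - X n x" for n x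
  proof -
    let ?\<psi> = "\<lambda>y. \<eta>n n (x - y)"
    have \<psi>: "?\<psi> \<in> test_functions" by (rule test_reflect[OF t])
    have d\<psi>: "dd l ?\<psi> = (\<lambda>y. - dd l (\<eta>n n) (x - y))" for l
      by (rule ext) (rule dir_deriv_reflect[OF test_smooth[OF t]])
    have i: "integrable lborel (\<lambda>y. u y * (D k k l y * dd l ?\<psi> y + c k l y * dd k (dd l ?\<psi>) y))" for k l
      by (intro L2_mult_integrable L2_add Linf_mult_L2 c_Linf D_Linf test_L2 test_dir_deriv \<psi> uL)
    have "conv f (\<eta>n n) x = (\<integral>y. u y * transposed_op ?\<psi> y \<partial>lborel)"
      unfolding conv_def by (rule operator_weak[OF uf \<psi>])
    also have "\<dots> = (\<integral>y. - (\<Sum>k\<in>UNIV. \<Sum>l\<in>UNIV. u y * (D k k l y * dd l ?\<psi> y + c k l y * dd k (dd l ?\<psi>) y)) \<partial>lborel)"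
      unfolding transposed_op_def by (simp add: sum_distrib_left)
    also have "\<dots> = (\<Sum>k\<in>UNIV. \<Sum>l\<in>UNIV. - (\<integral>y. u y * (D k k l y * dd l ?\<psi> y + c k l y * dd k (dd l ?\<psi>) y) \<partial>lborel))"
      using i by (simp add: sum_negf)
    also have "\<dots> = (\<Sum>k\<in>UNIV. \<Sum>l\<in>UNIV. (\<integral>y. u' k y * (c k l y * dd l ?\<psi> y) \<partial>lborel))"
      using weak_product_rule[OF c_Linf D_Linf D_weak u'(2) test_dir_deriv[OF \<psi>] \<eta>]
      by (simp add: partial_deriv_eq)
    also have "\<dots> = - (\<Sum>k\<in>UNIV. \<Sum>l\<in>UNIV. conv (\<lambda>y. c k l y * u' k y) (dd l (\<eta>n n)) x)"
      by (simp add: d\<psi> conv_def sum_negf mult_ac)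
    finally have fx: "conv f (\<eta>n n) x = - (\<Sum>k\<in>UNIV. \<Sum>l\<in>UNIV. conv (\<lambda>y. c k l y * u' k y) (dd l (\<eta>n n)) x)" .
    have d1: "dd k (conv u (\<eta>n n)) = conv (u' k) (\<eta>n n)" for k by (rule dir_deriv_conv_weak[OF u'(2) t])
    have d2: "dd l (conv (u' k) (\<eta>n n)) = conv (u' k) (dd l (\<eta>n n))" for k l
      by (rule dir_deriv_conv[OF L2_imp_locally_integrable[OF u'(1)] t])
    show ?thesis
      unfolding op_def d1 d2 X_def fx by (simp add: sum_subtractf sum.distrib)
  qed
  then have "(\<lambda>n. op (conv u (\<eta>n n))) = (\<lambda>n x. conv f (\<eta>n n) x - X n x)" by (simp add: fun_eq_iff)
  then show ?thesis using L2_lim_diff[OF F X] by (simp add: \<eta>n_def)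
qed

text \<open>
  In the Leibniz expansion every term except \<open>ch \<cdot> op g\<close> contains a derivative of the dilated
  cutoff.
\<close>

lemma op_cutoff_L2_lim:
  assumes g: "smooth g" "\<And>k. dd k g \<in> L2" "g \<in> L2" "op g \<in> L2"
    and \<chi>: "ch \<in> test_functions" "ch 0 = 1"
  shows "L2_lim (\<lambda>j. op (\<lambda>x. ch (eps j *\<^sub>R x) * g x)) (op g)"
proof -
  define cj where "cj j = (\<lambda>x. ch (eps j *\<^sub>R x))" for j
  have d: "h differentiable at x" if "smooth h" for h :: "real^'n \<Rightarrow> complex" and x
    using that by (rule smooth_differentiable)
  have sc: "smooth ch" by (rule test_smooth[OF \<chi>(1)])
  have dil: "dd k (\<lambda>x. h (e *\<^sub>R x)) = (\<lambda>x. of_real e * dd k h (e *\<^sub>R x))" if "smooth h" for k e and h :: "real^'n \<Rightarrow> complex"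
    using dir_deriv_affine[of h 0 e, OF d[OF that]] by (simp add: fun_eq_iff)
  have sj: "smooth (cj j)" for j unfolding cj_def using smooth_affine[OF sc, of 0 "eps j"] by simp
  have d1: "dd k (cj j) = (\<lambda>x. of_real (eps j) * (1 * dd k ch (eps j *\<^sub>R x)))" for k j
    unfolding cj_def by (simp add: dil sc)
  have d2: "dd l (dd k (cj j)) = (\<lambda>x. of_real (eps j) * (of_real (eps j) * dd l (dd k ch) (eps j *\<^sub>R x)))" for k l j
  proof
    fix x
    have s2: "smooth (\<lambda>x. dd k ch (eps j *\<^sub>R x))"
      using smooth_affine[OF smooth_dir_deriv[OF sc], where a = 0 and r = "eps j"] by simp
    show "dd l (dd k (cj j)) x = of_real (eps j) * (of_real (eps j) * dd l (dd k ch) (eps j *\<^sub>R x))"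
      unfolding d1 using dir_deriv_mult[of "\<lambda>_. of_real (eps j)" x "\<lambda>x. dd k ch (eps j *\<^sub>R x)" "axis l 1",
          OF differentiable_const d[OF s2]]
      by (simp add: dir_deriv_const dil[OF smooth_dir_deriv[OF sc]])
  qed
  \<comment> \<open>All Leibniz terms in which the cutoff is differentiated.\<close>
  define Y where "Y j x = (\<Sum>k\<in>UNIV. \<Sum>l\<in>UNIV. D l k l x * dd k (cj j) x * g x + c k l x * dd l (dd k (cj j)) x * g x
      + c k l x * dd k (cj j) x * dd l g x + c k l x * dd l (cj j) x * dd k g x)" for j x
  have "L2_lim Y (\<lambda>x. \<Sum>k\<in>(UNIV :: 'n set). \<Sum>l\<in>(UNIV :: 'n set). 0 + 0 + 0 + 0)"
    unfolding Y_def[abs_def] d2 unfolding d1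
    by (intro L2_lim_sum L2_lim_add finite scaled_test_vanishes c_Linf D_Linf test_dir_deriv \<chi> g)
       (simp_all add: abs_of_pos[OF eps_pos] eps_le_1)
  then have Y: "L2_lim Y (\<lambda>x. 0)" by simp
  have "op (\<lambda>x. cj j x * g x) x = cj j x * op g x - Y j x" for j x
  proof -
    have e1: "dd k (\<lambda>x. cj j x * g x) = (\<lambda>x. cj j x * dd k g x + dd k (cj j) x * g x)" for k
      by (rule ext) (rule dir_deriv_mult[OF d[OF sj] d[OF g(1)]])
    have e2: "dd l (\<lambda>x. cj j x * dd k g x + dd k (cj j) x * g x) x =
        cj j x * dd l (dd k g) x + dd l (cj j) x * dd k g x + (dd k (cj j) x * dd l g x + dd l (dd k (cj j)) x * g x)" for k l
      using dir_deriv_add[OF d[OF smooth_mult[OF sj[of j] smooth_dir_deriv[OF g(1), of "axis k 1"]]]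
          d[OF smooth_mult[OF smooth_dir_deriv[OF sj[of j], of "axis k 1"] g(1)]], of "axis l 1" x]
        dir_deriv_mult[OF d[OF sj[of j]] d[OF smooth_dir_deriv[OF g(1), of "axis k 1"]], of "axis l 1" x]
        dir_deriv_mult[OF d[OF smooth_dir_deriv[OF sj[of j], of "axis k 1"]] d[OF g(1)], of "axis l 1" x]
      by simp
    have leibniz: "D l k l x * (cj j x * dd k g x + dd k (cj j) x * g x) + c k l x * (cj j x * dd l (dd k g) x + dd l (cj j) x * dd k g x
          + (dd k (cj j) x * dd l g x + dd l (dd k (cj j)) x * g x))
        = cj j x * (D l k l x * dd k g x + c k l x * dd l (dd k g) x)
        + (D l k l x * dd k (cj j) x * g x + c k l x * dd l (dd k (cj j)) x * g x
          + c k l x * dd k (cj j) x * dd l g x + c k l x * dd l (cj j) x * dd k g x)" for k l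
      by (simp add: algebra_simps)
    have split: "(\<Sum>k\<in>UNIV. \<Sum>l\<in>UNIV. a * A k l + B k l)
        = a * (\<Sum>k\<in>UNIV. \<Sum>l\<in>UNIV. A k l) + (\<Sum>k\<in>UNIV. \<Sum>l\<in>UNIV. B k l)"
      for a :: complex and A B :: "'n \<Rightarrow> 'n \<Rightarrow> complex"
      by (simp add: sum.distrib sum_distrib_left)
    show ?thesis unfolding op_def e1 e2 Y_def leibniz split by simp
  qed
  then have "(\<lambda>j. op (\<lambda>x. ch (eps j *\<^sub>R x) * g x)) = (\<lambda>j x. ch (eps j *\<^sub>R x) * op g x - Y j x)"
    by (simp add: fun_eq_iff cj_def)
  then show ?thesis using L2_lim_diff[OF L2_lim_cutoff[OF g(4) \<chi>] Y] by simp
qed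

lemma graph_norm_approximation:
  assumes uf: "(u, f) \<in> elliptic_operator c" and u: "u \<in> sobolev 1 L2" and e: "0 < e"
  obtains v where "v \<in> test_functions" "L2_norm (\<lambda>x. u x - v x) + L2_norm (\<lambda>x. f x - op v x) < e"
proof -
  have "\<exists>g\<in>L2. weak_partial_deriv k u g" for k using u by simp
  then obtain u' where u': "\<And>k. u' k \<in> L2" "\<And>k. weak_partial_deriv k u (u' k)" by metis
  have uL: "u \<in> L2" and fL: "f \<in> L2"
    using uf by (auto simp: elliptic_operator_def associated_operator_def closure_domain_def)
  obtain \<eta> :: "real^'n \<Rightarrow> complex" where \<eta>: "\<eta> \<in> test_functions" "\<And>x. 1 < norm x \<Longrightarrow> \<eta> x = 0"
    "\<And>x. \<eta> x = of_real (norm (\<eta> x))" "\<eta> 0 \<noteq> 0" "(\<integral>x. \<eta> x \<partial>lborel) = 1"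
    using exists_mollifier by blast
  then have m: "mollifier \<eta>" unfolding mollifier_def by blast
  define ch where "ch x = (1 / \<eta> 0) * \<eta> x" for x
  have ch: "ch \<in> test_functions" "ch 0 = 1"
    unfolding ch_def[abs_def] using \<eta>(4) test_cmult[OF \<eta>(1), of "1 / \<eta> 0"] by simp_all
  define un where "un n = conv u (dilate (eps n) \<eta>)" for n
  have t: "dilate (eps n) \<eta> \<in> test_functions" for n by (intro test_dilate \<eta> eps_pos)
  have moll: "L2_lim (\<lambda>n. conv h (dilate (eps n) \<eta>)) h" if "h \<in> L2" for h
    using mollify_L2[OF that smooth_continuous[OF test_smooth[OF \<eta>(1)]] \<eta>(2)] by (simp add: \<eta>(5))
  have l1: "L2_lim un u" unfolding un_def[abs_def] by (rule moll[OF uL])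
  have l2: "L2_lim (\<lambda>n. op (un n)) f" unfolding un_def by (rule op_mollification_L2_lim[OF uf u' m])
  have "eventually (\<lambda>n. L2_norm (\<lambda>x. un n x - u x) < e / 4 \<and> L2_norm (\<lambda>x. op (un n) x - f x) < e / 4) sequentially"
    using e by (intro eventually_conj order_tendstoD(2)[OF L2_limD(3)[OF l1]] order_tendstoD(2)[OF L2_limD(3)[OF l2]]) auto
  then obtain n where n: "L2_norm (\<lambda>x. un n x - u x) < e / 4" "L2_norm (\<lambda>x. op (un n) x - f x) < e / 4"
    by (auto simp: eventually_sequentially)
  define g where "g = un n"
  have gL: "g \<in> L2" "op g \<in> L2" unfolding g_def using L2_limD(1)[OF l1] L2_limD(1)[OF l2] by auto
  have gs: "smooth g" unfolding g_def un_def by (rule smooth_conv[OF L2_imp_locally_integrable[OF uL] t])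
  have gd: "dd k g \<in> L2" for k
    unfolding g_def un_def dir_deriv_conv_weak[OF u'(2) t] by (rule L2_limD(1)[OF moll[OF u'(1)]])
  define v where "v j = (\<lambda>x. ch (eps j *\<^sub>R x) * g x)" for j
  have vt: "v j \<in> test_functions" for j
    unfolding v_def using test_affine[OF ch(1), of "eps j" 0] eps_pos[of j] by (intro test_mult_smooth gs) auto
  have l3: "L2_lim v g" unfolding v_def[abs_def] by (rule L2_lim_cutoff[OF gL(1) ch])
  have l4: "L2_lim (\<lambda>j. op (v j)) (op g)" unfolding v_def by (rule op_cutoff_L2_lim[OF gs gd gL ch])
  have "eventually (\<lambda>j. L2_norm (\<lambda>x. v j x - g x) < e / 4 \<and> L2_norm (\<lambda>x. op (v j) x - op g x) < e / 4) sequentially"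
    using e by (intro eventually_conj order_tendstoD(2)[OF L2_limD(3)[OF l3]] order_tendstoD(2)[OF L2_limD(3)[OF l4]]) auto
  then obtain j where j: "L2_norm (\<lambda>x. v j x - g x) < e / 4" "L2_norm (\<lambda>x. op (v j) x - op g x) < e / 4"
    by (auto simp: eventually_sequentially)
  have "L2_norm (\<lambda>x. u x - v j x) \<le> L2_norm (\<lambda>x. u x - g x) + L2_norm (\<lambda>x. g x - v j x)"
    by (rule L2_norm_triangle_diff[OF uL gL(1) test_L2[OF vt]])
  moreover have "L2_norm (\<lambda>x. f x - op (v j) x) \<le> L2_norm (\<lambda>x. f x - op g x) + L2_norm (\<lambda>x. op g x - op (v j) x)"
    by (rule L2_norm_triangle_diff[OF fL gL(2) op_L2[OF vt]])
  ultimately have "L2_norm (\<lambda>x. u x - v j x) + L2_norm (\<lambda>x. f x - op (v j) x) < e"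
    using n j unfolding g_def[symmetric]
      L2_norm_minus_commute[of u g] L2_norm_minus_commute[of g "v j"]
      L2_norm_minus_commute[of f "op g"] L2_norm_minus_commute[of "op g" "op (v j)"] by linarith
  then show ?thesis using vt that by blast
qed

end

theorem theorem1p3:
  fixes c :: "'n::finite \<Rightarrow> 'n \<Rightarrow> real^'n \<Rightarrow> complex" and \<theta> :: real
  assumes "0 \<le> \<theta>" and "\<theta> < pi / 2"
    and "\<And>k l. c k l \<in> sobolev 2 Linf"
    and "\<And>x \<xi>. cinner_vec (coeff_matrix c x *v \<xi>) \<xi> \<in> sector \<theta>"
    and "Domain (elliptic_operator c) \<subseteq> sobolev 1 L2"
  shows "is_core test_functions (elliptic_operator c)"
proof -
  have c: "c k l \<in> Linf" for k l using assms(3)[of k l] by (simp add: numeral_2_eq_2)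
  have "\<exists>g. g \<in> sobolev 1 Linf \<and> weak_partial_deriv m (c k l) g" for m k l
    using assms(3)[of k l] by (auto simp: numeral_2_eq_2)
  then obtain D where D: "\<And>m k l. D m k l \<in> sobolev 1 Linf" "\<And>m k l. weak_partial_deriv m (c k l) (D m k l)"
    by metis
  have "\<exists>g. g \<in> Linf \<and> weak_partial_deriv p (D m k l) g" for m p k l using D(1)[of m k l] by auto
  note E_ex = this
  define E where "E m p k l = (SOME g. g \<in> Linf \<and> weak_partial_deriv p (D m k l) g)" for m p k l
  have E: "E m p k l \<in> Linf" "weak_partial_deriv p (D m k l) (E m p k l)" for m p k l
    using someI_ex[OF E_ex[of p m k l]] by (simp_all add: E_def)
  interpret elliptic_coefficients c D E \<theta>
    using assms(1,2,4) c D E by unfold_locales auto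
  show ?thesis
    unfolding is_core_def
  proof (intro conjI)
    show "complex_subspace (test_functions :: (real^'n \<Rightarrow> complex) set)"
      by (simp add: complex_subspace_def test_zero test_add test_cmult)
    show "test_functions \<subseteq> Domain (elliptic_operator c)" using test_in_operator by blast
    show "\<forall>(u, f)\<in>elliptic_operator c. \<forall>e>0. \<exists>(v, g)\<in>elliptic_operator c. v \<in> test_functions \<and>
        L2_norm (\<lambda>x. u x - v x) + L2_norm (\<lambda>x. f x - g x) < e"
    proof (clarify)
      fix u f and e :: real assume uf: "(u, f) \<in> elliptic_operator c" and e: "0 < e"
      have "u \<in> sobolev 1 L2" using uf assms(5) by blast
      from graph_norm_approximation[OF uf this e] obtain v where v: "v \<in> test_functions"
        "L2_norm (\<lambda>x. u x - v x) + L2_norm (\<lambda>x. f x - op v x) < e" .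
      then show "\<exists>(v, g)\<in>elliptic_operator c. v \<in> test_functions \<and>
          L2_norm (\<lambda>x. u x - v x) + L2_norm (\<lambda>x. f x - g x) < e"
        using test_in_operator[OF v(1)] by (intro bexI[of _ "(v, op v)"]) auto
    qed
  qed
qed

end
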